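(* Let $G$ be a finite simple graph on the vertex set $[n]=\{1,\dots,n\}$ with at least one edge, let $\mathrm{k}$ be a field, and let $I(G)\subseteq S=\mathrm{k}[x_1,\dots,x_n]$ be its edge ideal. Then $I(G)^3$ has a linear free resolution over $S$ if and only if $G$ is gap-free and $\operatorname{reg} I(G)\le 4$.
   Context: $S=\mathrm{k}[x_1,\dots,x_n]$ is standard graded with maximal homogeneous ideal $\mathfrak m=(x_1,\dots,x_n)$. The edge ideal is $I(G)=(x_ix_j \mid \{i,j\}\in E(G))\subseteq S$. A gap in $G$ is a pair of disjoint edges forming an induced subgraph of $G$ (i.e. edges $\{a,b\},\{c,d\}$ on four distinct vertices with no other edge of $G$ among $a,b,c,d$); $G$ is gap-free if it has no gaps. For a finitely generated graded $S$-module $L$, $\operatorname{reg}(L)=\max\{i+j\mid H^i_{\mathfrak m}(L)_j\neq 0\}$ is the Castelnuovo-Mumford regularity; for a nonzero proper homogeneous ideal $J$, $\operatorname{reg}(J)=\operatorname{reg}(S/J)+1$. For $s\ge 1$, $I(G)^s$ is generated in degree $2s$, and it has a linear (free) resolution if and only if $\operatorname{reg} I(G)^s=2s$. *)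

theory Defs
  imports
    "HOL-Library.Poly_Mapping"
    "Jordan_Normal_Form.Matrix"
begin

section \<open>The standard graded polynomial ring\<close>

text \<open>
  The ring \<open>S\<close> is the whole type of polynomials with indeterminates indexed by a finite linearly
  ordered type \<open>'v\<close>, which plays the role of \<open>{1,\<dots>,n}\<close>. The order is only used for the signs in
  the Cech complex.
\<close>

type_synonym ('v, 'k) mpoly = "('v \<Rightarrow>\<^sub>0 nat) \<Rightarrow>\<^sub>0 'k"

definition var :: "'v \<Rightarrow> ('v, 'k::comm_ring_1) mpoly" where
  "var v = Poly_Mapping.single (Poly_Mapping.single v 1) 1"

text \<open>The zero polynomial is homogeneous of every degree, and the only one in negative degrees.\<close>

definition homogeneous :: "int \<Rightarrow> ('v::finite, 'k::comm_ring_1) mpoly \<Rightarrow> bool" where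
  "homogeneous d f \<longleftrightarrow>
    (\<forall>t \<in> Poly_Mapping.keys f. int (\<Sum>v\<in>UNIV. Poly_Mapping.lookup t v) = d)"

definition ideal_gen :: "'a::comm_ring_1 set \<Rightarrow> 'a set" where
  "ideal_gen B = Modules.module.span (*) B"

primrec ideal_power :: "'a::comm_ring_1 set \<Rightarrow> nat \<Rightarrow> 'a set" where
  "ideal_power J 0 = UNIV"
| "ideal_power J (Suc s) = ideal_gen {a * b | a b. a \<in> J \<and> b \<in> ideal_power J s}"


section \<open>Graphs and edge ideals\<close>

definition simple_graph :: "'v set set \<Rightarrow> bool" where
  "simple_graph E \<longleftrightarrow> (\<forall>e\<in>E. card e = 2)"

definition is_gap :: "'v set set \<Rightarrow> 'v set \<Rightarrow> 'v set \<Rightarrow> bool" where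
  "is_gap E e e' \<longleftrightarrow> e \<in> E \<and> e' \<in> E \<and> e \<inter> e' = {} \<and> {h \<in> E. h \<subseteq> e \<union> e'} = {e, e'}"

definition gap_free :: "'v set set \<Rightarrow> bool" where
  "gap_free E \<longleftrightarrow> \<not> (\<exists>e e'. is_gap E e e')"

definition edge_ideal :: "'v set set \<Rightarrow> ('v, 'k::comm_ring_1) mpoly set" where
  "edge_ideal E = ideal_gen {var i * var j | i j. {i, j} \<in> E}"


section \<open>Linear free resolutions\<close>

text \<open>
  A graded free resolution of the ideal \<open>J\<close> by finitely generated free modules
  \<open>F\<^sub>i = \<Oplus>\<^bsub>l < r i\<^esub> S(- a i l)\<close>: the augmentation \<open>F\<^sub>0 \<rightarrow> J\<close> sends the \<open>l\<close>-th basis element to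
  \<open>e $ l\<close>, and \<open>\<phi> i\<close> is the matrix of \<open>F\<^bsub>i+1\<^esub> \<rightarrow> F\<^sub>i\<close>. All maps preserve degrees.
\<close>

definition graded_free_resolution ::
  "('v::finite, 'k::comm_ring_1) mpoly set \<Rightarrow> (nat \<Rightarrow> nat) \<Rightarrow> (nat \<Rightarrow> nat \<Rightarrow> int) \<Rightarrow>
    ('v, 'k) mpoly vec \<Rightarrow> (nat \<Rightarrow> ('v, 'k) mpoly mat) \<Rightarrow> bool" where
  "graded_free_resolution J r a e \<phi> \<longleftrightarrow>
    e \<in> carrier_vec (r 0) \<and>
    (\<forall>l < r 0. homogeneous (a 0 l) (e $ l)) \<and>
    (\<forall>i. \<phi> i \<in> carrier_mat (r i) (r (Suc i))) \<and>
    (\<forall>i. \<forall>k < r i. \<forall>l < r (Suc i). homogeneous (a (Suc i) l - a i k) (\<phi> i $$ (k, l))) \<and>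
    {e \<bullet> c | c. c \<in> carrier_vec (r 0)} = J \<and>
    {c \<in> carrier_vec (r 0). e \<bullet> c = 0} = {\<phi> 0 *\<^sub>v c | c. c \<in> carrier_vec (r 1)} \<and>
    (\<forall>i. {c \<in> carrier_vec (r (Suc i)). \<phi> i *\<^sub>v c = 0\<^sub>v (r i)} =
         {\<phi> (Suc i) *\<^sub>v c | c. c \<in> carrier_vec (r (Suc (Suc i)))})"

text \<open>
  Linearity: \<open>F\<^sub>i = S(-d-i)\<^bsup>r i\<^esup>\<close> for all \<open>i\<close>, where \<open>d\<close> is the generating degree. All entries of
  the matrices are then linear forms, so such a resolution is automatically minimal.
\<close>

definition has_linear_free_resolution :: "('v::finite, 'k::comm_ring_1) mpoly set \<Rightarrow> bool" where
  "has_linear_free_resolution J \<longleftrightarrow>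
    (\<exists>d r e \<phi>. graded_free_resolution J r (\<lambda>i l. d + int i) e \<phi>)"


section \<open>Local cohomology and Castelnuovo-Mumford regularity\<close>

text \<open>
  A graded \<open>S\<close>-module \<open>L\<close> is given by its scalar multiplication \<open>scale\<close> and its graded pieces \<open>gr j\<close>
  inside an ambient abelian group. Its local cohomology with respect to the maximal homogeneous
  ideal is the cohomology of the Cech complex on the indeterminates, with terms
  \<open>C\<^sup>p = \<Oplus>\<^bsub>card \<sigma> = p\<^esub> L\<^bsub>x\<sigma>\<^esub>\<close>, where \<open>x\<sigma>\<close> is the product of the indeterminates in \<open>\<sigma>\<close>.

  A pair \<open>(N, m)\<close> represents the element of \<open>C\<^sup>p\<close> with component \<open>m \<sigma> / x\<sigma>\<^sup>N\<close> at \<open>\<sigma>\<close>; since \<open>C\<^sup>p\<close> is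
  a finite direct sum, every element can be written with such a common exponent. The values of \<open>m\<close>
  at sets of cardinality other than \<open>p\<close> are irrelevant. The element has degree \<open>j\<close> when \<open>m \<sigma>\<close> has
  degree \<open>j + N p\<close>.
\<close>

definition var_prod :: "'v set \<Rightarrow> ('v, 'k::comm_ring_1) mpoly" where
  "var_prod \<sigma> = (\<Prod>v\<in>\<sigma>. var v)"

definition cech_cochains :: "(int \<Rightarrow> 'm set) \<Rightarrow> nat \<Rightarrow> int \<Rightarrow> (nat \<times> ('v set \<Rightarrow> 'm)) set" where
  "cech_cochains gr p j = {(N, m). \<forall>\<sigma>. card \<sigma> = p \<longrightarrow> m \<sigma> \<in> gr (j + int (N * p))}"

text \<open>
  Equality in \<open>C\<^sup>p\<close>: fractions \<open>m / x\<sigma>\<^sup>N\<close> and \<open>m' / x\<sigma>\<^sup>N'\<close> agree in the localization iff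
  \<open>x\<sigma>\<^sup>M (x\<sigma>\<^sup>N' m - x\<sigma>\<^sup>N m') = 0\<close> for some \<open>M\<close>.
\<close>

definition cech_eq ::
  "(('v, 'k::comm_ring_1) mpoly \<Rightarrow> 'm \<Rightarrow> 'm) \<Rightarrow> nat \<Rightarrow>
    nat \<times> ('v set \<Rightarrow> 'm) \<Rightarrow> nat \<times> ('v set \<Rightarrow> 'm) \<Rightarrow> bool" where
  "cech_eq scale p c c' \<longleftrightarrow> (\<forall>\<sigma>. card \<sigma> = p \<longrightarrow>
    (\<exists>M. scale (var_prod \<sigma> ^ (M + fst c')) (snd c \<sigma>) = scale (var_prod \<sigma> ^ (M + fst c)) (snd c' \<sigma>)))"

text \<open>
  The \<open>\<tau>\<close>-component of the differential is the alternating sum over \<open>i \<in> \<tau>\<close> of the images of the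
  components at \<open>\<tau> - {i}\<close>; over the common denominator, \<open>m / x(\<tau>-{i})\<^sup>N = x\<^sub>i\<^sup>N m / x\<tau>\<^sup>N\<close>.
\<close>

definition cech_diff ::
  "(('v::{finite,linorder}, 'k::comm_ring_1) mpoly \<Rightarrow> 'm::ab_group_add \<Rightarrow> 'm) \<Rightarrow>
    nat \<times> ('v set \<Rightarrow> 'm) \<Rightarrow> nat \<times> ('v set \<Rightarrow> 'm)" where
  "cech_diff scale c = (fst c, \<lambda>\<tau>. \<Sum>i\<in>\<tau>.
     scale ((- 1) ^ card {l \<in> \<tau>. l < i} * var i ^ fst c) (snd c (\<tau> - {i})))"

definition cech_cocycles ::
  "(('v::{finite,linorder}, 'k::comm_ring_1) mpoly \<Rightarrow> 'm::ab_group_add \<Rightarrow> 'm) \<Rightarrow>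
    (int \<Rightarrow> 'm set) \<Rightarrow> nat \<Rightarrow> int \<Rightarrow> (nat \<times> ('v set \<Rightarrow> 'm)) set" where
  "cech_cocycles scale gr p j =
    {c \<in> cech_cochains gr p j. cech_eq scale (Suc p) (cech_diff scale c) (0, \<lambda>_. 0)}"

definition cech_coboundaries ::
  "(('v::{finite,linorder}, 'k::comm_ring_1) mpoly \<Rightarrow> 'm::ab_group_add \<Rightarrow> 'm) \<Rightarrow>
    (int \<Rightarrow> 'm set) \<Rightarrow> nat \<Rightarrow> int \<Rightarrow> (nat \<times> ('v set \<Rightarrow> 'm)) set" where
  "cech_coboundaries scale gr p j = {c \<in> cech_cochains gr p j.
    (case p of
       0 \<Rightarrow> cech_eq scale 0 c (0, \<lambda>_. 0)
     | Suc q \<Rightarrow> \<exists>b \<in> cech_cochains gr q j. cech_eq scale p c (cech_diff scale b))}"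

text \<open>The graded piece of degree \<open>j\<close> of the \<open>p\<close>-th local cohomology module is nonzero.\<close>

definition local_cohomology_nonzero ::
  "(('v::{finite,linorder}, 'k::comm_ring_1) mpoly \<Rightarrow> 'm::ab_group_add \<Rightarrow> 'm) \<Rightarrow>
    (int \<Rightarrow> 'm set) \<Rightarrow> nat \<Rightarrow> int \<Rightarrow> bool" where
  "local_cohomology_nonzero scale gr p j \<longleftrightarrow>
    \<not> cech_cocycles scale gr p j \<subseteq> cech_coboundaries scale gr p j"

text \<open>For a nonzero finitely generated graded module over a field the maximum below exists.\<close>

definition regularity ::
  "(('v::{finite,linorder}, 'k::comm_ring_1) mpoly \<Rightarrow> 'm::ab_group_add \<Rightarrow> 'm) \<Rightarrow>
    (int \<Rightarrow> 'm set) \<Rightarrow> int" where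
  "regularity scale gr =
    (GREATEST r. \<exists>i j. r = int i + j \<and> local_cohomology_nonzero scale gr i j)"

text \<open>The regularity of a homogeneous ideal is its regularity as a graded module.\<close>

definition ideal_reg :: "('v::{finite,linorder}, 'k::comm_ring_1) mpoly set \<Rightarrow> int" where
  "ideal_reg J = regularity (*) (\<lambda>j. {f \<in> J. homogeneous j f})"

end

theory Submission
  imports Defs "HOL-Library.Function_Algebras"
begin

text \<open>
  Both conditions concern the cohomology of families of vertex sets. Call \<open>box X lo hi\<close> the
  family of those \<open>\<sigma>\<close> for which the exponent vector equal to \<open>hi\<close> on \<open>\<sigma>\<close> and to \<open>lo\<close> off \<open>\<sigma>\<close>
  belongs to the exponent set \<open>X\<close> of a monomial ideal. The boxes with \<open>hi = lo + 1\<close> compute the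
  multigraded pieces of Koszul cohomology, hence decide whether a linear resolution exists, and the
  boxes with \<open>hi\<close> a large constant compute those of local cohomology. Splitting a box along one
  coordinate (Mayer-Vietoris) shows that one kind has no cohomology above a given total degree iff
  the other has none.

  For the cube of the edge ideal of a gap-free graph and a multidegree \<open>a\<close> with negative part \<open>N\<close>,
  take \<open>a v\<close> clones of each vertex \<open>v\<close>, and let \<open>m\<close> be the number of clones. The Cech box consists
  of the \<open>\<sigma> \<supseteq> N\<close> that contain an edge or whose neighbourhood meets every set of a certain family of
  admissible sets of clones, described by matchings. For \<open>m \<le> 2\<close> the empty set is admissible, so the
  box is a strand of the edge ideal itself and vanishing in these multidegrees means regularity at
  most 4. For \<open>m \<ge> 3\<close> a special case of Gallai's lemma leaves so few admissible sets that the
  required vanishing always holds. Conversely, a gap produces a Koszul strand which is the cochain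
  complex of a 4-cycle.
\<close>

section \<open>The Koszul differential\<close>

text \<open>Cech boxes are easier to describe than Koszul boxes: once \<open>hi\<close> is at least
  3, a vertex of \<sigma> may occur in all three edges of a product, so only the exponents off
  \<sigma> restrict the choice of edges, and clones turn this restriction into a matching problem.
  Total degrees are compared with 6 = 2 * 3, the generating degree of the cube. With negative part
  \<open>N\<close> and \<open>m\<close> clones the total degree of a strand is
  \<open>p - card N + m\<close>, so vanishing is due for \<open>p > card N + 6 - m\<close>. For
  \<open>m = 2\<close> this reads \<open>p > card N + 4\<close>, the origin of the regularity bound
  4; fewer clones ask for less. The obstacle for \<open>m \<ge> 3\<close> is that every additional
  minimal admissible set may cost a cohomological degree, while the room shrinks as \<open>m\<close>
  grows. The matching lemmas therefore have to bound the number and the overlaps of these sets,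
  after deletion of the clones that do not matter.\<close>

definition koszul_diff :: "('v::linorder \<Rightarrow> 'k::comm_ring_1) \<Rightarrow> ('v set \<Rightarrow> 'k) \<Rightarrow> 'v set \<Rightarrow> 'k" where
  "koszul_diff w f \<tau> = (\<Sum>i\<in>\<tau>. (- 1) ^ card {l \<in> \<tau>. l < i} * w i * f (\<tau> - {i}))"

text \<open>Deleting the smaller index first moves \<open>j\<close> down by one position, while
  deleting the larger one leaves the position of \<open>i\<close> unchanged.\<close>

lemma position_sign_swap:
  fixes i j :: "'v::linorder"
  assumes "finite \<tau>" "i \<in> \<tau>" "j \<in> \<tau>" "i < j"
  shows "(- 1 :: 'k::comm_ring_1) ^ card {l \<in> \<tau>. l < i} * (- 1) ^ card {l \<in> \<tau> - {i}. l < j}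
    = - ((- 1) ^ card {l \<in> \<tau>. l < j} * (- 1) ^ card {l \<in> \<tau> - {j}. l < i})"
proof -
  have "{l \<in> \<tau>. l < j} = insert i {l \<in> \<tau> - {i}. l < j}" using assms by auto
  then have 1: "card {l \<in> \<tau>. l < j} = Suc (card {l \<in> \<tau> - {i}. l < j})"
    using assms by simp
  have "{l \<in> \<tau> - {j}. l < i} = {l \<in> \<tau>. l < i}" using assms by auto
  then show ?thesis unfolding 1 by simp
qed

text \<open>The terms for \<open>(i, j)\<close> and \<open>(j, i)\<close> delete the same pair with
  opposite signs. The weights stay general because the differential occurs with weights 1 for set
  families, \<open>var i\<close> for the Koszul complex and \<open>var i ^ N\<close> for the Cech
  complex.\<close>

lemma koszul_diff_koszul_diff:
  fixes w :: "'v::linorder \<Rightarrow> 'k::comm_ring_1"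
  assumes "finite \<tau>"
  shows "koszul_diff w (koszul_diff w f) \<tau> = 0"
proof -
  define T where "T i j = (- 1 :: 'k) ^ card {l \<in> \<tau>. l < i} * (- 1) ^ card {l \<in> \<tau> - {i}. l < j} *
    (w i * w j * f (\<tau> - {i, j}))" for i j
  have "koszul_diff w (koszul_diff w f) \<tau> = (\<Sum>i\<in>\<tau>. \<Sum>j\<in>\<tau> - {i}. T i j)"
    unfolding koszul_diff_def T_def sum_distrib_left
    by (intro sum.cong refl) (simp add: algebra_simps insert_commute Diff_insert[symmetric])
  also have "\<dots> = (\<Sum>(i, j)\<in>Sigma \<tau> (\<lambda>i. \<tau> - {i}). T i j)"
    using assms by (subst sum.Sigma) auto
  also have "Sigma \<tau> (\<lambda>i. \<tau> - {i}) = {(i, j). i \<in> \<tau> \<and> j \<in> \<tau> \<and> i < j} \<union> {(i, j). i \<in> \<tau> \<and> j \<in> \<tau> \<and> j < i}"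
    by auto
  also have "(\<Sum>(i, j)\<in>\<dots>. T i j) = (\<Sum>(i, j)\<in>{(i, j). i \<in> \<tau> \<and> j \<in> \<tau> \<and> i < j}. T i j)
      + (\<Sum>(i, j)\<in>{(i, j). i \<in> \<tau> \<and> j \<in> \<tau> \<and> j < i}. T i j)"
    by (rule sum.union_disjoint) (auto intro: finite_subset[OF _ finite_cartesian_product[OF assms assms]])
  also have "(\<Sum>(i, j)\<in>{(i, j). i \<in> \<tau> \<and> j \<in> \<tau> \<and> j < i}. T i j)
      = (\<Sum>(i, j)\<in>{(i, j). i \<in> \<tau> \<and> j \<in> \<tau> \<and> i < j}. T j i)"
    by (rule sum.reindex_bij_witness[of _ "\<lambda>(i, j). (j, i)" "\<lambda>(i, j). (j, i)"]) auto
  also have "\<dots> = (\<Sum>(i, j)\<in>{(i, j). i \<in> \<tau> \<and> j \<in> \<tau> \<and> i < j}. - T i j)"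
  proof (intro sum.cong refl, clarify)
    fix i j assume *: "i \<in> \<tau>" "j \<in> \<tau>" "i < j"
    have "w j * w i * f (\<tau> - {j, i}) = w i * w j * f (\<tau> - {i, j})"
      by (simp add: mult.commute insert_commute)
    then show "T j i = - T i j"
      unfolding T_def using position_sign_swap[OF assms *, where 'k='k] by simp
  qed
  finally show ?thesis by (simp add: case_prod_unfold sum_negf)
qed

lemma koszul_diff_diff: "koszul_diff w (\<lambda>\<sigma>. f \<sigma> - g \<sigma>) \<tau> = koszul_diff w f \<tau> - koszul_diff w g \<tau>"
  unfolding koszul_diff_def by (simp add: right_diff_distrib sum_subtractf)

lemma koszul_diff_add: "koszul_diff w (\<lambda>\<sigma>. f \<sigma> + g \<sigma>) \<tau> = koszul_diff w f \<tau> + koszul_diff w g \<tau>"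
  unfolding koszul_diff_def by (simp add: distrib_left sum.distrib)

text \<open>Cochains are functions on all sets, but the value at \<tau> sees only sets with one
  element less. This licenses cutting a cochain down to one cardinality when an identity is known
  only there.\<close>

lemma koszul_diff_cong:
  assumes "\<And>\<sigma>. finite \<tau> \<Longrightarrow> Suc (card \<sigma>) = card \<tau> \<Longrightarrow> f \<sigma> = g \<sigma>"
  shows "koszul_diff w f \<tau> = koszul_diff w g \<tau>"
proof (cases "finite \<tau>")
  case True
  show ?thesis unfolding koszul_diff_def
  proof (intro sum.cong refl arg_cong2[where f = "(*)"] assms)
    fix i assume "i \<in> \<tau>"
    then show "Suc (card (\<tau> - {i})) = card \<tau>" using card_Suc_Diff1[OF True] by blast
  qed (rule True)
qed (simp add: koszul_diff_def)

section \<open>Cohomology of upward closed set families\<close>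

definition upset :: "'v set set \<Rightarrow> bool" where
  "upset U \<longleftrightarrow> (\<forall>\<sigma>\<in>U. \<forall>\<tau>. \<sigma> \<subseteq> \<tau> \<longrightarrow> \<tau> \<in> U)"

text \<open>
  With unit weights \<open>koszul_diff\<close> is the simplicial coboundary. For an upward closed \<open>U\<close> the
  cochains vanishing off \<open>U\<close> are those of the full simplex relative to the complement of \<open>U\<close>.
\<close>

definition vanishes :: "'k::comm_ring_1 itself \<Rightarrow> 'v::{finite,linorder} set set \<Rightarrow> nat \<Rightarrow> bool" where
  "vanishes K U p \<longleftrightarrow> (\<forall>f :: 'v set \<Rightarrow> 'k. (\<forall>\<sigma>. \<sigma> \<notin> U \<longrightarrow> f \<sigma> = 0) \<longrightarrow>
     (\<forall>\<tau>. card \<tau> = Suc p \<longrightarrow> koszul_diff (\<lambda>_. 1) f \<tau> = 0) \<longrightarrow>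
     (\<exists>g. (\<forall>\<sigma>. \<sigma> \<notin> U \<longrightarrow> g \<sigma> = 0) \<and> (\<forall>\<sigma>. card \<sigma> = p \<longrightarrow> f \<sigma> = koszul_diff (\<lambda>_. 1) g \<sigma>)))"

lemma vanishesI:
  assumes "\<And>f :: 'v::{finite,linorder} set \<Rightarrow> 'k::comm_ring_1. (\<And>\<sigma>. \<sigma> \<notin> U \<Longrightarrow> f \<sigma> = 0) \<Longrightarrow>
     (\<And>\<tau>. card \<tau> = Suc p \<Longrightarrow> koszul_diff (\<lambda>_. 1) f \<tau> = 0) \<Longrightarrow>
     \<exists>g. (\<forall>\<sigma>. \<sigma> \<notin> U \<longrightarrow> g \<sigma> = 0) \<and> (\<forall>\<sigma>. card \<sigma> = p \<longrightarrow> f \<sigma> = koszul_diff (\<lambda>_. 1) g \<sigma>)"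
  shows "vanishes TYPE('k) U p"
  unfolding vanishes_def using assms by blast

lemma vanishesE:
  fixes f :: "'v::{finite,linorder} set \<Rightarrow> 'k::comm_ring_1"
  assumes "vanishes TYPE('k) U p" "\<And>\<sigma>. \<sigma> \<notin> U \<Longrightarrow> f \<sigma> = 0"
     "\<And>\<tau>. card \<tau> = Suc p \<Longrightarrow> koszul_diff (\<lambda>_. 1) f \<tau> = 0"
  obtains g where "\<And>\<sigma>. \<sigma> \<notin> U \<Longrightarrow> g \<sigma> = 0" "\<And>\<sigma>. card \<sigma> = p \<Longrightarrow> f \<sigma> = koszul_diff (\<lambda>_. 1) g \<sigma>"
  using assms unfolding vanishes_def by metis

text \<open>Here upward closure enters: subsets of a set outside \<open>U\<close> are outside
  \<open>U\<close>, so the cochains vanishing off \<open>U\<close> form a subcomplex.\<close>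

lemma koszul_diff_supported:
  assumes "upset U" "\<And>\<sigma>. \<sigma> \<notin> U \<Longrightarrow> f \<sigma> = 0" "\<tau> \<notin> U"
  shows "koszul_diff w f \<tau> = 0"
proof -
  have "f (\<tau> - {i}) = 0" for i
    using assms unfolding upset_def by (metis Diff_subset)
  then show ?thesis by (simp add: koszul_diff_def)
qed

lemma vanishes_if_none:
  fixes U :: "'v::{finite,linorder} set set"
  assumes "\<And>\<sigma>. \<sigma> \<in> U \<Longrightarrow> card \<sigma> \<noteq> p"
  shows "vanishes TYPE('k::comm_ring_1) U p"
proof (rule vanishesI)
  fix f :: "'v set \<Rightarrow> 'k" assume "\<And>\<sigma>. \<sigma> \<notin> U \<Longrightarrow> f \<sigma> = 0"
  then show "\<exists>g. (\<forall>\<sigma>. \<sigma> \<notin> U \<longrightarrow> g \<sigma> = 0) \<and> (\<forall>\<sigma>. card \<sigma> = p \<longrightarrow> f \<sigma> = koszul_diff (\<lambda>_. 1) g \<sigma>)"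
    using assms by (intro exI[of _ "\<lambda>_. 0"]) (auto simp: koszul_diff_def)
qed

text \<open>Contracting homotopy: \<open>f \<mapsto> (\<sigma> \<mapsto> \<plusminus> f (\<sigma> \<union> {x}))\<close> for \<open>x \<notin> \<sigma>\<close>.\<close>

lemma vanishes_toggle:
  fixes x :: "'v::{finite,linorder}"
  assumes tog: "\<And>\<sigma>. x \<notin> \<sigma> \<Longrightarrow> insert x \<sigma> \<in> U \<longleftrightarrow> \<sigma> \<in> U"
  shows "vanishes TYPE('k::comm_ring_1) U p"
proof (rule vanishesI)
  fix f :: "'v set \<Rightarrow> 'k"
  assume supp: "\<And>\<sigma>. \<sigma> \<notin> U \<Longrightarrow> f \<sigma> = 0"
    and cyc: "\<And>\<tau>. card \<tau> = Suc p \<Longrightarrow> koszul_diff (\<lambda>_. 1) f \<tau> = 0"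
  define s where "s i \<tau> = (- 1 :: 'k) ^ card {l \<in> \<tau>. l < i}" for i :: 'v and \<tau>
  have ss: "s i \<tau> * (s i \<tau> * c) = c" for i \<tau> c
    unfolding s_def by (simp flip: mult.assoc power_add mult_2)
  define g where "g \<sigma> = (if x \<in> \<sigma> then 0 else s x (insert x \<sigma>) * f (insert x \<sigma>))" for \<sigma>
  have "f \<sigma> = koszul_diff (\<lambda>_. 1) g \<sigma>" if c: "card \<sigma> = p" for \<sigma>
  proof (cases "x \<in> \<sigma>")
    case True
    have "koszul_diff (\<lambda>_. 1) g \<sigma> = (\<Sum>i\<in>\<sigma>. if i = x then s x \<sigma> * g (\<sigma> - {x}) else 0)"
      unfolding koszul_diff_def s_def by (rule sum.cong) (use True in \<open>auto simp: g_def\<close>)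
    also have "\<dots> = f \<sigma>" using True by (simp add: g_def insert_absorb ss)
    finally show ?thesis by simp
  next
    case False
    have "0 = koszul_diff (\<lambda>_. 1) f (insert x \<sigma>)"
      using cyc[of "insert x \<sigma>"] False c by simp
    also have "\<dots> = s x (insert x \<sigma>) * f \<sigma> + (\<Sum>i\<in>\<sigma>. s i (insert x \<sigma>) * f (insert x \<sigma> - {i}))"
      using False by (simp add: koszul_diff_def s_def)
    finally have e: "s x (insert x \<sigma>) * f \<sigma> = - (\<Sum>i\<in>\<sigma>. s i (insert x \<sigma>) * f (insert x \<sigma> - {i}))"
      by (intro eq_neg_iff_add_eq_0[THEN iffD2]) (rule sym)
    have "koszul_diff (\<lambda>_. 1) g \<sigma> = (\<Sum>i\<in>\<sigma>. s x (insert x \<sigma>) * - (s i (insert x \<sigma>) * f (insert x \<sigma> - {i})))"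
      unfolding koszul_diff_def
    proof (rule sum.cong[OF refl])
      fix i assume i: "i \<in> \<sigma>"
      have ix: "i \<noteq> x" using i False by auto
      have eq: "insert x (\<sigma> - {i}) = insert x \<sigma> - {i}" using ix by auto
      \<comment> \<open>Of \<open>i\<close> and \<open>x\<close>, only the larger one changes its
        position when the other is removed, so exactly one sign flips.\<close>
      have "s i \<sigma> * s x (insert x \<sigma> - {i}) = - (s x (insert x \<sigma>) * s i (insert x \<sigma>))"
      proof (cases "i < x")
        case True
        have "{l \<in> insert x \<sigma>. l < i} = {l \<in> \<sigma>. l < i}" using True by auto
        then have 1: "s i (insert x \<sigma>) = s i \<sigma>" by (simp add: s_def)
        have "s i (insert x \<sigma>) * s x (insert x \<sigma> - {i}) = - (s x (insert x \<sigma>) * s i (insert x \<sigma> - {x}))"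
          unfolding s_def using position_sign_swap[of "insert x \<sigma>" i x, where 'k='k] True i by simp
        moreover have "insert x \<sigma> - {x} = \<sigma>" using False by auto
        ultimately show ?thesis using 1 by simp
      next
        case F: False
        then have xi: "x < i" using ix by auto
        have "insert x \<sigma> - {x} = \<sigma>" using False by auto
        then have "s x (insert x \<sigma>) * s i \<sigma> = - (s i (insert x \<sigma>) * s x (insert x \<sigma> - {i}))"
          using position_sign_swap[of "insert x \<sigma>" x i, where 'k='k] xi i
          unfolding s_def by (metis finite insertI1 insertI2)
        moreover have "{l \<in> insert x \<sigma> - {i}. l < x} = {l \<in> insert x \<sigma>. l < x}" using F by auto
        then have "s x (insert x \<sigma> - {i}) = s x (insert x \<sigma>)" by (simp add: s_def)
        ultimately show ?thesis by (simp add: mult.commute)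
      qed
      then show "(- 1) ^ card {l \<in> \<sigma>. l < i} * 1 * g (\<sigma> - {i}) =
          s x (insert x \<sigma>) * - (s i (insert x \<sigma>) * f (insert x \<sigma> - {i}))"
        using False unfolding g_def eq s_def[of i \<sigma>, symmetric]
        by (simp flip: mult.assoc)
    qed
    also have "\<dots> = s x (insert x \<sigma>) * (s x (insert x \<sigma>) * f \<sigma>)"
      unfolding e by (simp add: sum_distrib_left sum_negf)
    finally show ?thesis by (simp add: ss)
  qed
  moreover have "g \<sigma> = 0" if "\<sigma> \<notin> U" for \<sigma>
    unfolding g_def using supp tog that by auto
  ultimately show "\<exists>g. (\<forall>\<sigma>. \<sigma> \<notin> U \<longrightarrow> g \<sigma> = 0) \<and> (\<forall>\<sigma>. card \<sigma> = p \<longrightarrow> f \<sigma> = koszul_diff (\<lambda>_. 1) g \<sigma>)"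
    by blast
qed

text \<open>Mayer-Vietoris for the cochains supported on the intersection, on \<open>U\<close> and
  \<open>V\<close> separately, and on the union: a class on the intersection that dies on both sides
  comes from the union one degree lower. For \<open>p = 0\<close> all coboundaries are zero, so that
  case is settled before \<open>p - 1\<close> matters.\<close>

lemma vanishes_Int:
  fixes U V :: "'v::{finite,linorder} set set"
  assumes up: "upset U" "upset V"
    and "vanishes TYPE('k::comm_ring_1) U p" "vanishes TYPE('k) V p" "vanishes TYPE('k) (U \<union> V) (p - 1)"
  shows "vanishes TYPE('k) (U \<inter> V) p"
proof (rule vanishesI)
  fix f :: "'v set \<Rightarrow> 'k"
  assume supp: "\<And>\<sigma>. \<sigma> \<notin> U \<inter> V \<Longrightarrow> f \<sigma> = 0"
    and cyc: "\<And>\<tau>. card \<tau> = Suc p \<Longrightarrow> koszul_diff (\<lambda>_. 1) f \<tau> = 0"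
  obtain g1 where g1: "\<And>\<sigma>. \<sigma> \<notin> U \<Longrightarrow> g1 \<sigma> = 0" "\<And>\<sigma>. card \<sigma> = p \<Longrightarrow> f \<sigma> = koszul_diff (\<lambda>_. 1) g1 \<sigma>"
    using vanishesE[OF assms(3), of f] supp cyc by blast
  obtain g2 where g2: "\<And>\<sigma>. \<sigma> \<notin> V \<Longrightarrow> g2 \<sigma> = 0" "\<And>\<sigma>. card \<sigma> = p \<Longrightarrow> f \<sigma> = koszul_diff (\<lambda>_. 1) g2 \<sigma>"
    using vanishesE[OF assms(4), of f] supp cyc by blast
  show "\<exists>g. (\<forall>\<sigma>. \<sigma> \<notin> U \<inter> V \<longrightarrow> g \<sigma> = 0) \<and> (\<forall>\<sigma>. card \<sigma> = p \<longrightarrow> f \<sigma> = koszul_diff (\<lambda>_. 1) g \<sigma>)"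
  proof (cases p)
    case 0
    then have "f \<sigma> = 0" if "card \<sigma> = p" for \<sigma>
      using g1(2)[OF that] that by (simp add: koszul_diff_def)
    then show ?thesis by (intro exI[of _ "\<lambda>_. 0"]) (auto simp: koszul_diff_def)
  next
    case (Suc q)
    have "koszul_diff (\<lambda>_. 1) (\<lambda>\<sigma>. g1 \<sigma> - g2 \<sigma>) \<tau> = 0" if "card \<tau> = Suc (p - 1)" for \<tau>
      using g1(2)[of \<tau>] g2(2)[of \<tau>] that Suc by (simp add: koszul_diff_diff)
    then obtain h where h: "\<And>\<sigma>. \<sigma> \<notin> U \<union> V \<Longrightarrow> h \<sigma> = 0"
      "\<And>\<sigma>. card \<sigma> = p - 1 \<Longrightarrow> g1 \<sigma> - g2 \<sigma> = koszul_diff (\<lambda>_. 1) h \<sigma>"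
      using vanishesE[OF assms(5), of "\<lambda>\<sigma>. g1 \<sigma> - g2 \<sigma>"] g1(1) g2(1) by auto
    \<comment> \<open>A cochain on the union splits into a part on \<open>U\<close> and a rest,
      which is supported on \<open>V\<close>. The cut does not commute with the differential, but
      each half keeps its support under it.\<close>
    define h1 where "h1 \<sigma> = (if \<sigma> \<in> U then h \<sigma> else 0)" for \<sigma>
    define h2 where "h2 \<sigma> = (if \<sigma> \<in> U then 0 else h \<sigma>)" for \<sigma>
    have h12: "h = (\<lambda>\<sigma>. h1 \<sigma> + h2 \<sigma>)" by (auto simp: h1_def h2_def)
    \<comment> \<open>The identity relating \<open>g1\<close>, \<open>g2\<close> and
      \<open>h\<close> is known only in cardinality \<open>q\<close>, so the primitive is cut down
      to it; elsewhere its support would not be controlled.\<close>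
    define g where "g \<sigma> = (if card \<sigma> = q then g1 \<sigma> - koszul_diff (\<lambda>_. 1) h1 \<sigma> else 0)" for \<sigma>
    have "g \<sigma> = 0" if "\<sigma> \<notin> U \<inter> V" for \<sigma>
    proof (cases "card \<sigma> = q")
      case True
      have "g \<sigma> = g2 \<sigma> + koszul_diff (\<lambda>_. 1) h2 \<sigma>"
        using h(2)[of \<sigma>] True Suc unfolding g_def h12 koszul_diff_add by (simp add: algebra_simps)
      moreover have "koszul_diff (\<lambda>_. 1) h1 \<sigma> = 0" if "\<sigma> \<notin> U"
        by (rule koszul_diff_supported[OF up(1) _ that]) (simp add: h1_def)
      moreover have "koszul_diff (\<lambda>_. 1) h2 \<sigma> = 0" if "\<sigma> \<notin> V"
        by (rule koszul_diff_supported[OF up(2) _ that]) (use h(1) in \<open>auto simp: h2_def\<close>)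
      moreover have "g \<sigma> = g1 \<sigma> - koszul_diff (\<lambda>_. 1) h1 \<sigma>" using True by (simp add: g_def)
      ultimately show ?thesis using that g1(1)[of \<sigma>] g2(1)[of \<sigma>]
        by (cases "\<sigma> \<in> U") simp_all
    qed (simp add: g_def)
    moreover have "f \<sigma> = koszul_diff (\<lambda>_. 1) g \<sigma>" if "card \<sigma> = p" for \<sigma>
    proof -
      have "koszul_diff (\<lambda>_. 1) g \<sigma> = koszul_diff (\<lambda>_. 1) (\<lambda>\<sigma>. g1 \<sigma> - koszul_diff (\<lambda>_. 1) h1 \<sigma>) \<sigma>"
        by (rule koszul_diff_cong) (use that Suc in \<open>auto simp: g_def\<close>)
      then show ?thesis using g1(2)[OF that]
        by (simp add: koszul_diff_diff koszul_diff_koszul_diff)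
    qed
    ultimately show ?thesis by blast
  qed
qed

text \<open>Exactness of the same sequence in the middle: subtracting the coboundary of the
  \<open>U\<close>-half of a primitive on the union moves the cocycle into the intersection.\<close>

lemma vanishes_Int_Un:
  fixes U V :: "'v::{finite,linorder} set set"
  assumes up: "upset U" "upset V"
    and "vanishes TYPE('k::comm_ring_1) (U \<inter> V) p" "vanishes TYPE('k) (U \<union> V) p"
  shows "vanishes TYPE('k) U p"
proof (rule vanishesI)
  fix f :: "'v set \<Rightarrow> 'k"
  assume supp: "\<And>\<sigma>. \<sigma> \<notin> U \<Longrightarrow> f \<sigma> = 0"
    and cyc: "\<And>\<tau>. card \<tau> = Suc p \<Longrightarrow> koszul_diff (\<lambda>_. 1) f \<tau> = 0"
  obtain h where h: "\<And>\<sigma>. \<sigma> \<notin> U \<union> V \<Longrightarrow> h \<sigma> = 0" "\<And>\<sigma>. card \<sigma> = p \<Longrightarrow> f \<sigma> = koszul_diff (\<lambda>_. 1) h \<sigma>"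
    using vanishesE[OF assms(4), of f] supp cyc by blast
  define h1 where "h1 \<sigma> = (if \<sigma> \<in> U then h \<sigma> else 0)" for \<sigma>
  define h2 where "h2 \<sigma> = (if \<sigma> \<in> U then 0 else h \<sigma>)" for \<sigma>
  have h12: "h = (\<lambda>\<sigma>. h1 \<sigma> + h2 \<sigma>)" by (auto simp: h1_def h2_def)
  define f' where "f' \<sigma> = (if card \<sigma> = p then koszul_diff (\<lambda>_. 1) h2 \<sigma> else 0)" for \<sigma>
  have f': "f' \<sigma> = f \<sigma> - koszul_diff (\<lambda>_. 1) h1 \<sigma>" if "card \<sigma> = p" for \<sigma>
    using h(2)[OF that] that unfolding f'_def h12 koszul_diff_add by simp
  have "f' \<sigma> = 0" if "\<sigma> \<notin> U \<inter> V" for \<sigma>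
  proof (cases "card \<sigma> = p")
    case True
    have "koszul_diff (\<lambda>_. 1) h1 \<sigma> = 0" if "\<sigma> \<notin> U"
      by (rule koszul_diff_supported[OF up(1) _ that]) (simp add: h1_def)
    moreover have "koszul_diff (\<lambda>_. 1) h2 \<sigma> = 0" if "\<sigma> \<notin> V"
      by (rule koszul_diff_supported[OF up(2) _ that]) (use h(1) in \<open>auto simp: h2_def\<close>)
    ultimately show ?thesis using that supp f'[OF True] True by (auto simp: f'_def)
  qed (simp add: f'_def)
  moreover have "koszul_diff (\<lambda>_. 1) f' \<tau> = 0" if "card \<tau> = Suc p" for \<tau>
  proof -
    have "koszul_diff (\<lambda>_. 1) f' \<tau> = koszul_diff (\<lambda>_. 1) (koszul_diff (\<lambda>_. 1) h2) \<tau>"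
      by (rule koszul_diff_cong) (use that in \<open>auto simp: f'_def\<close>)
    then show ?thesis by (simp add: koszul_diff_koszul_diff)
  qed
  ultimately obtain g where g: "\<And>\<sigma>. \<sigma> \<notin> U \<inter> V \<Longrightarrow> g \<sigma> = 0" "\<And>\<sigma>. card \<sigma> = p \<Longrightarrow> f' \<sigma> = koszul_diff (\<lambda>_. 1) g \<sigma>"
    using vanishesE[OF assms(3), of f'] by blast
  show "\<exists>g. (\<forall>\<sigma>. \<sigma> \<notin> U \<longrightarrow> g \<sigma> = 0) \<and> (\<forall>\<sigma>. card \<sigma> = p \<longrightarrow> f \<sigma> = koszul_diff (\<lambda>_. 1) g \<sigma>)"
  proof (intro exI[of _ "\<lambda>\<sigma>. h1 \<sigma> + g \<sigma>"] conjI allI impI)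
    fix \<sigma> :: "'v set" assume "card \<sigma> = p"
    then show "f \<sigma> = koszul_diff (\<lambda>_. 1) (\<lambda>\<sigma>. h1 \<sigma> + g \<sigma>) \<sigma>"
      using f' g(2) unfolding koszul_diff_add by (metis add.commute diff_add_cancel)
  qed (use g(1) in \<open>auto simp: h1_def\<close>)
qed

section \<open>Boxes of exponents\<close>

text \<open>
  For an upward closed set \<open>J\<close> of exponents, the box from \<open>lo\<close> to \<open>hi\<close> carries one two-term complex
  per indeterminate.
\<close>

definition box :: "('v \<Rightarrow> int) set \<Rightarrow> ('v \<Rightarrow> int) \<Rightarrow> ('v \<Rightarrow> int) \<Rightarrow> 'v set set" where
  "box J lo hi = {\<sigma>. (\<lambda>v. if v \<in> \<sigma> then hi v else lo v) \<in> J}"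

definition up_exps :: "('v \<Rightarrow> int) set \<Rightarrow> bool" where
  "up_exps J \<longleftrightarrow> (\<forall>u\<in>J. \<forall>u'. u \<le> u' \<longrightarrow> u' \<in> J)"

lemma up_expsD: "up_exps J \<Longrightarrow> u \<in> J \<Longrightarrow> (\<And>v. u v \<le> u' v) \<Longrightarrow> u' \<in> J"
  unfolding up_exps_def le_fun_def by blast

lemma upset_box:
  assumes "up_exps J" "\<And>v. lo v \<le> hi v"
  shows "upset (box J lo hi)"
  unfolding upset_def
proof (intro ballI allI impI)
  fix \<sigma> \<tau> assume "\<sigma> \<in> box J lo hi" "\<sigma> \<subseteq> \<tau>"
  then show "\<tau> \<in> box J lo hi" unfolding box_def mem_Collect_eq
    by - (erule up_expsD[OF assms(1)], use assms(2) in auto)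
qed

text \<open>The two-term complex in direction \<open>v\<close> is then an identity map, so toggling
  \<open>v\<close> contracts the box.\<close>

lemma vanishes_box_flat:
  assumes "lo v = hi v"
  shows "vanishes TYPE('k::comm_ring_1) (box J lo hi) p"
proof (rule vanishes_toggle[of v])
  fix \<sigma> assume "v \<notin> \<sigma>"
  then have "(\<lambda>w. if w \<in> insert v \<sigma> then hi w else lo w) = (\<lambda>w. if w \<in> \<sigma> then hi w else lo w)"
    using assms by auto
  then show "insert v \<sigma> \<in> box J lo hi \<longleftrightarrow> \<sigma> \<in> box J lo hi" by (simp only: box_def mem_Collect_eq)
qed

lemma box_upd_hi_mono:
  assumes "up_exps J" "m \<le> h"
  shows "box J lo (hi(v := m)) \<subseteq> box J lo (hi(v := h))" (is "?A \<subseteq> ?B")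
proof
  fix \<sigma> assume "\<sigma> \<in> ?A"
  then show "\<sigma> \<in> ?B" unfolding box_def mem_Collect_eq
    by (rule up_expsD[OF assms(1)]) (use assms(2) in auto)
qed

lemma box_upd_lo_mono:
  assumes "up_exps J" "lo v \<le> m"
  shows "box J lo hi \<subseteq> box J (lo(v := m)) hi" (is "?A \<subseteq> ?B")
proof
  fix \<sigma> assume "\<sigma> \<in> ?A"
  then show "\<sigma> \<in> ?B" unfolding box_def mem_Collect_eq
    by (rule up_expsD[OF assms(1)]) (use assms(2) in auto)
qed

lemma box_upd_lo_irrelevant: "v \<in> \<sigma> \<Longrightarrow> \<sigma> \<in> box J (lo(v := m)) hi \<longleftrightarrow> \<sigma> \<in> box J lo hi"
  unfolding box_def mem_Collect_eq by (rule arg_cong[where f = "\<lambda>u. u \<in> J"]) auto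

lemma box_upd_hi_irrelevant: "v \<notin> \<sigma> \<Longrightarrow> \<sigma> \<in> box J lo (hi(v := m)) \<longleftrightarrow> \<sigma> \<in> box J lo hi"
  unfolding box_def mem_Collect_eq by (rule arg_cong[where f = "\<lambda>u. u \<in> J"]) auto

text \<open>The box that is flat at height \<open>m\<close> in direction \<open>v\<close> is acyclic
  and serves as the second Mayer-Vietoris piece. Intersecting with it leaves the lower part of the
  side from \<open>lo v\<close> to \<open>h\<close>, uniting with it leaves the upper part, so one
  sequence links the two parts of a cut to the whole.\<close>

lemma box_Int:
  assumes "up_exps J" "lo v \<le> m" "m \<le> h"
  shows "box J lo (hi(v := h)) \<inter> box J (lo(v := m)) (hi(v := m)) = box J lo (hi(v := m))"
proof -
  have "\<sigma> \<in> box J lo (hi(v := h)) \<and> \<sigma> \<in> box J (lo(v := m)) (hi(v := m)) \<longleftrightarrow> \<sigma> \<in> box J lo (hi(v := m))" for \<sigma>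
  proof (cases "v \<in> \<sigma>")
    case True
    show ?thesis using box_upd_hi_mono[OF assms(1,3), of lo hi v] unfolding box_upd_lo_irrelevant[OF True] by blast
  next
    case False
    show ?thesis using box_upd_lo_mono[of J lo v m hi, OF assms(1,2)] unfolding box_upd_hi_irrelevant[OF False] by blast
  qed
  then show ?thesis by blast
qed

lemma box_Un:
  assumes "up_exps J" "lo v \<le> m" "m \<le> h"
  shows "box J lo (hi(v := h)) \<union> box J (lo(v := m)) (hi(v := m)) = box J (lo(v := m)) (hi(v := h))"
proof -
  have "\<sigma> \<in> box J lo (hi(v := h)) \<or> \<sigma> \<in> box J (lo(v := m)) (hi(v := m)) \<longleftrightarrow> \<sigma> \<in> box J (lo(v := m)) (hi(v := h))" for \<sigma>
  proof (cases "v \<in> \<sigma>")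
    case True
    show ?thesis using box_upd_hi_mono[OF assms(1,3), of lo hi v] unfolding box_upd_lo_irrelevant[OF True] by blast
  next
    case False
    show ?thesis using box_upd_lo_mono[of J lo v m hi, OF assms(1,2)] unfolding box_upd_hi_irrelevant[OF False] by blast
  qed
  then show ?thesis by blast
qed

lemma sum_fun_upd_gt:
  fixes lo :: "'v::finite \<Rightarrow> int"
  assumes "lo v < m"
  shows "sum lo UNIV < sum (lo(v := m)) UNIV"
  by (rule sum_strict_mono_ex1) (use assms in auto)

text \<open>The combinatorial form of the equality of the Tor and local cohomology regularities.\<close>

lemma vanishes_box_if_vanishes_cech:
  fixes J :: "('v::{finite,linorder} \<Rightarrow> int) set"
  assumes up: "up_exps J"
    and cech: "\<And>lo p. (\<And>v. - 1 \<le> lo v \<and> lo v < B) \<Longrightarrow> int p + sum lo UNIV > r \<Longrightarrow>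
      vanishes TYPE('k::comm_ring_1) (box J lo (\<lambda>_. B)) p"
    and "\<And>v. - 1 \<le> lo v \<and> lo v \<le> hi v \<and> hi v \<le> B" "int p + sum lo UNIV > r"
  shows "vanishes TYPE('k) (box J lo hi) p"
  using assms(3,4)
proof (induction "card {v. hi v \<noteq> B}" arbitrary: lo hi p)
  case 0
  then have hi: "hi = (\<lambda>_. B)" by auto
  show ?case
  proof (cases "\<exists>v. lo v = B")
    case True
    then show ?thesis unfolding hi using vanishes_box_flat by metis
  next
    case False
    then show ?thesis unfolding hi using cech[of lo p] 0(2,3) hi by (metis order_le_neq_trans)
  qed
next
  case (Suc n)
  from Suc(2) have "{v. hi v \<noteq> B} \<noteq> {}" by (metis Zero_not_Suc card.empty)
  then obtain v where v: "hi v \<noteq> B" by auto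
  show ?case
  proof (cases "lo v = hi v")
    case True
    then show ?thesis by (rule vanishes_box_flat)
  next
    case False
    let ?m = "hi v"
    have lt: "lo v < ?m" using False Suc(3)[of v] by linarith
    have "{w. (hi(v := B)) w \<noteq> B} = {w. hi w \<noteq> B} - {v}" by auto
    then have n: "n = card {w. (hi(v := B)) w \<noteq> B}"
      using Suc(2) v by simp
    have 1: "vanishes TYPE('k) (box J lo (hi(v := B))) p"
      by (rule Suc(1)[OF n]) (use Suc(3,4) in \<open>auto intro: order_trans\<close>)
    \<comment> \<open>Raising the lower corner to \<open>hi v\<close> adds at least one to its sum,
      which pays for the drop from \<open>p\<close> to \<open>p - 1\<close>.\<close>
    have 2: "vanishes TYPE('k) (box J (lo(v := ?m)) (hi(v := B))) (p - 1)"
      by (rule Suc(1)[OF n]) (use Suc(3,4) sum_fun_upd_gt[of lo v ?m] lt in \<open>auto intro: order_trans\<close>)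
    have "vanishes TYPE('k) (box J lo (hi(v := B)) \<inter> box J (lo(v := ?m)) (hi(v := ?m))) p"
    proof (rule vanishes_Int)
      show "upset (box J lo (hi(v := B)))"
        by (rule upset_box[OF up]) (use Suc(3) in \<open>auto intro: order_trans\<close>)
      show "upset (box J (lo(v := ?m)) (hi(v := ?m)))"
        by (rule upset_box[OF up]) (use Suc(3) in auto)
      show "vanishes TYPE('k) (box J (lo(v := ?m)) (hi(v := ?m))) p"
        by (rule vanishes_box_flat[of _ v]) simp
      show "vanishes TYPE('k) (box J lo (hi(v := B)) \<union> box J (lo(v := ?m)) (hi(v := ?m))) (p - 1)"
        using 2 lt Suc(3)[of v] by (subst box_Un[OF up]) auto
    qed (rule 1)
    then show ?thesis using lt Suc(3)[of v] by (subst (asm) box_Int[OF up]) auto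
  qed
qed

text \<open>Induction on the total side length. A side longer than one is cut after its first unit.
  The box is the middle term of the sequence, so both parts are used in the same degree
  \<open>p\<close>, and raising the lower corner only increases the total degree.\<close>

lemma vanishes_box_if_vanishes_koszul:
  fixes J :: "('v::{finite,linorder} \<Rightarrow> int) set"
  assumes up: "up_exps J"
    and koszul: "\<And>lo p. (\<And>v. - 1 \<le> lo v) \<Longrightarrow> int p + sum lo UNIV > r \<Longrightarrow>
      vanishes TYPE('k::comm_ring_1) (box J lo (\<lambda>v. lo v + 1)) p"
    and "\<And>v. - 1 \<le> lo v \<and> lo v \<le> hi v" "int p + sum lo UNIV > r"
  shows "vanishes TYPE('k) (box J lo hi) p"
  using assms(3,4)
proof (induction "\<Sum>v\<in>UNIV. nat (hi v - lo v)" arbitrary: lo hi rule: less_induct)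
  case less
  show ?case
  proof (cases "\<exists>v. lo v = hi v")
    case True
    then show ?thesis using vanishes_box_flat by metis
  next
    case ne: False
    show ?thesis
    proof (cases "\<forall>v. hi v = lo v + 1")
      case True
      then have "hi = (\<lambda>v. lo v + 1)" by auto
      then show ?thesis using koszul less(2,3) by simp
    next
      case False
      then obtain v where v: "hi v \<noteq> lo v + 1" by auto
      let ?m = "lo v + 1"
      have "lo v \<noteq> hi v" using ne by blast
      then have lt: "?m < hi v" using v less(2)[of v] by linarith
      have 1: "vanishes TYPE('k) (box J lo (hi(v := ?m))) p"
      proof (rule less(1))
        show "(\<Sum>w\<in>UNIV. nat ((hi(v := ?m)) w - lo w)) < (\<Sum>w\<in>UNIV. nat (hi w - lo w))"
          by (rule sum_strict_mono_ex1) (use lt in \<open>auto intro!: bexI[of _ v]\<close>)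
      qed (use less(2,3) in \<open>simp_all\<close>)
      have 2: "vanishes TYPE('k) (box J (lo(v := ?m)) hi) p"
      proof (rule less(1))
        show "(\<Sum>w\<in>UNIV. nat (hi w - (lo(v := ?m)) w)) < (\<Sum>w\<in>UNIV. nat (hi w - lo w))"
          by (rule sum_strict_mono_ex1) (use lt in \<open>auto intro!: bexI[of _ v]\<close>)
        show "- 1 \<le> (lo(v := ?m)) w \<and> (lo(v := ?m)) w \<le> hi w" for w
          using less(2)[of w] lt less(2)[of v] by auto
      qed (use less(3) sum_fun_upd_gt[of lo v ?m] in auto)
      show ?thesis
      proof (rule vanishes_Int_Un)
        show "upset (box J lo hi)" by (rule upset_box[OF up]) (use less(2) in auto)
        show "upset (box J (lo(v := ?m)) (hi(v := ?m)))" by (rule upset_box[OF up]) (use less(2) in auto)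
        show "vanishes TYPE('k) (box J lo hi \<inter> box J (lo(v := ?m)) (hi(v := ?m))) p"
          using 1 lt box_Int[OF up, of lo v ?m "hi v" hi] by simp
        show "vanishes TYPE('k) (box J lo hi \<union> box J (lo(v := ?m)) (hi(v := ?m))) p"
          using 2 lt box_Un[OF up, of lo v ?m "hi v" hi] by simp
      qed
    qed
  qed
qed

section \<open>Matchings in gap-free graphs\<close>

text \<open>Applied to the adjacency of the graph and to that of its clones, where copies of one
  vertex are not adjacent. The gap condition carries no distinctness assumption: for edges that
  share a vertex it holds by symmetry.\<close>

locale gap_free_relation =
  fixes R :: "'a \<Rightarrow> 'a \<Rightarrow> bool"
  assumes R_sym: "R x y \<Longrightarrow> R y x"
    and R_irrefl: "\<not> R x x"
    and R_gap: "R a b \<Longrightarrow> R c d \<Longrightarrow> R a c \<or> R a d \<or> R b c \<or> R b d"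
begin

fun has_matching :: "'a set \<Rightarrow> nat \<Rightarrow> bool" where
  "has_matching T 0 \<longleftrightarrow> True"
| "has_matching T (Suc n) \<longleftrightarrow> (\<exists>x\<in>T. \<exists>y\<in>T. R x y \<and> has_matching (T - {x, y}) n)"

lemma has_matching_mono: "T \<subseteq> T' \<Longrightarrow> has_matching T n \<Longrightarrow> has_matching T' n"
proof (induction n arbitrary: T T')
  case (Suc n)
  then obtain x y where "x \<in> T" "y \<in> T" "R x y" "has_matching (T - {x, y}) n" by auto
  moreover have "has_matching (T' - {x, y}) n"
    by (rule Suc(1)[OF _ calculation(4)]) (use Suc(2) in auto)
  ultimately show ?case using Suc(2) by auto
qed simp

lemma has_matching_1: "has_matching T (Suc 0) \<longleftrightarrow> (\<exists>x\<in>T. \<exists>y\<in>T. R x y)"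
  by simp

lemma has_matching_2:
  "has_matching T (Suc (Suc 0)) \<longleftrightarrow>
    (\<exists>x\<in>T. \<exists>y\<in>T. \<exists>z\<in>T. \<exists>w\<in>T. R x y \<and> R z w \<and> z \<noteq> x \<and> z \<noteq> y \<and> w \<noteq> x \<and> w \<noteq> y)"
  by auto

lemma has_matching_2I:
  "x \<in> T \<Longrightarrow> y \<in> T \<Longrightarrow> z \<in> T \<Longrightarrow> w \<in> T \<Longrightarrow> R x y \<Longrightarrow> R z w \<Longrightarrow> z \<noteq> x \<Longrightarrow> z \<noteq> y \<Longrightarrow> w \<noteq> x \<Longrightarrow> w \<noteq> y
    \<Longrightarrow> has_matching T (Suc (Suc 0))"
  unfolding has_matching_2 by blast

lemma has_matching_3I:
  assumes "{a, b, c, d, e, f} \<subseteq> T" "distinct [a, b, c, d, e, f]" "R a b" "R c d" "R e f"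
  shows "has_matching T (Suc (Suc (Suc 0)))"
proof -
  have "has_matching (T - {a, b}) (Suc (Suc 0))"
    by (rule has_matching_2I[of c _ d e f]) (use assms in auto)
  then show ?thesis unfolding has_matching.simps(2)[of T] using assms by blast
qed

definition isolated_free :: "'a set \<Rightarrow> bool" where
  "isolated_free Q \<longleftrightarrow> (\<forall>z\<in>Q. \<exists>y\<in>Q. R z y)"

text \<open>Pairwise intersecting edges form a star or a triangle, and a star is excluded because no
  single vertex meets all edges. An edge that meets all three sides of the triangle is one of
  them.\<close>

lemma triangle_if_no_matching_2:
  assumes no2: "\<not> has_matching Q (Suc (Suc 0))"
    and nocover: "\<And>c. c \<in> Q \<Longrightarrow> has_matching (Q - {c}) (Suc 0)" and "Q \<noteq> {}"
  obtains x y w where "x \<in> Q" "y \<in> Q" "w \<in> Q" "R x y" "R y w" "R x w"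
    "\<And>u v. u \<in> Q \<Longrightarrow> v \<in> Q \<Longrightarrow> R u v \<Longrightarrow> u \<in> {x, y, w} \<and> v \<in> {x, y, w}"
proof -
  have meet: "a = c \<or> a = d \<or> b = c \<or> b = d"
    if "a \<in> Q" "b \<in> Q" "c \<in> Q" "d \<in> Q" "R a b" "R c d" for a b c d
    using has_matching_2I[of a Q b c d] that no2 by blast
  from \<open>Q \<noteq> {}\<close> obtain c where "c \<in> Q" by auto
  then obtain x y where xy: "x \<in> Q" "y \<in> Q" "R x y"
    using nocover unfolding has_matching_1 by blast
  have "\<exists>r\<in>Q. R y r \<and> r \<noteq> x"
  proof -
    obtain a b where ab: "a \<in> Q - {x}" "b \<in> Q - {x}" "R a b"
      using nocover[OF xy(1)] unfolding has_matching_1 by blast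
    then show ?thesis using meet[of a b x y] xy R_sym by blast
  qed
  then obtain r1 where r1: "r1 \<in> Q" "R y r1" "r1 \<noteq> x" by blast
  have "\<exists>r\<in>Q. R x r \<and> r \<noteq> y"
  proof -
    obtain a b where ab: "a \<in> Q - {y}" "b \<in> Q - {y}" "R a b"
      using nocover[OF xy(2)] unfolding has_matching_1 by blast
    then show ?thesis using meet[of a b x y] xy R_sym by blast
  qed
  then obtain r2 where r2: "r2 \<in> Q" "R x r2" "r2 \<noteq> y" by blast
  have ne: "x \<noteq> y" "y \<noteq> r1" "x \<noteq> r2" using xy r1 r2 R_irrefl by auto
  have "r1 = r2" using meet[of y r1 x r2] xy r1 r2 ne by blast
  then have tri: "x \<in> Q" "y \<in> Q" "r1 \<in> Q" "R x y" "R y r1" "R x r1" using xy r1 r2 by auto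
  show thesis
  proof (rule that[OF tri])
    fix u v assume "u \<in> Q" "v \<in> Q" "R u v"
    then have "u \<noteq> v" "u = x \<or> u = y \<or> v = x \<or> v = y" "u = y \<or> u = r1 \<or> v = y \<or> v = r1" "u = x \<or> u = r1 \<or> v = x \<or> v = r1"
      using meet[of u v x y] meet[of u v y r1] meet[of u v x r1] tri R_irrefl by blast+
    then show "u \<in> {x, y, r1} \<and> v \<in> {x, y, r1}" using ne r1 by auto
  qed
qed

text \<open>
  A special case of Gallai's lemma, with the gap condition replacing the induction on distances: a
  graph without isolated vertices whose matching number is 2 and does not drop when a vertex is
  deleted has at most five vertices.
\<close>

lemma card_le_5_if_matchings_avoid:
  assumes fin: "finite Q" and no3: "\<not> has_matching Q (Suc (Suc (Suc 0)))"
    and iso: "isolated_free Q"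
    and avoid: "\<And>p. p \<in> Q \<Longrightarrow> has_matching (Q - {p}) (Suc (Suc 0))"
  shows "card Q \<le> 5"
proof (rule ccontr)
  assume "\<not> card Q \<le> 5"
  have no3': "\<not> (R a b \<and> R c d \<and> R e f)"
    if "{a, b, c, d, e, f} \<subseteq> Q" "distinct [a, b, c, d, e, f]" for a b c d e f
    using has_matching_3I[OF that] no3 by blast
  \<comment> \<open>a maximum matching \<open>xy, zw\<close> together with two vertices it misses\<close>
  let ?cfg = "\<lambda>x y z w r r'. {x, y, z, w, r, r'} \<subseteq> Q \<and> distinct [x, y, z, w, r, r'] \<and> R x y \<and> R z w"
  \<comment> \<open>A matching of size 2 that avoids \<open>t\<close> must use \<open>r\<close>, for
    otherwise the edge \<open>r t\<close> would extend it; hence \<open>r\<close> has a second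
    neighbour.\<close>
  have covered: "\<exists>b\<in>Q - {t, r}. R r b"
    if rt: "r \<in> Q" "t \<in> Q" "R r t" for r t
  proof -
    obtain a b c d where m: "a \<in> Q - {t}" "b \<in> Q - {t}" "c \<in> Q - {t}" "d \<in> Q - {t}" "R a b" "R c d"
      "c \<noteq> a" "c \<noteq> b" "d \<noteq> a" "d \<noteq> b"
      using avoid[OF rt(2)] unfolding has_matching_2 by blast
    have "a \<noteq> b" "c \<noteq> d" "r \<noteq> t" using m rt R_irrefl by auto
    then have "r \<in> {a, b, c, d}"
      using no3'[of a b c d r t] m rt by auto
    then show ?thesis using m R_sym R_irrefl by blast
  qed
  \<comment> \<open>If both missed vertices were adjacent to \<open>x\<close>, a matching of size 2
    avoiding \<open>x\<close> would have to use both, by different edges since they are not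
    adjacent. Their partners lie in \<open>{y, z, w}\<close>, and every choice completes to three
    disjoint edges.\<close>
  have common: "\<not> (R r x \<and> R r' x)" if cfg: "?cfg x y z w r r'" for x y z w r r'
  proof
    assume rx: "R r x \<and> R r' x"
    have x: "x \<in> Q" using cfg by simp
    obtain a b c d where m: "a \<in> Q - {x}" "b \<in> Q - {x}" "c \<in> Q - {x}" "d \<in> Q - {x}" "R a b" "R c d"
      "c \<noteq> a" "c \<noteq> b" "d \<noteq> a" "d \<noteq> b"
      using avoid[OF x] unfolding has_matching_2 by blast
    have ne: "a \<noteq> b" "c \<noteq> d" using m R_irrefl by auto
    have rr: "\<not> R r r'" using no3'[of x y z w r r'] cfg by auto
    have "r \<in> {a, b, c, d}" using no3'[of a b c d r x] m ne rx cfg by auto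
    moreover have "r' \<in> {a, b, c, d}" using no3'[of a b c d r' x] m ne rx cfg by auto
    ultimately obtain b' d' where bd: "b' \<in> Q - {x}" "d' \<in> Q - {x}" "R r b'" "R r' d'"
      "b' \<noteq> d'" "b' \<noteq> r'" "d' \<noteq> r" "b' \<noteq> r" "d' \<noteq> r'"
      using m ne rr R_sym cfg by (elim insertE) auto
    have "b' \<in> {y, z, w}" using no3'[of r b' x y z w] bd cfg by auto
    moreover have "d' \<in> {y, z, w}" using no3'[of r' d' x y z w] bd cfg by auto
    moreover have "b' \<noteq> y" using no3'[of r y r' x z w] bd rx cfg by auto
    moreover have "d' \<noteq> y" using no3'[of r' y r x z w] bd rx cfg by auto
    moreover have "\<not> (b' = z \<and> d' = w)" using no3'[of r z r' w x y] bd cfg by auto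
    moreover have "\<not> (b' = w \<and> d' = z)" using no3'[of r w r' z x y] bd cfg by auto
    ultimately show False using bd(5) by auto
  qed
  have swap: "?cfg y x z w r r'" "?cfg z w x y r r'" "?cfg x y z w r' r" if "?cfg x y z w r r'" for x y z w r r'
    using that R_sym by auto
  have no_common: "\<not> (R r t \<and> R r' t)" if cfg: "?cfg x y z w r r'" and t: "t \<in> {x, y, z, w}" for x y z w r r' t
    using t common[OF cfg] common[OF swap(1)[OF cfg]] common[OF swap(2)[OF cfg]]
      common[OF swap(1)[OF swap(2)[OF cfg]]] by auto
  \<comment> \<open>Here \<open>r\<close> hangs on \<open>x\<close> and \<open>r'\<close> on
    \<open>z\<close>. Their neighbours are confined to the ends of the respective matching edge, so
    \<open>covered\<close> also yields \<open>R r y\<close> and \<open>R r' w\<close>, and these two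
    edges form a gap.\<close>
  have main: False if cfg: "?cfg x y z w r r'" and rx: "R r x" "R r' z" for x y z w r r'
  proof -
    have rr: "\<not> R r r'" using no3'[of x y z w r r'] cfg by auto
    have rz: "\<not> R r z" and r'x: "\<not> R r' x" using no_common[OF cfg] rx by auto
    have rw: "\<not> R r w" using no3'[of r w r' z x y] rx cfg R_sym by auto
    have r'y: "\<not> R r' y" using no3'[of r' y r x z w] rx cfg R_sym by auto
    have near: "b \<in> {x, y, z, w, r, r'}" if "b \<in> Q" "R r b \<or> R r' b" for b
      using no3'[of r b x y z w] no3'[of r' b x y z w] that cfg by auto
    have "R r y" using covered[of r x] near rr rz rw rx cfg R_irrefl by auto
    moreover have "R r' w" using covered[of r' z] near rr r'x r'y rx cfg R_irrefl R_sym by auto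
    moreover have "\<not> R y w" using no3'[of y w r x r' z] rx cfg by auto
    ultimately show False using R_gap[of r y r' w] rr rw r'y R_sym by blast
  qed
  have "Q \<noteq> {}" using \<open>\<not> card Q \<le> 5\<close> by auto
  then obtain p where "p \<in> Q" by auto
  then obtain x y z w where m: "x \<in> Q" "y \<in> Q" "z \<in> Q" "w \<in> Q" "R x y" "R z w"
      "z \<noteq> x" "z \<noteq> y" "w \<noteq> x" "w \<noteq> y"
    using avoid unfolding has_matching_2 by blast
  have xyzw: "x \<noteq> y" "z \<noteq> w" using m R_irrefl by auto
  \<comment> \<open>At least six vertices leave two outside the matching.\<close>
  have "card (Q - {x, y, z, w}) \<ge> 2"
    using fin \<open>\<not> card Q \<le> 5\<close> m xyzw by (subst card_Diff_subset) auto
  then obtain S where "S \<subseteq> Q - {x, y, z, w}" "card S = 2"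
    by (meson obtain_subset_with_card_n)
  then obtain r r' where r: "r \<in> Q - {x, y, z, w}" "r' \<in> Q - {x, y, z, w}" "r \<noteq> r'"
    unfolding card_2_iff by blast
  have cfg: "?cfg x y z w r r'" using m xyzw r by auto
  obtain t where t: "t \<in> Q" "R r t" using iso r unfolding isolated_free_def by blast
  obtain t' where t': "t' \<in> Q" "R r' t'" using iso r unfolding isolated_free_def by blast
  have tin: "t \<in> {x, y, z, w}" using no3'[of r t x y z w] t cfg R_irrefl by auto
  have t'in: "t' \<in> {x, y, z, w}" using no3'[of r' t' x y z w] t' cfg R_irrefl by auto
  \<comment> \<open>The neighbours of the two missed vertices are distinct and are not the two ends
    of one matching edge. So they lie on different edges, and the eight positions left are symmetric
    copies of \<open>main\<close>.\<close>
  have "t \<noteq> t'" using no_common[OF cfg tin] t t' by auto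
  moreover have "\<not> (t = x \<and> t' = y)" using no3'[of r x r' y z w] t t' cfg by auto
  moreover have "\<not> (t = y \<and> t' = x)" using no3'[of r y r' x z w] t t' cfg by auto
  moreover have "\<not> (t = z \<and> t' = w)" using no3'[of r z r' w x y] t t' cfg by auto
  moreover have "\<not> (t = w \<and> t' = z)" using no3'[of r w r' z x y] t t' cfg by auto
  ultimately have "t \<in> {x, y} \<and> t' \<in> {z, w} \<or> t \<in> {z, w} \<and> t' \<in> {x, y}" using tin t'in by auto
  moreover have "\<not> (t = x \<and> t' = z)" using main[OF cfg] t t' by blast
  moreover have "\<not> (t = y \<and> t' = z)" using main[OF swap(1)[OF cfg]] t t' by blast
  moreover have "\<not> (t = x \<and> t' = w)" using main[OF swap(2)[OF swap(1)[OF swap(2)[OF cfg]]]] t t' by blast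
  moreover have "\<not> (t = y \<and> t' = w)" using main[OF swap(1)[OF swap(2)[OF swap(1)[OF swap(2)[OF cfg]]]]] t t' by blast
  moreover have "\<not> (t = z \<and> t' = x)" using main[OF swap(2)[OF cfg]] t t' by blast
  moreover have "\<not> (t = w \<and> t' = x)" using main[OF swap(1)[OF swap(2)[OF cfg]]] t t' by blast
  moreover have "\<not> (t = z \<and> t' = y)" using main[OF swap(2)[OF swap(1)[OF cfg]]] t t' by blast
  moreover have "\<not> (t = w \<and> t' = y)" using main[OF swap(1)[OF swap(2)[OF swap(1)[OF cfg]]]] t t' by blast
  ultimately show False by blast
qed

declare has_matching.simps(2) [simp del]

text \<open>
  For \<open>m - card T \<ge> 3\<close> the truncated subtraction yields a matching of size 0, so that \<open>T\<close> is not
  admissible.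
\<close>

definition admissible :: "nat \<Rightarrow> 'a set \<Rightarrow> bool" where
  "admissible m T \<longleftrightarrow> \<not> has_matching T (3 - (m - card T))"

lemma admissible_card: "admissible m T \<Longrightarrow> m \<le> card T + 2"
  unfolding admissible_def by (rule ccontr) simp

lemma admissible_0: "card T = m \<Longrightarrow> admissible m T \<longleftrightarrow> \<not> has_matching T (Suc (Suc (Suc 0)))"
  unfolding admissible_def by (simp only: diff_self_eq_0 numeral_3_eq_3) simp

lemma admissible_1: "Suc (card T) = m \<Longrightarrow> admissible m T \<longleftrightarrow> \<not> has_matching T (Suc (Suc 0))"
proof -
  assume "Suc (card T) = m"
  then have "3 - (m - card T) = Suc (Suc 0)" by auto
  then show ?thesis unfolding admissible_def by (simp only:)
qed

lemma admissible_2: "Suc (Suc (card T)) = m \<Longrightarrow> admissible m T \<longleftrightarrow> \<not> has_matching T (Suc 0)"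
proof -
  assume "Suc (Suc (card T)) = m"
  then have "3 - (m - card T) = Suc 0" by auto
  then show ?thesis unfolding admissible_def by (simp only:)
qed

text \<open>The gap condition supplies an edge between the two disjoint ones, and the three together
  form the path.\<close>

lemma path_if_matching_2:
  assumes "has_matching Q (Suc (Suc 0))" "finite Q" "card Q = 4"
  obtains a b c d where "distinct [a, b, c, d]" "Q = {a, b, c, d}" "R a b" "R b c" "R c d"
proof -
  obtain x y z w where m: "x \<in> Q" "y \<in> Q" "z \<in> Q" "w \<in> Q" "R x y" "R z w"
      "z \<noteq> x" "z \<noteq> y" "w \<noteq> x" "w \<noteq> y"
    using assms(1) unfolding has_matching_2 by blast
  have ne: "x \<noteq> y" "z \<noteq> w" using m R_irrefl by auto
  have "card {x, y, z, w} = 4" using m ne by auto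
  then have Q: "Q = {x, y, z, w}" using m assms by (metis card_subset_eq empty_subsetI insert_subset)
  consider "R x z" | "R x w" | "R y z" | "R y w" using R_gap[OF m(5,6)] by blast
  then show thesis
  proof cases
    case 1 show thesis by (rule that[of y x z w]) (use 1 m ne Q R_sym in auto)
  next
    case 2 show thesis by (rule that[of y x w z]) (use 2 m ne Q R_sym in auto)
  next
    case 3 show thesis by (rule that[of x y z w]) (use 3 m ne Q R_sym in auto)
  next
    case 4 show thesis by (rule that[of x y w z]) (use 4 m ne Q R_sym in auto)
  qed
qed

text \<open>
  Removing an inessential element from the ground set does not change which sets contain an
  admissible subset.
\<close>

definition essential :: "nat \<Rightarrow> 'a set \<Rightarrow> 'a \<Rightarrow> bool" where
  "essential m Q c \<longleftrightarrow> (\<exists>T\<subseteq>Q. c \<in> T \<and> admissible m T \<and> (\<forall>T'\<subseteq>T. admissible m T' \<longrightarrow> c \<in> T'))"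

lemma essentialE:
  assumes "essential m Q c"
  obtains T where "T \<subseteq> Q" "c \<in> T" "admissible m T" "\<And>T'. T' \<subseteq> T \<Longrightarrow> admissible m T' \<Longrightarrow> c \<in> T'"
  using assms unfolding essential_def by blast

lemma subset_card_Suc:
  assumes "finite Q" "T \<subseteq> Q" "Suc (card T) = card Q"
  obtains p where "p \<in> Q" "T = Q - {p}"
proof -
  have "card (Q - T) = 1" using assms by (simp add: card_Diff_subset finite_subset)
  then obtain p where "Q - T = {p}" using card_1_singletonE by blast
  then show thesis using that[of p] assms(2) by blast
qed

lemma subset_card_Suc_Suc:
  assumes "finite Q" "T \<subseteq> Q" "Suc (Suc (card T)) = card Q"
  obtains p q where "p \<in> Q" "q \<in> Q" "p \<noteq> q" "T = Q - {p, q}"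
proof -
  have "card (Q - T) = 2" using assms by (simp add: card_Diff_subset finite_subset)
  then obtain p q where "Q - T = {p, q}" "p \<noteq> q" unfolding card_2_iff by blast
  then show thesis using that[of p q] assms(2) by blast
qed

text \<open>The number in the name counts the clones, out of \<open>m\<close>, that are no longer in
  \<open>Q\<close>. With two gone, only \<open>Q\<close> itself is large enough to be admissible,
  and then it must be edgeless.\<close>

lemma essential_missing_2:
  assumes "finite Q" "Suc (Suc (card Q)) = m" "isolated_free Q" "c \<in> Q" "essential m Q c"
  shows False
proof -
  obtain T where T: "T \<subseteq> Q" "c \<in> T" "admissible m T" using assms(5) by (rule essentialE) (rule that)
  have "card Q \<le> card T" using admissible_card[OF T(3)] assms(2) by simp
  then have "T = Q" using card_seteq[OF assms(1) T(1)] by simp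
  then have "\<not> has_matching Q (Suc 0)" using T(3) admissible_2[OF assms(2)] by simp
  then show False using assms(3,4) unfolding isolated_free_def has_matching_1 by blast
qed

text \<open>Besides \<open>Q\<close>, only edgeless sets \<open>Q - {p}\<close> can be admissible.
  If one existed, essentiality of \<open>p\<close> would force another one \<open>Q - {q}\<close>,
  so that \<open>p q\<close> would be the only edge and a third element isolated. Hence
  \<open>Q\<close> alone is admissible, it has no two disjoint edges, and the triangle case leaves
  at most three elements.\<close>

lemma essential_missing_1:
  assumes fin: "finite Q" and card: "Suc (card Q) = m" and "4 \<le> m" and iso: "isolated_free Q"
    and ess: "\<And>c. c \<in> Q \<Longrightarrow> essential m Q c"
  shows "m = 4 \<and> (\<forall>T\<subseteq>Q. admissible m T \<longrightarrow> T = Q)"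
proof -
  have Qne: "Q \<noteq> {}" using card \<open>4 \<le> m\<close> by auto
  have sub: "T = Q \<or> (\<exists>p\<in>Q. T = Q - {p} \<and> \<not> has_matching T (Suc 0))" if T: "T \<subseteq> Q" "admissible m T" for T
  proof (cases "T = Q")
    case False
    then have "card T < card Q" using T fin by (simp add: psubset_card_mono psubsetI)
    then have c: "Suc (card T) = card Q" using admissible_card[OF T(2)] card by simp
    then show ?thesis using subset_card_Suc[OF fin T(1)] admissible_2[of T m] card T(2) by metis
  qed simp
  have avoid: "has_matching (Q - {p}) (Suc 0)" if p: "p \<in> Q" for p
  proof (rule ccontr)
    assume no: "\<not> has_matching (Q - {p}) (Suc 0)"
    have "Suc (Suc (card (Q - {p}))) = m" using card_Suc_Diff1[OF fin p] card by (simp only:)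
    then have adm: "admissible m (Q - {p})" using admissible_2 no by blast
    obtain T where T: "T \<subseteq> Q" "p \<in> T" "admissible m T" "\<And>T'. T' \<subseteq> T \<Longrightarrow> admissible m T' \<Longrightarrow> p \<in> T'"
      using ess[OF p] by (rule essentialE) (rule that)
    have "T \<noteq> Q" using T(4)[of "Q - {p}"] adm by auto
    then obtain q where q: "q \<in> Q" "T = Q - {q}" "\<not> has_matching T (Suc 0)" using sub[OF T(1,3)] by blast
    have "\<not> Q \<subseteq> {p, q}"
    proof
      assume "Q \<subseteq> {p, q}"
      then have "card Q \<le> 2" using card_mono[of "{p, q}" Q] by (simp add: card_insert_if split: if_splits)
      then show False using card \<open>4 \<le> m\<close> by simp
    qed
    then obtain z where z: "z \<in> Q" "z \<noteq> p" "z \<noteq> q" by blast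
    then obtain y where y: "y \<in> Q" "R z y" using iso unfolding isolated_free_def by blast
    have "y = p" using no z y unfolding has_matching_1 by blast
    then show False using q T(2) z y unfolding has_matching_1 by blast
  qed
  have only: "T = Q" if "T \<subseteq> Q" "admissible m T" for T
    using sub[OF that] avoid by blast
  obtain c where c: "c \<in> Q" using Qne by auto
  then have "admissible m Q" using ess[OF c] only unfolding essential_def by blast
  then have no2: "\<not> has_matching Q (Suc (Suc 0))" using admissible_1[OF card] by blast
  obtain x y w where tri: "x \<in> Q" "y \<in> Q" "w \<in> Q"
    "\<And>u v. u \<in> Q \<Longrightarrow> v \<in> Q \<Longrightarrow> R u v \<Longrightarrow> u \<in> {x, y, w} \<and> v \<in> {x, y, w}"
    using triangle_if_no_matching_2[OF no2 avoid Qne] by metis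
  have "Q \<subseteq> {x, y, w}" using tri(4) iso unfolding isolated_free_def by blast
  then have "card Q \<le> 3" using card_mono[of "{x, y, w}" Q] by (simp add: card_insert_if split: if_splits)
  then show ?thesis using card \<open>4 \<le> m\<close> only by auto
qed

text \<open>Without two disjoint edges the edges form a triangle, which isolates the fourth element,
  or a star. The centre of a star is not essential: removing it from an admissible set leaves an
  admissible set, except for a pair, and a nonadjacent pair at the centre would need an edge missing
  the centre.\<close>

lemma essential_missing_0_4:
  assumes fin: "finite Q" and card: "card Q = 4" and iso: "isolated_free Q"
    and ess: "\<And>c. c \<in> Q \<Longrightarrow> essential 4 Q c"
  shows "has_matching Q (Suc (Suc 0))"
proof (rule ccontr)
  assume no2: "\<not> has_matching Q (Suc (Suc 0))"
  have Qne: "Q \<noteq> {}" using card by auto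
  have "\<exists>c\<in>Q. \<not> has_matching (Q - {c}) (Suc 0)"
  proof (rule ccontr)
    assume "\<not> ?thesis"
    then obtain x y w where tri: "x \<in> Q" "y \<in> Q" "w \<in> Q"
      "\<And>u v. u \<in> Q \<Longrightarrow> v \<in> Q \<Longrightarrow> R u v \<Longrightarrow> u \<in> {x, y, w} \<and> v \<in> {x, y, w}"
      using triangle_if_no_matching_2[OF no2 _ Qne] by metis
    have "Q \<subseteq> {x, y, w}" using tri(4) iso unfolding isolated_free_def by blast
    then have "card Q \<le> 3" using card_mono[of "{x, y, w}" Q] by (simp add: card_insert_if split: if_splits)
    then show False using card by simp
  qed
  then obtain c where c: "c \<in> Q" "\<not> has_matching (Q - {c}) (Suc 0)" by blast
  obtain T where T: "T \<subseteq> Q" "c \<in> T" "admissible 4 T" "\<And>T'. T' \<subseteq> T \<Longrightarrow> admissible 4 T' \<Longrightarrow> c \<in> T'"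
    using ess[OF c(1)] by (rule essentialE) (rule that)
  have finT: "finite T" using T(1) fin finite_subset by blast
  have no1: "\<not> has_matching (T - {c}) (Suc 0)"
    using has_matching_mono[of "T - {c}" "Q - {c}"] c(2) T(1) by blast
  then have no1': "\<not> has_matching (T - {c}) (Suc (Suc 0))" unfolding has_matching_1 has_matching_2 by blast
  have cT: "Suc (card (T - {c})) = card T" using finT T(2) by (rule card_Suc_Diff1)
  have "card T \<le> 4" using card_mono[OF fin T(1)] card by simp
  moreover have "card T \<ge> 2" using admissible_card[OF T(3)] by simp
  ultimately consider "card (T - {c}) = 1" | "card (T - {c}) = 2" | "card (T - {c}) = 3" using cT by linarith
  then show False
  proof cases
    case 1
    then obtain x where x: "T - {c} = {x}" using card_1_singletonE by blast
    then have "x \<in> Q" "x \<noteq> c" using T(1) by auto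
    then obtain y where y: "y \<in> Q" "R x y" using iso unfolding isolated_free_def by blast
    have "\<not> has_matching T (Suc 0)" using admissible_2[of T 4] T(3) cT 1 by simp
    then have "y \<noteq> c" using y x T(2) unfolding has_matching_1 by blast
    then show False using c(2) y \<open>x \<in> Q\<close> \<open>x \<noteq> c\<close> unfolding has_matching_1 by blast
  next
    case 2
    then have "admissible 4 (T - {c})" using admissible_2[of "T - {c}" 4] no1 by simp
    then show False using T(4)[of "T - {c}"] by blast
  next
    case 3
    then have "admissible 4 (T - {c})" using admissible_1[of "T - {c}" 4] no1' by simp
    then show False using T(4)[of "T - {c}"] by blast
  qed
qed

text \<open>The aim is that every \<open>Q - {p}\<close> has two disjoint edges, so that the bound
  of five vertices applies. Two obstructions have to be refuted by essentiality: a
  \<open>Q - {p}\<close> whose edges form a triangle (\<open>no_tri\<close>), and a pair of vertices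
  meeting all edges (\<open>no_cover\<close>).\<close>

lemma essential_missing_0:
  assumes fin: "finite Q" and card: "card Q = m" and "5 \<le> m" and iso: "isolated_free Q"
    and ess: "\<And>c. c \<in> Q \<Longrightarrow> essential m Q c"
  shows "m = 5 \<and> (\<forall>T\<subseteq>Q. admissible m T \<longrightarrow> T = Q)"
proof -
  have Qne: "Q \<noteq> {}" using card \<open>5 \<le> m\<close> by auto
  have cover: "u \<in> {c, d} \<or> v \<in> {c, d}"
    if "\<not> has_matching (Q - {c, d}) (Suc 0)" "u \<in> Q" "v \<in> Q" "R u v" for c d u v
    using that unfolding has_matching_1 by blast
  \<comment> \<open>This is where \<open>5 \<le> m\<close> enters: four vertices never exhaust
    \<open>Q\<close>.\<close>
  have big: "\<exists>z\<in>Q. z \<notin> {a, b, c, d}" for a b c d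
  proof (rule ccontr)
    assume "\<not> ?thesis"
    then have "Q \<subseteq> {a, b, c, d}" by blast
    then have "card Q \<le> 4" using card_mono[of "{a, b, c, d}" Q] by (simp add: card_insert_if split: if_splits)
    then show False using card \<open>5 \<le> m\<close> by simp
  qed
  have card1: "Suc (card (Q - {p})) = m" if "p \<in> Q" for p
    using card_Suc_Diff1[OF fin that] card by (simp only:)
  have card2: "Suc (Suc (card (Q - {p, q}))) = m" if "p \<in> Q" "q \<in> Q" "p \<noteq> q" for p q
  proof -
    have "Q - {p, q} = Q - {p} - {q}" by auto
    moreover have "Suc (card (Q - {p} - {q})) = card (Q - {p})"
      using that fin by (intro card_Suc_Diff1) auto
    ultimately show ?thesis using card1[OF that(1)] by (simp only:)
  qed
  have sub: "T = Q \<or> (\<exists>p\<in>Q. T = Q - {p} \<and> \<not> has_matching T (Suc (Suc 0)))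
      \<or> (\<exists>p\<in>Q. \<exists>q\<in>Q. p \<noteq> q \<and> T = Q - {p, q} \<and> \<not> has_matching T (Suc 0))"
    if T: "T \<subseteq> Q" "admissible m T" for T
  proof (cases "T = Q")
    case False
    then have "card T < card Q" using T fin by (simp add: psubset_card_mono psubsetI)
    then consider "Suc (card T) = card Q" | "Suc (Suc (card T)) = card Q"
      using admissible_card[OF T(2)] card by linarith
    then show ?thesis
    proof cases
      case 1
      then show ?thesis using subset_card_Suc[OF fin T(1)] admissible_1[of T m] card T(2) by metis
    next
      case 2
      then show ?thesis using subset_card_Suc_Suc[OF fin T(1)] admissible_2[of T m] card T(2) by metis
    qed
  qed simp
  \<comment> \<open>deleting one vertex cannot leave a triangle\<close>
  have no_tri: "\<exists>c\<in>Q - {p}. \<not> has_matching (Q - {p, c}) (Suc 0)"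
    if p: "p \<in> Q" "\<not> has_matching (Q - {p}) (Suc (Suc 0))" for p
  proof (rule ccontr)
    assume "\<not> ?thesis"
    then have nc: "has_matching (Q - {p} - {c}) (Suc 0)" if "c \<in> Q - {p}" for c
      using that by (simp add: Diff_insert2[symmetric] insert_commute)
    have "Q - {p} \<noteq> {}" using big[of p p p p] by auto
    then obtain x y w where tri: "x \<in> Q - {p}" "y \<in> Q - {p}" "w \<in> Q - {p}" "R x y" "R y w" "R x w"
      and edges: "\<And>u v. u \<in> Q - {p} \<Longrightarrow> v \<in> Q - {p} \<Longrightarrow> R u v \<Longrightarrow> u \<in> {x, y, w} \<and> v \<in> {x, y, w}"
      using triangle_if_no_matching_2[OF p(2) nc] by metis
    have ne: "x \<noteq> y" "y \<noteq> w" "x \<noteq> w" using tri R_irrefl by auto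
    have zp: "R z p" if "z \<in> Q" "z \<notin> {x, y, w, p}" for z
      using iso that edges unfolding isolated_free_def by blast
    obtain z where z: "z \<in> Q" "z \<notin> {x, y, w, p}" using big by blast
    \<comment> \<open>A vertex \<open>z\<close> outside the triangle is joined to \<open>p\<close>
      only, so the gap condition for \<open>z p\<close> and a triangle edge makes \<open>p\<close>
      adjacent to an end of that edge.\<close>
    have adj: "R p u \<or> R p v" if "R u v" "u \<in> {x, y, w}" "v \<in> {x, y, w}" for u v
      using R_gap[OF zp[OF z] that(1)] edges[of z] z that tri by blast
    have padj: "R p x \<or> R p y" "R p y \<or> R p w" "R p x \<or> R p w" using adj tri by blast+
    obtain T where T: "T \<subseteq> Q" "p \<in> T" "admissible m T" "\<And>T'. T' \<subseteq> T \<Longrightarrow> admissible m T' \<Longrightarrow> p \<in> T'"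
      using ess[OF p(1)] by (rule essentialE) (rule that)
    have "admissible m (Q - {p})" using admissible_1[OF card1[OF p(1)]] p(2) by blast
    then have "T \<noteq> Q" using T(4)[of "Q - {p}"] by auto
    then consider (1) c where "T = Q - {c}" "\<not> has_matching T (Suc (Suc 0))"
      | (2) c d where "T = Q - {c, d}" "\<not> has_matching T (Suc 0)"
      using sub[OF T(1,3)] by blast
    \<comment> \<open>Both shapes of \<open>T\<close> keep \<open>p\<close>. In the first, two
      disjoint edges survive: \<open>z p\<close> with a triangle edge or, when \<open>z\<close> is
      gone, an edge from \<open>p\<close> with the opposite side. In the second, \<open>z\<close>
      must be removed, and one further vertex does not destroy the triangle.\<close>
    then show False
    proof cases
      case 1
      have "\<exists>u v. u \<in> {x, y, w} \<and> v \<in> {x, y, w} \<and> u \<noteq> c \<and> v \<noteq> c \<and> R u v"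
        using tri ne by blast
      then obtain u v where uv: "u \<in> {x, y, w}" "v \<in> {x, y, w}" "u \<noteq> c" "v \<noteq> c" "R u v" by blast
      show False
      proof (cases "c = z")
        case False
        have "has_matching T (Suc (Suc 0))"
          by (rule has_matching_2I[of u _ v z p]) (use 1 False uv z T(2) tri zp in auto)
        then show False using 1 by blast
      next
        case True
        have "\<exists>a b d. {a, b, d} = {x, y, w} \<and> R p a \<and> R b d \<and> a \<noteq> b \<and> a \<noteq> d"
          using padj tri ne R_sym by blast
        then obtain a b d where abd: "{a, b, d} = {x, y, w}" "R p a" "R b d" "a \<noteq> b" "a \<noteq> d" by blast
        then have mem: "a \<in> {x, y, w}" "b \<in> {x, y, w}" "d \<in> {x, y, w}" by blast+
        have "has_matching T (Suc (Suc 0))"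
          by (rule has_matching_2I[of p _ a b d]) (use 1 True mem abd z T(2) tri in auto)
        then show False using 1 by blast
      qed
    next
      case 2
      have "z \<in> {c, d}"
        using 2 zp[OF z] z T(2) unfolding has_matching_1 by blast
      then obtain k where k: "{c, d} = {z, k}" by blast
      have "\<exists>u v. u \<in> {x, y, w} \<and> v \<in> {x, y, w} \<and> u \<noteq> k \<and> v \<noteq> k \<and> R u v"
        using tri ne by blast
      then obtain u v where "u \<in> {x, y, w}" "v \<in> {x, y, w}" "u \<noteq> k" "v \<noteq> k" "R u v" by blast
      moreover from this have "u \<in> Q - {c, d}" "v \<in> Q - {c, d}" unfolding k using z tri by auto
      ultimately show False using 2 unfolding has_matching_1 by blast
    qed
  qed
  have no_cover: "has_matching (Q - {c, d}) (Suc 0)" if cd: "c \<in> Q" "d \<in> Q" "c \<noteq> d" for c d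
  proof (rule ccontr)
    assume no: "\<not> has_matching (Q - {c, d}) (Suc 0)"
    have adm: "admissible m (Q - {c, d})" using admissible_2[OF card2[OF cd]] no by blast
    \<comment> \<open>Essentiality of \<open>e\<close> yields a pair that meets all edges and does
      not contain \<open>e\<close>.\<close>
    have avoid: "\<exists>f\<in>Q - {e}. \<exists>g\<in>Q - {e}. f \<noteq> g \<and> \<not> has_matching (Q - {f, g}) (Suc 0)" if e: "e \<in> Q" for e
    proof -
      obtain T where T: "T \<subseteq> Q" "e \<in> T" "admissible m T" "\<And>T'. T' \<subseteq> T \<Longrightarrow> admissible m T' \<Longrightarrow> e \<in> T'"
        using ess[OF e] by (rule essentialE) (rule that)
      consider (0) "T = Q" | (1) p where "p \<in> Q" "T = Q - {p}" "\<not> has_matching T (Suc (Suc 0))"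
        | (2) f g where "f \<in> Q" "g \<in> Q" "f \<noteq> g" "T = Q - {f, g}" "\<not> has_matching T (Suc 0)"
        using sub[OF T(1,3)] by blast
      then show ?thesis
      proof cases
        case 0
        then have "e \<notin> {c, d}" using T(4)[of "Q - {c, d}"] adm by blast
        then show ?thesis using cd no by blast
      next
        case 1
        then obtain c' where c': "c' \<in> Q - {p}" "\<not> has_matching (Q - {p, c'}) (Suc 0)" using no_tri[OF 1(1)] 1(2,3) by blast
        have "p \<noteq> c'" "c' \<in> Q" using c' by auto
        then have "admissible m (Q - {p, c'})" using admissible_2[OF card2[OF 1(1)]] c'(2) by blast
        moreover have "Q - {p, c'} \<subseteq> T" using 1 by blast
        ultimately have "e \<in> Q - {p, c'}" using T(4) by blast
        then have "p \<in> Q - {e}" "c' \<in> Q - {e}" using 1(1) \<open>c' \<in> Q\<close> by auto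
        then show ?thesis using c'(2) \<open>p \<noteq> c'\<close> by metis
      next
        case 2
        then show ?thesis using T(2) by blast
      qed
    qed
    obtain e f where ef: "e \<in> Q - {c}" "f \<in> Q - {c}" "e \<noteq> f" "\<not> has_matching (Q - {e, f}) (Suc 0)"
      using avoid[OF cd(1)] by blast
    \<comment> \<open>Otherwise a fifth vertex would be isolated: its neighbour would have to lie in
      two disjoint pairs.\<close>
    have "d \<in> {e, f}"
    proof (rule ccontr)
      assume nd: "d \<notin> {e, f}"
      obtain z where z: "z \<in> Q" "z \<notin> {c, d, e, f}" using big by blast
      then obtain y where y: "y \<in> Q" "R z y" using iso unfolding isolated_free_def by blast
      show False using cover[OF no z(1) y] cover[OF ef(4) z(1) y] z ef nd by blast
    qed
    then obtain e' where e': "e' \<in> Q" "e' \<noteq> c" "e' \<noteq> d" "\<not> has_matching (Q - {d, e'}) (Suc 0)"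
      using ef by (auto simp: insert_commute)
    obtain h g where hg: "h \<in> Q - {d}" "g \<in> Q - {d}" "h \<noteq> g" "\<not> has_matching (Q - {h, g}) (Suc 0)"
      using avoid[OF cd(2)] by blast
    show False
    \<comment> \<open>Now \<open>{c, d}\<close>, \<open>{d, e'}\<close> and \<open>{h, g}\<close>
      all meet every edge, and \<open>d\<close> is not in the last. Either an edge at
      \<open>c\<close> escapes \<open>{h, g}\<close>, or the five names stand for at most four
      vertices; then a further vertex has only \<open>d\<close> as neighbour, and that edge escapes
      \<open>{h, g}\<close>.\<close>
    proof (cases "{h, g} \<inter> {c, e'} = {}")
      case True
      obtain y where y: "y \<in> Q" "R c y" using iso cd(1) unfolding isolated_free_def by blast
      have "y = e' \<or> y = d" using cover[OF e'(4) cd(1) y] e' cd by blast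
      then show False using cover[OF hg(4) cd(1) y] True hg by blast
    next
      case False
      then obtain k where k: "{c, d, e', h, g} \<subseteq> {c, d, e', k}" "k \<in> {h, g}" by blast
      obtain z where z: "z \<in> Q" "z \<notin> {c, d, e', k}" using big by blast
      then obtain y where y: "y \<in> Q" "R z y" using iso unfolding isolated_free_def by blast
      have "y = d" using cover[OF no z(1) y] cover[OF e'(4) z(1) y] z e' by blast
      then show False using cover[OF hg(4) z(1) y] z k hg by blast
    qed
  qed
  have avoid2: "has_matching (Q - {p}) (Suc (Suc 0))" if p: "p \<in> Q" for p
    using no_tri[OF p] no_cover[OF p] by blast
  have only: "T = Q" if "T \<subseteq> Q" "admissible m T" for T
    using sub[OF that] avoid2 no_cover by blast
  obtain c where c: "c \<in> Q" using Qne by auto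
  then have "admissible m Q" using ess[OF c] only unfolding essential_def by blast
  then have "\<not> has_matching Q (Suc (Suc (Suc 0)))" using admissible_0[OF card] by blast
  then have "card Q \<le> 5" using card_le_5_if_matchings_avoid[OF fin _ iso avoid2] by blast
  then show ?thesis using card \<open>5 \<le> m\<close> only by auto
qed

end

section \<open>Cohomology of the strands of the cube\<close>

locale gap_free_graph = gap_free_relation adj for adj :: "'v::{finite,linorder} \<Rightarrow> 'v \<Rightarrow> bool"

text \<open>Pairs \<open>(v, j)\<close> are clones of the vertex \<open>v\<close>.\<close>

sublocale gap_free_graph \<subseteq> clone: gap_free_relation "\<lambda>p q :: 'v \<times> nat. adj (fst p) (fst q)"
  using R_sym R_irrefl R_gap by unfold_locales blast+

context gap_free_graph begin

definition edgeless :: "'v set \<Rightarrow> bool" where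
  "edgeless \<sigma> \<longleftrightarrow> (\<forall>x\<in>\<sigma>. \<forall>y\<in>\<sigma>. \<not> adj x y)"

definition untouched :: "'v set \<Rightarrow> ('v \<times> nat) set \<Rightarrow> bool" where
  "untouched \<sigma> T \<longleftrightarrow> (\<forall>p\<in>T. \<forall>x\<in>\<sigma>. \<not> adj (fst p) x)"

text \<open>Enlarging a member of \<open>S\<close> weakens its condition, so only minimal members
  matter. Adding a member intersects families, and uniting families corresponds to uniting members,
  so Mayer-Vietoris stays within this class.\<close>

definition spoiled :: "'v set \<Rightarrow> ('v \<times> nat) set set \<Rightarrow> 'v set set" where
  "spoiled N S = {\<sigma>. N \<subseteq> \<sigma> \<and> (\<forall>T\<in>S. \<not> (edgeless \<sigma> \<and> untouched \<sigma> T))}"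

lemma upset_spoiled: "upset (spoiled N S)"
  unfolding upset_def spoiled_def edgeless_def untouched_def by blast

lemma spoiled_insert: "spoiled N (insert T S) = spoiled N S \<inter> spoiled N {T}"
  unfolding spoiled_def by blast

lemma untouched_Un: "untouched \<sigma> (T \<union> T') \<longleftrightarrow> untouched \<sigma> T \<and> untouched \<sigma> T'"
  unfolding untouched_def by blast

lemma spoiled_Un: "spoiled N S \<union> spoiled N {T} = spoiled N ((\<lambda>T'. T \<union> T') ` S)"
  unfolding spoiled_def by (auto simp: untouched_Un)

lemma untouched_mono: "T' \<subseteq> T \<Longrightarrow> untouched \<sigma> T \<Longrightarrow> untouched \<sigma> T'"
  unfolding untouched_def by blast

lemma spoiled_mono: "(\<And>T. T \<in> S \<Longrightarrow> \<exists>T'\<in>S'. T' \<subseteq> T) \<Longrightarrow> spoiled N S' \<subseteq> spoiled N S"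
  unfolding spoiled_def using untouched_mono by blast

lemma spoiled_eqI:
  assumes "\<And>T. T \<in> S \<Longrightarrow> \<exists>T'\<in>S'. T' \<subseteq> T" "\<And>T. T \<in> S' \<Longrightarrow> \<exists>T'\<in>S. T' \<subseteq> T"
  shows "spoiled N S = spoiled N S'"
  using spoiled_mono[of S S', OF assms(1)] spoiled_mono[of S' S, OF assms(2)] by blast

lemma vanishes_above:
  assumes "z \<notin> N"
  shows "vanishes TYPE('k::comm_ring_1) {\<sigma>. N \<subseteq> \<sigma>} p"
  by (rule vanishes_toggle[of z]) (use assms in auto)

text \<open>An edge inside \<open>T\<close> makes edgelessness automatic: an edge in an untouched
  \<sigma> would form a gap with it. What is left does not notice \<open>z\<close>, which has no
  neighbour in \<open>T\<close>.\<close>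

lemma vanishes_spoiled_edge:
  assumes "z \<notin> N" "\<And>p. p \<in> T \<Longrightarrow> \<not> adj z (fst p)" "a \<in> T" "b \<in> T" "adj (fst a) (fst b)"
  shows "vanishes TYPE('k::comm_ring_1) (spoiled N {T}) p"
proof (rule vanishes_toggle[of z])
  fix \<sigma>
  have "edgeless \<sigma>" if "untouched \<sigma> T" for \<sigma>
    unfolding edgeless_def using that assms(3,4) R_gap[OF assms(5)]
    unfolding untouched_def by blast
  moreover have "untouched (insert z \<sigma>) T \<longleftrightarrow> untouched \<sigma> T"
    unfolding untouched_def using assms(2) R_sym by blast
  ultimately have "edgeless (insert z \<sigma>) \<and> untouched (insert z \<sigma>) T \<longleftrightarrow> edgeless \<sigma> \<and> untouched \<sigma> T"
    by blast
  then show "insert z \<sigma> \<in> spoiled N {T} \<longleftrightarrow> \<sigma> \<in> spoiled N {T}"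
    unfolding spoiled_def using assms(1) by auto
qed

text \<open>If \<open>t\<close> has no neighbour in \<open>T\<close>, adding its vertex to an
  untouched \<sigma> creates no edge and touches nothing in \<open>T\<close>.\<close>

lemma vanishes_spoiled_cone:
  assumes "t \<in> T" "fst t \<notin> N" "\<And>p. p \<in> T \<Longrightarrow> \<not> adj (fst t) (fst p)"
  shows "vanishes TYPE('k::comm_ring_1) (spoiled N {T}) p"
proof (rule vanishes_toggle[of "fst t"])
  fix \<sigma>
  have "edgeless (insert (fst t) \<sigma>) \<and> untouched (insert (fst t) \<sigma>) T \<longleftrightarrow> edgeless \<sigma> \<and> untouched \<sigma> T"
    unfolding untouched_def edgeless_def using assms R_sym R_irrefl by blast
  then show "insert (fst t) \<sigma> \<in> spoiled N {T} \<longleftrightarrow> \<sigma> \<in> spoiled N {T}"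
    unfolding spoiled_def using assms(2) by auto
qed

lemma vanishes_spoiled_single:
  assumes "z \<notin> N" "\<And>p. p \<in> T \<Longrightarrow> \<not> adj z (fst p)" "T \<noteq> {}" "\<And>p. p \<in> T \<Longrightarrow> fst p \<notin> N"
  shows "vanishes TYPE('k::comm_ring_1) (spoiled N {T}) p"
proof (cases "\<exists>a\<in>T. \<exists>b\<in>T. adj (fst a) (fst b)")
  case True
  then obtain a b where "a \<in> T" "b \<in> T" "adj (fst a) (fst b)" by blast
  then show ?thesis using vanishes_spoiled_edge[OF assms(1,2)] by blast
next
  case False
  from \<open>T \<noteq> {}\<close> obtain t where "t \<in> T" by auto
  then show ?thesis using False vanishes_spoiled_cone[of t T N] assms(4) by blast
qed

text \<open>If every vertex outside \<open>N\<close> has a neighbour in \<open>T\<close>, an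
  untouched \<sigma> lies inside \<open>N\<close>. The family is then everything above
  \<open>N\<close>, possibly without \<open>N\<close> itself, and removing that one set creates
  cohomology in degree \<open>card N + 1\<close> only.\<close>

lemma vanishes_spoiled_single_above:
  assumes "T \<noteq> {}" "\<And>p. p \<in> T \<Longrightarrow> fst p \<notin> N" "p \<ge> card N + 2"
  shows "vanishes TYPE('k::comm_ring_1) (spoiled N {T}) p"
proof (cases "\<exists>z. z \<notin> N \<and> (\<forall>p\<in>T. \<not> adj z (fst p))")
  case True
  then show ?thesis using vanishes_spoiled_single[OF _ _ assms(1,2)] by metis
next
  case False
  from \<open>T \<noteq> {}\<close> obtain t where t: "t \<in> T" by auto
  then have tN: "fst t \<notin> N" using assms(2) by blast
  have sub: "\<sigma> \<subseteq> N" if "untouched \<sigma> T" for \<sigma>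
    using False R_sym that unfolding untouched_def by blast
  show ?thesis
  proof (cases "edgeless N \<and> untouched N T")
    case F: False
    have "\<not> (edgeless \<sigma> \<and> untouched \<sigma> T)" if "N \<subseteq> \<sigma>" for \<sigma>
      using sub[of \<sigma>] F that by (cases "\<sigma> = N") auto
    then have "spoiled N {T} = {\<sigma>. N \<subseteq> \<sigma>}"
      unfolding spoiled_def by auto
    then show ?thesis using vanishes_above[OF tN] by simp
  next
    case T: True
    have "edgeless \<sigma> \<and> untouched \<sigma> T \<longleftrightarrow> \<sigma> = N" if "N \<subseteq> \<sigma>" for \<sigma>
      using sub[of \<sigma>] T that by auto
    then have eq: "spoiled N {T} = {\<sigma>. N \<subseteq> \<sigma> \<and> \<sigma> \<noteq> N}"
      unfolding spoiled_def by auto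
    show ?thesis
    proof (rule vanishesI)
      fix f :: "'v set \<Rightarrow> 'k"
      assume supp: "\<And>\<sigma>. \<sigma> \<notin> spoiled N {T} \<Longrightarrow> f \<sigma> = 0"
        and cyc: "\<And>\<tau>. card \<tau> = Suc p \<Longrightarrow> koszul_diff (\<lambda>_. 1) f \<tau> = 0"
      obtain g where g: "\<And>\<sigma>. \<sigma> \<notin> {\<sigma>. N \<subseteq> \<sigma>} \<Longrightarrow> g \<sigma> = 0"
        "\<And>\<sigma>. card \<sigma> = p \<Longrightarrow> f \<sigma> = koszul_diff (\<lambda>_. 1) g \<sigma>"
        using vanishesE[OF vanishes_above[OF tN], of f p] supp cyc unfolding eq by blast
      \<comment> \<open>Clearing the value at \<open>N\<close> is harmless, because a coboundary in
        cardinality \<open>p\<close> sees sets of cardinality \<open>p - 1 > card N\<close>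
        only.\<close>
      define g' where "g' \<sigma> = (if \<sigma> = N then 0 else g \<sigma>)" for \<sigma>
      have "f \<sigma> = koszul_diff (\<lambda>_. 1) g' \<sigma>" if "card \<sigma> = p" for \<sigma>
        unfolding g(2)[OF that]
        by (rule koszul_diff_cong) (use that assms(3) in \<open>auto simp: g'_def\<close>)
      moreover have "g' \<sigma> = 0" if "\<sigma> \<notin> spoiled N {T}" for \<sigma>
        using that g(1) unfolding eq g'_def by auto
      ultimately show "\<exists>g. (\<forall>\<sigma>. \<sigma> \<notin> spoiled N {T} \<longrightarrow> g \<sigma> = 0) \<and>
          (\<forall>\<sigma>. card \<sigma> = p \<longrightarrow> f \<sigma> = koszul_diff (\<lambda>_. 1) g \<sigma>)" by blast
    qed
  qed
qed

lemma vanishes_spoiled_insert: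
  assumes "vanishes TYPE('k::comm_ring_1) (spoiled N S) p" "vanishes TYPE('k) (spoiled N {T}) p"
    "vanishes TYPE('k) (spoiled N ((\<lambda>T'. T \<union> T') ` S)) (p - 1)"
  shows "vanishes TYPE('k) (spoiled N (insert T S)) p"
  by (subst spoiled_insert, rule vanishes_Int[OF upset_spoiled upset_spoiled assms(1,2)], subst spoiled_Un, rule assms(3))

text \<open>A \<open>z\<close> without neighbours in any member has none in their unions either, so
  the Mayer-Vietoris induction loses no degree.\<close>

lemma vanishes_spoiled_cone_family:
  assumes "finite S" "S \<noteq> {}" "z \<notin> N"
    "\<And>T. T \<in> S \<Longrightarrow> T \<noteq> {}" "\<And>T p. T \<in> S \<Longrightarrow> p \<in> T \<Longrightarrow> fst p \<notin> N \<and> \<not> adj z (fst p)"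
  shows "vanishes TYPE('k::comm_ring_1) (spoiled N S) p"
  using assms
proof (induction "card S" arbitrary: S p rule: less_induct)
  case (less S p)
  from less(3) obtain T where T: "T \<in> S" by auto
  define S' where "S' = S - {T}"
  have S: "S = insert T S'" "T \<notin> S'" "finite S'" using T less(2) by (auto simp: S'_def)
  have single: "vanishes TYPE('k) (spoiled N {T}) p"
    using vanishes_spoiled_single[of z N T] less(4-6) T by blast
  show ?case
  proof (cases "S' = {}")
    case True then show ?thesis using single S by simp
  next
    case False
    have c: "card S' < card S" using S by simp
    have c': "card ((\<lambda>T'. T \<union> T') ` S') < card S" using c card_image_le[OF S(3), of "\<lambda>T'. T \<union> T'"] by linarith
    have "vanishes TYPE('k) (spoiled N (insert T S')) p"
    proof (rule vanishes_spoiled_insert[OF _ single])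
      show "vanishes TYPE('k) (spoiled N S') p"
        by (rule less(1)[OF c]) (use S False less(4-6) in auto)
      show "vanishes TYPE('k) (spoiled N ((\<lambda>T'. T \<union> T') ` S')) (p - 1)"
        by (rule less(1)[OF c']) (use S False less(4-6) in auto)
    qed
    then show ?thesis using S(1) by simp
  qed
qed

text \<open>Each further member costs one degree: the family of unions is needed at
  \<open>p - 1\<close>, but has fewer members.\<close>

lemma vanishes_spoiled_family:
  assumes "finite S" "S \<noteq> {}" "\<And>T. T \<in> S \<Longrightarrow> T \<noteq> {}" "\<And>T p. T \<in> S \<Longrightarrow> p \<in> T \<Longrightarrow> fst p \<notin> N"
    "p \<ge> card N + 1 + card S"
  shows "vanishes TYPE('k::comm_ring_1) (spoiled N S) p"
  using assms
proof (induction "card S" arbitrary: S p rule: less_induct)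
  case (less S p)
  from less(3) obtain T where T: "T \<in> S" by auto
  define S' where "S' = S - {T}"
  have S: "S = insert T S'" "T \<notin> S'" "finite S'" using T less(2) by (auto simp: S'_def)
  have single: "vanishes TYPE('k) (spoiled N {T}) p"
    by (rule vanishes_spoiled_single_above) (use less(4-6) T S in auto)
  show ?case
  proof (cases "S' = {}")
    case True then show ?thesis using single S by simp
  next
    case False
    have c: "card S' < card S" using S by simp
    have le: "card ((\<lambda>T'. T \<union> T') ` S') \<le> card S'" by (rule card_image_le[OF S(3)])
    then have c': "card ((\<lambda>T'. T \<union> T') ` S') < card S" using c by linarith
    have "vanishes TYPE('k) (spoiled N (insert T S')) p"
    proof (rule vanishes_spoiled_insert[OF _ single])
      show "vanishes TYPE('k) (spoiled N S') p"
        by (rule less(1)[OF c]) (use S False less(4-6) in auto)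
      have "p - 1 \<ge> card N + 1 + card ((\<lambda>T'. T \<union> T') ` S')" using le c less(6) by linarith
      then show "vanishes TYPE('k) (spoiled N ((\<lambda>T'. T \<union> T') ` S')) (p - 1)"
        by (intro less(1)[OF c']) (use S False less(4,5) in auto)
    qed
    then show ?thesis using S(1) by simp
  qed
qed

text \<open>When all unions contain the single set \<open>T \<union> T0\<close>, the family of
  unions collapses to it, and the bound stays at \<open>card N + 3\<close> however many members
  \<open>S\<close> has.\<close>

lemma vanishes_spoiled_attach:
  assumes "vanishes TYPE('k::comm_ring_1) (spoiled N S) p" "p \<ge> card N + 3"
    "T0 \<in> S" "\<And>T'. T' \<in> S \<Longrightarrow> T0 \<subseteq> T' \<union> T" "T \<noteq> {}" "\<And>p. p \<in> T \<union> T0 \<Longrightarrow> fst p \<notin> N"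
  shows "vanishes TYPE('k) (spoiled N (insert T S)) p"
proof (rule vanishes_spoiled_insert[OF assms(1)])
  show "vanishes TYPE('k) (spoiled N {T}) p"
    by (rule vanishes_spoiled_single_above) (use assms in auto)
  have "spoiled N ((\<lambda>T'. T \<union> T') ` S) = spoiled N {T \<union> T0}"
  proof (rule spoiled_eqI)
    fix T'' assume "T'' \<in> (\<lambda>T'. T \<union> T') ` S"
    then obtain T' where "T' \<in> S" "T'' = T \<union> T'" by blast
    then have "T \<union> T0 \<subseteq> T''" using assms(4)[of T'] by blast
    then show "\<exists>T'\<in>{T \<union> T0}. T' \<subseteq> T''" by simp
  qed (use assms(3) in auto)
  moreover have "vanishes TYPE('k) (spoiled N {T \<union> T0}) (p - 1)"
    by (rule vanishes_spoiled_single_above) (use assms in auto)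
  ultimately show "vanishes TYPE('k) (spoiled N ((\<lambda>T'. T \<union> T') ` S)) (p - 1)" by simp
qed

text \<open>
  Let \<open>T\<close> be the set of clones not adjacent to an edgeless \<open>\<sigma>\<close>, among \<open>m\<close> clones. The
  \<open>m - card T\<close> remaining ones can all be paired with vertices of \<open>\<sigma>\<close>, which are available with
  arbitrary multiplicity. Three disjoint edges exist unless \<open>T\<close> is admissible.
\<close>

definition admissible_family :: "nat \<Rightarrow> ('v \<times> nat) set \<Rightarrow> ('v \<times> nat) set set" where
  "admissible_family m Q = {T. T \<subseteq> Q \<and> clone.admissible m T}"

text \<open>The tightest case, \<open>m = 4\<close>. The minimal admissible sets are the nonadjacent
  pairs and the pairwise adjacent triples. The available bound \<open>card N + 3\<close> covers two
  members by \<open>vanishes_spoiled_family\<close>, while up to four occur; the others are attached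
  at no cost.\<close>

lemma vanishes_path:
  assumes Q: "distinct [a, b, c, d]" "Q = {a, b, c, d}"
    and path: "adj (fst a) (fst b)" "adj (fst b) (fst c)" "adj (fst c) (fst d)"
    and out: "\<And>q. q \<in> Q \<Longrightarrow> fst q \<notin> N" and p: "p \<ge> card N + 3"
  shows "vanishes TYPE('k::comm_ring_1) (spoiled N (admissible_family 4 Q)) p"
proof -
  let ?adj = "\<lambda>p q :: 'v \<times> nat. adj (fst p) (fst q)"
  have ne: "a \<noteq> b" "a \<noteq> c" "a \<noteq> d" "b \<noteq> c" "b \<noteq> d" "c \<noteq> d" using Q(1) by auto
  have pair: "clone.admissible 4 {s, t} \<longleftrightarrow> \<not> ?adj s t" if "s \<noteq> t" for s t
  proof -
    have "clone.admissible 4 {s, t} \<longleftrightarrow> \<not> clone.has_matching {s, t} (Suc 0)"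
      by (rule clone.admissible_2) (use that in simp)
    also have "\<dots> \<longleftrightarrow> \<not> ?adj s t"
      unfolding clone.has_matching_1 using R_sym R_irrefl by auto
    finally show ?thesis .
  qed
  have triple: "clone.admissible 4 {s, t, u}" if "s \<noteq> t" "s \<noteq> u" "t \<noteq> u" for s t u
  proof -
    have "clone.admissible 4 {s, t, u} \<longleftrightarrow> \<not> clone.has_matching {s, t, u} (Suc (Suc 0))"
      by (rule clone.admissible_1) (use that in simp)
    moreover have "\<not> clone.has_matching {s, t, u} (Suc (Suc 0))"
      unfolding clone.has_matching_2 using R_irrefl by auto
    ultimately show ?thesis by blast
  qed
  \<comment> \<open>\<open>B1\<close> and \<open>B2\<close> are the minimal admissible sets within
    \<open>{a, b, c}\<close> and \<open>{b, c, d}\<close>: the end points if these are not adjacent,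
    otherwise the whole triangle.\<close>
  define B1 where "B1 = (if ?adj a c then {a, b, c} else {a, c})"
  define B2 where "B2 = (if ?adj b d then {b, c, d} else {b, d})"
  define F where "F = (if ?adj a d
     then {B1, B2} \<union> (if ?adj b d then {{a, b, d}} else {}) \<union> (if ?adj a c then {{a, c, d}} else {})
     else {B1, {a, d}, B2})"
  have Fadm: "T \<subseteq> Q \<and> clone.admissible 4 T" if "T \<in> F" for T
    using that ne unfolding F_def B1_def B2_def Q(2)
    by (auto split: if_splits simp: pair triple)
  have adjpair: "\<not> T \<subseteq> {s, t}" if "clone.admissible 4 T" "?adj s t" for s t T
  proof
    assume T: "T \<subseteq> {s, t}"
    have st: "s \<noteq> t" using that R_irrefl by auto
    have "card T \<ge> 2" using clone.admissible_card[OF that(1)] by simp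
    then have "T = {s, t}" using T st by (intro card_seteq) auto
    then show False using that pair[OF st] by simp
  qed
  have small: "\<not> T \<subseteq> {s}" if "clone.admissible 4 T" for s T
  proof
    assume "T \<subseteq> {s}"
    then have "card T \<le> 1" using card_mono[of "{s}" T] by simp
    then show False using clone.admissible_card[OF that] by simp
  qed
  have Fmin: "\<exists>T'\<in>F. T' \<subseteq> T" if T: "T \<subseteq> Q" "clone.admissible 4 T" for T
  proof -
    consider "a \<in> T" "c \<in> T" | "b \<in> T" "d \<in> T" | "a \<in> T" "d \<in> T"
      | "T \<subseteq> {a, b}" | "T \<subseteq> {b, c}" | "T \<subseteq> {c, d}"
      using T(1) unfolding Q(2) by blast
    then show ?thesis
    proof cases
      case 1
      then show ?thesis using T(1) adjpair[OF T(2), of a c] unfolding Q(2) F_def B1_def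
        by (cases "b \<in> T"; cases "d \<in> T") auto
    next
      case 2
      then show ?thesis using T(1) adjpair[OF T(2), of b d] unfolding Q(2) F_def B2_def
        by (cases "a \<in> T"; cases "c \<in> T") auto
    next
      case 3
      then show ?thesis using T(1) adjpair[OF T(2), of a d] unfolding Q(2) F_def B1_def B2_def
        by (cases "b \<in> T"; cases "c \<in> T") auto
    qed (use adjpair[OF T(2)] path in blast)+
  qed
  have "spoiled N (admissible_family 4 Q) = spoiled N F"
    by (rule spoiled_eqI) (use Fadm Fmin in \<open>auto simp: admissible_family_def\<close>)
  moreover have "vanishes TYPE('k) (spoiled N F) p"
  proof -
    have two: "vanishes TYPE('k) (spoiled N {X, Y}) p" if "X \<in> F" "Y \<in> F" "X \<noteq> {}" "Y \<noteq> {}" for X Y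
      by (rule vanishes_spoiled_family)
        (use that Fadm out p card_insert_le_m1[of 2 "{Y}" X] in \<open>auto simp: card_insert_if\<close>)
    have Bne: "B1 \<noteq> {}" "B2 \<noteq> {}" "B1 \<subseteq> Q" "B2 \<subseteq> Q" "{a, c} \<subseteq> B1" "{b, d} \<subseteq> B2"
      unfolding B1_def B2_def Q(2) by auto
    show ?thesis
    proof (cases "?adj a d")
      case False
      \<comment> \<open>\<open>{a, d}\<close> lies in \<open>B1 \<union> B2\<close>, so all unions
        reduce to \<open>B2 \<union> {a, d}\<close>.\<close>
      have "vanishes TYPE('k) (spoiled N (insert B2 {B1, {a, d}})) p"
        by (rule vanishes_spoiled_attach[where ?T0.0 = "{a, d}"])
          (use two[of B1 "{a, d}"] False p Bne out in \<open>auto simp: F_def Q(2)\<close>)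
      moreover have "F = insert B2 {B1, {a, d}}" unfolding F_def using False by auto
      ultimately show ?thesis by simp
    next
      case True
      define F1 where "F1 = {B1, B2} \<union> (if ?adj b d then {{a, b, d}} else {})"
      have 0: "vanishes TYPE('k) (spoiled N {B1, B2}) p"
        by (rule two) (use Bne in \<open>auto simp: F_def\<close>)
      have 1: "vanishes TYPE('k) (spoiled N F1) p"
      proof (cases "?adj b d")
        case bd: True
        have "vanishes TYPE('k) (spoiled N (insert {a, b, d} {B1, B2})) p"
          by (rule vanishes_spoiled_attach[where ?T0.0 = B1])
            (use 0 p Bne out bd in \<open>auto simp: B2_def Q(2)\<close>)
        moreover have "F1 = insert {a, b, d} {B1, B2}" unfolding F1_def using bd by auto
        ultimately show ?thesis by simp
      qed (use 0 in \<open>simp add: F1_def\<close>)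
      show ?thesis
      proof (cases "?adj a c")
        case ac: True
        have "vanishes TYPE('k) (spoiled N (insert {a, c, d} F1)) p"
          by (rule vanishes_spoiled_attach[where ?T0.0 = B1])
            (use 1 p Bne out ac in \<open>auto simp: F1_def B1_def Q(2) split: if_splits\<close>)
        moreover have "F = insert {a, c, d} F1" unfolding F1_def F_def using True ac by auto
        ultimately show ?thesis by simp
      next
        case False
        then have "F = F1" unfolding F1_def F_def using True by auto
        then show ?thesis using 1 by simp
      qed
    qed
  qed
  ultimately show ?thesis by simp
qed

text \<open>Induction on \<open>Q\<close> with \<open>m\<close> fixed, deleting inessential clones.
  Without admissible sets everything above \<open>N\<close> remains, and an isolated clone gives a
  cone. In the remaining case \<open>m\<close> is at most 5, and the hypothesis on \<open>p\<close>
  is what each outcome consumes: \<open>card N + 4\<close> for three singletons at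
  \<open>m = 3\<close>, \<open>card N + 3\<close> for a path at \<open>m = 4\<close>, and at least
  \<open>card N + 2\<close> for one set at \<open>m \<le> 5\<close>.\<close>

lemma vanishes_admissible_family:
  assumes "finite Q" "\<And>q. q \<in> Q \<Longrightarrow> fst q \<notin> N" "card Q \<le> m" "3 \<le> m" "z \<notin> N" "p + m > card N + 6"
  shows "vanishes TYPE('k::comm_ring_1) (spoiled N (admissible_family m Q)) p"
  using assms(1-3)
proof (induction "card Q" arbitrary: Q rule: less_induct)
  case (less Q)
  note fin = less(2) and out = less(3) and card = less(4)
  let ?F = "admissible_family m Q"
  have finF: "finite ?F" unfolding admissible_family_def using fin by simp
  have neF: "T \<noteq> {}" if "T \<in> ?F" for T
    using that clone.admissible_card[of m T] \<open>3 \<le> m\<close> unfolding admissible_family_def by auto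
  have single: ?case if only: "\<And>T. T \<in> ?F \<Longrightarrow> T = Q" and "?F \<noteq> {}" "m \<le> 5"
  proof -
    have F: "?F = {Q}" using that(1,2) by blast
    have "Q \<noteq> {}" using neF F by blast
    then show ?thesis unfolding F
      by (rule vanishes_spoiled_single_above) (use out assms(6) \<open>m \<le> 5\<close> in auto)
  qed
  consider (empty) "?F = {}" | (iso) "?F \<noteq> {}" "\<not> clone.isolated_free Q"
    | (drop) c where "c \<in> Q" "\<not> clone.essential m Q c"
    | (ess) "?F \<noteq> {}" "clone.isolated_free Q" "\<And>c. c \<in> Q \<Longrightarrow> clone.essential m Q c" by blast
  then show ?case
  proof cases
    case empty
    then show ?thesis using vanishes_above[OF assms(5)] by (simp add: spoiled_def)
  next
    case iso
    then obtain q where q: "q \<in> Q" "\<And>r. r \<in> Q \<Longrightarrow> \<not> adj (fst q) (fst r)"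
      unfolding clone.isolated_free_def by blast
    show ?thesis
      by (rule vanishes_spoiled_cone_family[OF finF iso(1), of "fst q"])
        (use q out neF in \<open>auto simp: admissible_family_def\<close>)
  next
    case drop
    have "spoiled N ?F = spoiled N (admissible_family m (Q - {c}))"
    proof (rule spoiled_eqI)
      fix T assume T: "T \<in> ?F"
      show "\<exists>T'\<in>admissible_family m (Q - {c}). T' \<subseteq> T"
      proof (cases "c \<in> T")
        case True
        have T': "T \<subseteq> Q" "clone.admissible m T" using T by (auto simp: admissible_family_def)
        then obtain T' where "T' \<subseteq> T" "clone.admissible m T'" "c \<notin> T'"
          using drop(2) True unfolding clone.essential_def by metis
        then show ?thesis using T'(1) by (intro bexI[of _ T']) (auto simp: admissible_family_def)
      qed (use T in \<open>auto simp: admissible_family_def\<close>)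
    qed (auto simp: admissible_family_def)
    moreover have "card (Q - {c}) < card Q" by (rule card_Diff1_less[OF fin drop(1)])
    moreover have "vanishes TYPE('k) (spoiled N (admissible_family m (Q - {c}))) p"
      by (rule less(1)) (use calculation fin out card in auto)
    ultimately show ?thesis by simp
  next
    case ess
    from ess(1) obtain T where "T \<subseteq> Q" "clone.admissible m T" unfolding admissible_family_def by blast
    then have lo: "m \<le> card Q + 2" using clone.admissible_card[of m T] card_mono[OF fin, of T] by linarith
    show ?thesis
    \<comment> \<open>For \<open>m = 3\<close> a single clone is already admissible, there being no
      loops, so at most three singletons determine the family.\<close>
    proof (cases "m = 3")
      case True
      have sing: "clone.admissible m {q}" for q
      proof -
        have "clone.admissible m {q} \<longleftrightarrow> \<not> clone.has_matching {q} (Suc 0)"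
          by (rule clone.admissible_2) (simp add: True)
        then show ?thesis unfolding clone.has_matching_1 using R_irrefl by auto
      qed
      have "spoiled N ?F = spoiled N ((\<lambda>q. {q}) ` Q)"
      proof (rule spoiled_eqI)
        fix T assume T: "T \<in> ?F"
        then obtain q where "q \<in> T" using neF by blast
        then show "\<exists>T'\<in>(\<lambda>q. {q}) ` Q. T' \<subseteq> T" using T by (auto simp: admissible_family_def)
      next
        fix T assume "T \<in> (\<lambda>q. {q}) ` Q"
        then show "\<exists>T'\<in>?F. T' \<subseteq> T" using sing by (auto simp: admissible_family_def)
      qed
      moreover have "card ((\<lambda>q. {q}) ` Q) \<le> 3" using card_image_le[OF fin, of "\<lambda>q. {q}"] card True by simp
      then have "vanishes TYPE('k) (spoiled N ((\<lambda>q. {q}) ` Q)) p"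
        using assms(6) True lo fin out by (intro vanishes_spoiled_family) auto
      ultimately show ?thesis by simp
    next
      case False
      then have m4: "4 \<le> m" using \<open>3 \<le> m\<close> by simp
      then have "Q \<noteq> {}" using lo by auto
      then obtain c where c: "c \<in> Q" by auto
      consider "Suc (Suc (card Q)) = m" | "Suc (card Q) = m" | "card Q = m" using lo card by linarith
      then show ?thesis
      proof cases
        case 1
        then show ?thesis using clone.essential_missing_2[OF fin _ ess(2) c ess(3)[OF c]] by blast
      next
        case 2
        then have "m = 4 \<and> (\<forall>T\<subseteq>Q. clone.admissible m T \<longrightarrow> T = Q)"
          using clone.essential_missing_1[OF fin _ m4 ess(2,3)] by blast
        then show ?thesis using single ess(1) unfolding admissible_family_def by auto
      next
        case 3
        show ?thesis
        proof (cases "m = 4")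
          case True
          have "clone.has_matching Q (Suc (Suc 0))"
            by (rule clone.essential_missing_0_4[OF fin]) (use 3 True ess in auto)
          then obtain a b c d where *: "distinct [a, b, c, d]" "Q = {a, b, c, d}"
            "adj (fst a) (fst b)" "adj (fst b) (fst c)" "adj (fst c) (fst d)"
            by (rule clone.path_if_matching_2[OF _ fin]) (use 3 True in auto)
          show ?thesis unfolding True
            by (rule vanishes_path[OF *]) (use out assms(6) True in auto)
        next
          case False
          then have "5 \<le> m" using m4 by simp
          then have "m = 5 \<and> (\<forall>T\<subseteq>Q. clone.admissible m T \<longrightarrow> T = Q)"
            using clone.essential_missing_0[OF fin 3 _ ess(2,3)] by blast
          then show ?thesis using single ess(1) unfolding admissible_family_def by auto
        qed
      qed
    qed
  qed
qed

end

section \<open>Matchings as indexed families of disjoint pairs\<close>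

context gap_free_relation begin

lemma has_matching_le: "n' \<le> n \<Longrightarrow> has_matching T n \<Longrightarrow> has_matching T n'"
proof (induction n arbitrary: n' T)
  case (Suc n)
  show ?case
  proof (cases n')
    case (Suc k)
    then show ?thesis using Suc.IH[of k] Suc.prems unfolding has_matching.simps(2) Suc by auto
  qed simp
qed simp

lemma has_matchingI:
  assumes "finite I" "\<And>i. i \<in> I \<Longrightarrow> x i \<in> T \<and> y i \<in> T \<and> R (x i) (y i)"
    "\<And>i j. i \<in> I \<Longrightarrow> j \<in> I \<Longrightarrow> i \<noteq> j \<Longrightarrow> {x i, y i} \<inter> {x j, y j} = {}"
  shows "has_matching T (card I)"
  using assms
proof (induction I arbitrary: T rule: finite_induct)
  case (insert i I)
  have "has_matching (T - {x i, y i}) (card I)"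
  proof (rule insert.IH)
    fix j assume "j \<in> I"
    moreover from this insert.hyps have "i \<noteq> j" by auto
    ultimately show "x j \<in> T - {x i, y i} \<and> y j \<in> T - {x i, y i} \<and> R (x j) (y j)"
      using insert.prems(1)[of j] insert.prems(2)[of i j] by auto
  qed (use insert.prems(2) in auto)
  then show ?case using insert.prems(1)[of i] insert.hyps unfolding card_insert_disjoint[OF insert.hyps] has_matching.simps(2) by blast
qed simp

lemma has_matchingE:
  assumes "has_matching T n"
  obtains x y where "\<And>i. i < n \<Longrightarrow> x i \<in> T \<and> y i \<in> T \<and> R (x i) (y i)"
    "\<And>i j. i < n \<Longrightarrow> j < n \<Longrightarrow> i \<noteq> j \<Longrightarrow> {x i, y i} \<inter> {x j, y j} = {}"
  using assms
proof (induction n arbitrary: T thesis)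
  case (Suc n)
  from Suc.prems(2) obtain a b where ab: "a \<in> T" "b \<in> T" "R a b" "has_matching (T - {a, b}) n"
    unfolding has_matching.simps(2) by blast
  obtain x y where xy: "\<And>i. i < n \<Longrightarrow> x i \<in> T - {a, b} \<and> y i \<in> T - {a, b} \<and> R (x i) (y i)"
    "\<And>i j. i < n \<Longrightarrow> j < n \<Longrightarrow> i \<noteq> j \<Longrightarrow> {x i, y i} \<inter> {x j, y j} = {}"
    by (rule Suc.IH[OF _ ab(4)]) (rule that)
  show ?case
  proof (rule Suc.prems(1)[of "x(n := a)" "y(n := b)"])
    fix i assume "i < Suc n"
    then show "(x(n := a)) i \<in> T \<and> (y(n := b)) i \<in> T \<and> R ((x(n := a)) i) ((y(n := b)) i)"
      using xy(1)[of i] ab by (cases "i = n") auto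
  next
    fix i j assume *: "i < Suc n" "j < Suc n" "i \<noteq> j"
    show "{(x(n := a)) i, (y(n := b)) i} \<inter> {(x(n := a)) j, (y(n := b)) j} = {}"
    proof (cases "i = n \<or> j = n")
      case True
      then show ?thesis using * xy(1)[of i] xy(1)[of j] by auto
    next
      case False
      then show ?thesis using * xy(2)[of i j] by simp
    qed
  qed
qed blast

end

section \<open>Monomials of the cube and its Cech boxes\<close>

text \<open>
  The exponents of the monomials in the \<open>s\<close>-th power of the edge ideal: the endpoints of the \<open>s\<close>
  edges are \<open>occ 0, \<dots>, occ (2 s - 1)\<close>.
\<close>

definition power_exps :: "('v \<Rightarrow> 'v \<Rightarrow> bool) \<Rightarrow> nat \<Rightarrow> ('v \<Rightarrow> int) set" where
  "power_exps adj s = {u. \<exists>occ. (\<forall>i<s. adj (occ (2 * i)) (occ (2 * i + 1))) \<and>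
     (\<forall>v. int (card {k. k < 2 * s \<and> occ k = v}) \<le> u v)}"

lemma up_exps_power_exps: "up_exps (power_exps adj s)"
  unfolding up_exps_def power_exps_def le_fun_def by (auto, meson order_trans)

lemma power_exps_nonneg: "u \<in> power_exps adj s \<Longrightarrow> 0 \<le> u v"
  unfolding power_exps_def by (auto, meson of_nat_0_le_iff order_trans)

definition clones :: "('v \<Rightarrow> int) \<Rightarrow> ('v \<times> nat) set" where
  "clones a = {(v, j). int j < a v}"

lemma clones_eq_Sigma: "clones a = Sigma UNIV (\<lambda>v. {..<nat (a v)})"
  unfolding clones_def by auto

lemma finite_clones: "finite (clones (a :: 'v::finite \<Rightarrow> int))"
  unfolding clones_eq_Sigma by simp

lemma card_clones:
  fixes a :: "'v::finite \<Rightarrow> int"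
  shows "card (clones a) = (\<Sum>v\<in>UNIV. nat (a v))"
  unfolding clones_eq_Sigma by (simp add: card_SigmaI)

text \<open>Negative coordinates all equal \<open>- 1\<close>, so the total degree is the number of
  clones minus that of negative vertices.\<close>

lemma sum_eq_card_clones:
  fixes a :: "'v::finite \<Rightarrow> int"
  assumes "\<And>v. - 1 \<le> a v"
  shows "sum a UNIV = int (card (clones a)) - int (card {v. a v = - 1})"
proof -
  have "sum a UNIV = (\<Sum>v\<in>UNIV. int (nat (a v)) - of_bool (a v = - 1))"
  proof (rule sum.cong[OF refl])
    fix v show "a v = int (nat (a v)) - of_bool (a v = - 1)"
      using assms[of v] by (cases "a v = - 1") auto
  qed
  also have "\<dots> = int (card (clones a)) - int (card {v. a v = - 1})"
    by (simp add: sum_subtractf card_clones of_bool_def sum.If_cases)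
  finally show ?thesis .
qed

context gap_free_graph begin

text \<open>Suppose three edges fit. As \<sigma> is edgeless, each has an end outside \<sigma>,
  which occupies a clone. An edge that is not a pair of clones in \<open>T\<close> occupies a clone
  outside \<open>T\<close>, because a partner in \<sigma> touches it. There are only
  \<open>card (clones a) - card T\<close> of those, so the other edges form a matching in
  \<open>T\<close> too large for admissibility.\<close>

lemma edgeless_notin_box:
  assumes "N = {v. a v = - 1}" "N \<subseteq> \<sigma>" "edgeless \<sigma>" "untouched \<sigma> T" "T \<subseteq> clones a"
    "clone.admissible (card (clones a)) T"
  shows "\<sigma> \<notin> box (power_exps adj 3) a (\<lambda>_. B)"
proof
  assume "\<sigma> \<in> box (power_exps adj 3) a (\<lambda>_. B)"
  then obtain occ where adj: "\<And>i. i < 3 \<Longrightarrow> adj (occ (2 * i)) (occ (2 * i + 1))"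
    and le: "\<And>v. int (card {k. k < 2 * (3::nat) \<and> occ k = v}) \<le> (if v \<in> \<sigma> then B else a v)"
    unfolding box_def power_exps_def by blast
  \<comment> \<open>A position receives the clone of its vertex numbered by the earlier occurrences
    of that vertex, so different positions receive different clones.\<close>
  define pos where "pos k = (occ k, card {l. l < k \<and> occ l = occ k})" for k
  have pos_ne: "pos k \<noteq> pos l" if "k < l" for k l
  proof
    assume "pos k = pos l"
    then have eq: "occ k = occ l" "card {h. h < k \<and> occ h = occ k} = card {h. h < l \<and> occ h = occ l}"
      by (auto simp: pos_def)
    have "{h. h < k \<and> occ h = occ k} \<subset> {h. h < l \<and> occ h = occ l}" using that eq(1) by auto
    then have "card {h. h < k \<and> occ h = occ k} < card {h. h < l \<and> occ h = occ l}"
      by (intro psubset_card_mono) auto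
    then show False using eq by simp
  qed
  then have pos_inj: "pos k = pos l \<longleftrightarrow> k = l" for k l by (metis linorder_neqE_nat)
  have pos_in: "pos k \<in> clones a" if "k < 6" "occ k \<notin> \<sigma>" for k
  proof -
    have "{h. h < k \<and> occ h = occ k} \<subset> {h. h < 2 * (3::nat) \<and> occ h = occ k}" using that(1) by auto
    then have "card {h. h < k \<and> occ h = occ k} < card {h. h < 2 * (3::nat) \<and> occ h = occ k}"
      by (intro psubset_card_mono) auto
    then show ?thesis using le[of "occ k"] that(2) by (simp add: pos_def clones_def)
  qed
  define I where "I = {i. i < 3 \<and> pos (2 * i) \<in> T \<and> pos (2 * i + 1) \<in> T}"
  have "\<exists>k. (k = 2 * i \<or> k = 2 * i + 1) \<and> pos k \<in> clones a - T" if i: "i < 3" "i \<notin> I" for i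
  proof -
    have lt: "2 * i < 6" "2 * i + 1 < 6" using i by auto
    consider "occ (2 * i) \<notin> \<sigma>" "occ (2 * i + 1) \<notin> \<sigma>" | "occ (2 * i) \<in> \<sigma>" "occ (2 * i + 1) \<notin> \<sigma>"
      | "occ (2 * i) \<notin> \<sigma>" "occ (2 * i + 1) \<in> \<sigma>"
      using adj[OF i(1)] assms(3) unfolding edgeless_def by blast
    then show ?thesis
    proof cases
      case 1
      then have "pos (2 * i) \<in> clones a" "pos (2 * i + 1) \<in> clones a" using pos_in lt by blast+
      then show ?thesis using i unfolding I_def by blast
    next
      case 2
      then have "pos (2 * i + 1) \<notin> T"
        using adj[OF i(1)] assms(4) R_sym unfolding untouched_def pos_def by force
      then show ?thesis using pos_in[OF lt(2) 2(2)] by blast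
    next
      case 3
      then have "pos (2 * i) \<notin> T"
        using adj[OF i(1)] assms(4) unfolding untouched_def pos_def by force
      then show ?thesis using pos_in[OF lt(1) 3(1)] by blast
    qed
  qed
  then obtain kk where kk: "\<And>i. i < 3 \<Longrightarrow> i \<notin> I \<Longrightarrow> (kk i = 2 * i \<or> kk i = 2 * i + 1) \<and> pos (kk i) \<in> clones a - T"
    by metis
  have "inj_on (\<lambda>i. pos (kk i)) ({..<3} - I)"
  proof (rule inj_onI)
    fix i j assume "i \<in> {..<3} - I" "j \<in> {..<3} - I" "pos (kk i) = pos (kk j)"
    then have "kk i = 2 * i \<or> kk i = 2 * i + 1" "kk j = 2 * j \<or> kk j = 2 * j + 1" "kk i = kk j"
      using kk[of i] kk[of j] pos_inj[of "kk i" "kk j"] by auto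
    then show "i = j" by presburger
  qed
  moreover have "(\<lambda>i. pos (kk i)) ` ({..<3} - I) \<subseteq> clones a - T" using kk by auto
  ultimately have "card ({..<3} - I) \<le> card (clones a - T)"
    by (intro card_inj_on_le) (auto simp: finite_clones)
  moreover have "card ({..<3} - I) = 3 - card I"
    by (subst card_Diff_subset) (auto simp: I_def)
  moreover have "card (clones a - T) = card (clones a) - card T"
    using assms(5) finite_subset[OF assms(5) finite_clones] by (simp add: card_Diff_subset)
  ultimately have "3 - (card (clones a) - card T) \<le> card I" by linarith
  moreover have "clone.has_matching T (card I)"
  proof (rule clone.has_matchingI[where x = "\<lambda>i. pos (2 * i)" and y = "\<lambda>i. pos (2 * i + 1)"])
    fix i j :: nat assume "i \<noteq> j"
    then show "{pos (2 * i), pos (2 * i + 1)} \<inter> {pos (2 * j), pos (2 * j + 1)} = {}"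
      by (auto simp: pos_inj)
  qed (use adj in \<open>auto simp: I_def pos_def\<close>)
  ultimately show False
    using assms(6) clone.has_matching_le unfolding clone.admissible_def by blast
qed

text \<open>Without loops an edge contains \<open>v\<close> at most once. Hence
  \<open>3 \<le> B\<close> suffices to make the exponents on \<sigma> no restriction.\<close>

lemma card_occ_le:
  assumes adj: "\<And>i. i < s \<Longrightarrow> adj (occ (2 * i)) (occ (2 * i + 1))"
  shows "card {k. k < 2 * s \<and> occ k = v} \<le> s"
proof -
  have "inj_on (\<lambda>k. k div 2) {k. k < 2 * s \<and> occ k = v}"
  proof (rule inj_onI)
    fix k l assume kl: "k \<in> {k. k < 2 * s \<and> occ k = v}" "l \<in> {k. k < 2 * s \<and> occ k = v}" "k div 2 = l div 2"
    show "k = l"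
    proof (rule ccontr)
      assume "k \<noteq> l"
      then have "k = 2 * (k div 2) \<and> l = 2 * (k div 2) + 1 \<or> l = 2 * (k div 2) \<and> k = 2 * (k div 2) + 1"
        using kl(3) by presburger
      moreover have "occ k = v" "occ l = v" "k div 2 < s" using kl by auto
      ultimately have "adj v v" using adj[of "k div 2"] by auto
      then show False using R_irrefl by blast
    qed
  qed
  moreover have "(\<lambda>k. k div 2) ` {k. k < 2 * s \<and> occ k = v} \<subseteq> {..<s}" by auto
  ultimately have "card {k. k < 2 * s \<and> occ k = v} \<le> card {..<s}"
    by (rule card_inj_on_le) simp
  then show ?thesis by simp
qed

lemma edge_in_box:
  assumes "\<And>v. - 1 \<le> a v" "{v. a v = - 1} \<subseteq> \<sigma>" "\<not> edgeless \<sigma>" "3 \<le> B"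
  shows "\<sigma> \<in> box (power_exps adj 3) a (\<lambda>_. B)"
proof -
  obtain x y where xy: "x \<in> \<sigma>" "y \<in> \<sigma>" "adj x y" using assms(3) unfolding edgeless_def by blast
  define occ where "occ k = (if even k then x else y)" for k :: nat
  have "int (card {k. k < 2 * (3::nat) \<and> occ k = v}) \<le> (if v \<in> \<sigma> then B else a v)" for v
  proof (cases "v \<in> \<sigma>")
    case True
    have "card {k. k < 2 * (3::nat) \<and> occ k = v} \<le> 3"
      by (rule card_occ_le) (use xy in \<open>simp add: occ_def\<close>)
    then show ?thesis using True assms(4) by simp
  next
    case False
    then have "{k. k < 2 * (3::nat) \<and> occ k = v} = {}" using xy by (auto simp: occ_def)
    then have 0: "int (card {k. k < 2 * (3::nat) \<and> occ k = v}) = 0" by (simp only: card.empty of_nat_0)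
    have "a v \<noteq> - 1" using False assms(2) by auto
    then have "0 \<le> (if v \<in> \<sigma> then B else a v)" using False assms(1)[of v] by simp
    then show ?thesis unfolding 0 .
  qed
  moreover have "adj (occ (2 * i)) (occ (2 * i + 1))" for i using xy by (simp add: occ_def)
  ultimately show ?thesis unfolding box_def power_exps_def by blast
qed

text \<open>The converse construction: a matching in \<open>T\<close> supplies \<open>n\<close>
  edges, and distinct clones outside \<open>T\<close> are joined to vertices of \<sigma>, where
  multiplicity is free. Since \<open>T\<close> contains all clones without a neighbour in \<sigma>,
  every other clone has a partner there.\<close>

lemma touched_in_box:
  assumes "\<And>v. - 1 \<le> a v" "{v. a v = - 1} \<subseteq> \<sigma>" "3 \<le> B"
    and T: "T = {p \<in> clones a. untouched \<sigma> {p}}" "\<not> clone.admissible (card (clones a)) T"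
  shows "\<sigma> \<in> box (power_exps adj 3) a (\<lambda>_. B)"
proof -
  define t where "t = card (clones a) - card T"
  define n where "n = 3 - t"
  have sub: "T \<subseteq> clones a" unfolding T by blast
  have finT: "finite T" by (rule finite_subset[OF sub finite_clones])
  have "clone.has_matching T n" using T(2) unfolding clone.admissible_def n_def t_def by blast
  then obtain x y where xy: "\<And>i. i < n \<Longrightarrow> x i \<in> T \<and> y i \<in> T \<and> adj (fst (x i)) (fst (y i))"
    and disj: "\<And>i j. i < n \<Longrightarrow> j < n \<Longrightarrow> i \<noteq> j \<Longrightarrow> {x i, y i} \<inter> {x j, y j} = {}"
    by (rule clone.has_matchingE) (rule that)
  \<comment> \<open>If \<open>t \<ge> 3\<close> then \<open>n = 0\<close> and all three edges start
    at clones outside \<open>T\<close>; in every case there are enough of them.\<close>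
  have "card {n..<3} \<le> card (clones a - T)"
    using sub finT by (simp add: card_Diff_subset n_def t_def)
  then obtain e where e: "e ` {n..<3} \<subseteq> clones a - T" "inj_on e {n..<3}"
    using inj_on_iff_card_le[of "{n..<3}" "clones a - T"] finite_clones by auto
  have "\<exists>s. s \<in> \<sigma> \<and> adj (fst (e i)) s" if "n \<le> i" "i < 3" for i
  proof -
    have "i \<in> {n..<3}" using that by simp
    then have "e i \<in> clones a - T" using e(1) by blast
    then show ?thesis unfolding T untouched_def by blast
  qed
  then obtain s where s: "\<And>i. n \<le> i \<Longrightarrow> i < 3 \<Longrightarrow> s i \<in> \<sigma> \<and> adj (fst (e i)) (s i)" by metis
  \<comment> \<open>Edge \<open>i\<close> occupies the positions \<open>2 * i\<close> and
    \<open>2 * i + 1\<close>. For \<open>i \<ge> n\<close> the odd position is the partner in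
    \<sigma>, which uses up no clone; \<open>pos\<close> is a dummy there.\<close>
  define pos where "pos k = (if k div 2 < n then if even k then x (k div 2) else y (k div 2) else e (k div 2))" for k
  define occ where "occ k = (if k div 2 < n \<or> even k then fst (pos k) else s (k div 2))" for k
  have n3: "n \<le> 3" unfolding n_def by simp
  have adj: "adj (occ (2 * i)) (occ (2 * i + 1))" if "i < 3" for i
    using xy[of i] s[of i] that by (cases "i < n") (auto simp: occ_def pos_def)
  have "int (card {k. k < 2 * (3::nat) \<and> occ k = v}) \<le> (if v \<in> \<sigma> then B else a v)" for v
  proof (cases "v \<in> \<sigma>")
    case True
    have "card {k. k < 2 * (3::nat) \<and> occ k = v} \<le> 3"
      by (rule card_occ_le) (rule adj)
    then show ?thesis using True assms(3) by simp
  next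
    case False
    have av: "0 \<le> a v" using False assms(1)[of v] assms(2) by force
    have pos_kind: "k div 2 < n \<or> even k" "fst (pos k) = v" if "k < 6" "occ k = v" for k
    proof -
      show "k div 2 < n \<or> even k"
      proof (rule ccontr)
        assume "\<not> ?thesis"
        then have "occ k = s (k div 2)" "s (k div 2) \<in> \<sigma>" using s[of "k div 2"] that(1) by (auto simp: occ_def)
        then show False using that False by simp
      qed
      then show "fst (pos k) = v" using that(2) by (simp add: occ_def)
    qed
    have eT: "e i \<in> clones a - T" if "n \<le> i" "i < 3" for i
    proof -
      have "i \<in> {n..<3}" using that by simp
      then show ?thesis using e(1) by blast
    qed
    have "inj_on pos {k. k < 2 * (3::nat) \<and> occ k = v}"
    proof (rule inj_onI)
      fix k l assume kl: "k \<in> {k. k < 2 * (3::nat) \<and> occ k = v}" "l \<in> {k. k < 2 * (3::nat) \<and> occ k = v}" "pos k = pos l"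
      have lt: "k < 6" "l < 6" "k div 2 < 3" "l div 2 < 3" using kl by auto
      have kk: "k div 2 < n \<or> even k" "l div 2 < n \<or> even l" using pos_kind kl by auto
      have "k div 2 = l div 2"
      proof (rule ccontr)
        assume ne: "k div 2 \<noteq> l div 2"
        show False
        proof (cases "k div 2 < n")
          case True
          then have "pos k \<in> {x (k div 2), y (k div 2)}" "pos k \<in> T" using xy by (auto simp: pos_def)
          then show False
            using kl(3) disj[OF True _ ne] eT[of "l div 2"] lt by (auto simp: pos_def split: if_splits)
        next
          case F: False
          then have "pos k = e (k div 2)" "pos k \<notin> T" using eT[of "k div 2"] lt by (auto simp: pos_def)
          moreover from this have "\<not> l div 2 < n" using kl(3) xy[of "l div 2"] by (auto simp: pos_def split: if_splits)
          ultimately have "e (k div 2) = e (l div 2)" using kl(3) by (simp add: pos_def)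
          then show False using inj_onD[OF e(2), of "k div 2" "l div 2"] F \<open>\<not> l div 2 < n\<close> lt ne by simp
        qed
      qed
      moreover have "even k \<longleftrightarrow> even l"
      proof (rule ccontr)
        assume odd: "even k \<noteq> even l"
        then have "k div 2 < n" using kk calculation by auto
        then have "x (k div 2) = y (k div 2)" using kl(3) calculation odd by (auto simp: pos_def split: if_splits)
        then show False using xy[OF \<open>k div 2 < n\<close>] R_irrefl by auto
      qed
      ultimately show "k = l" by presburger
    qed
    moreover have "pos ` {k. k < 2 * (3::nat) \<and> occ k = v} \<subseteq> {v} \<times> {..<nat (a v)}"
    proof
      fix p assume "p \<in> pos ` {k. k < 2 * (3::nat) \<and> occ k = v}"
      then obtain k where k: "k < 6" "occ k = v" "p = pos k" by auto
      have "pos k \<in> clones a"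
        using xy[of "k div 2"] eT[of "k div 2"] sub k(1) by (auto simp: pos_def)
      then show "p \<in> {v} \<times> {..<nat (a v)}" using pos_kind(2)[OF k(1,2)] k(3)
        unfolding clones_def by (cases p) auto
    qed
    ultimately have "card {k. k < 2 * (3::nat) \<and> occ k = v} \<le> card ({v} \<times> {..<nat (a v)})"
      by (rule card_inj_on_le) auto
    then show ?thesis using False av by (simp add: card_cartesian_product)
  qed
  then show ?thesis unfolding box_def power_exps_def using adj by blast
qed

lemma box_eq_spoiled:
  assumes "\<And>v. - 1 \<le> a v" "3 \<le> B"
  shows "box (power_exps adj 3) a (\<lambda>_. B) =
    spoiled {v. a v = - 1} (admissible_family (card (clones a)) (clones a))" (is "?box = ?sp")
proof (intro equalityI subsetI)
  fix \<sigma> assume \<sigma>: "\<sigma> \<in> ?box"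
  have "a v \<noteq> - 1" if "v \<notin> \<sigma>" for v
    using power_exps_nonneg[of "\<lambda>v. if v \<in> \<sigma> then B else a v" adj 3 v] \<sigma> that unfolding box_def by auto
  then have "{v. a v = - 1} \<subseteq> \<sigma>" by blast
  then show "\<sigma> \<in> ?sp" using edgeless_notin_box[OF refl, of a \<sigma>] \<sigma>
    unfolding spoiled_def admissible_family_def by blast
next
  fix \<sigma> assume \<sigma>: "\<sigma> \<in> ?sp"
  then have sub: "{v. a v = - 1} \<subseteq> \<sigma>" unfolding spoiled_def by blast
  show "\<sigma> \<in> ?box"
  proof (cases "edgeless \<sigma>")
    case False
    then show ?thesis using edge_in_box[OF assms(1) sub _ assms(2)] by blast
  next
    case True
    define T where "T = {p \<in> clones a. untouched \<sigma> {p}}"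
    have "untouched \<sigma> T" "T \<subseteq> clones a" unfolding T_def untouched_def by auto
    then have "\<not> clone.admissible (card (clones a)) T"
      using \<sigma> True unfolding spoiled_def admissible_family_def by blast
    then show ?thesis using touched_in_box[OF assms(1) sub assms(2) T_def] by blast
  qed
qed

lemma spoiled_few:
  assumes "m \<le> 2"
  shows "spoiled N (admissible_family m Q) = {\<sigma>. N \<subseteq> \<sigma> \<and> \<not> edgeless \<sigma>}"
proof -
  have "\<not> clone.has_matching {} (Suc n)" for n unfolding clone.has_matching.simps(2) by blast
  moreover have "3 - m = Suc (2 - m)" using assms by simp
  ultimately have "clone.admissible m {}" unfolding clone.admissible_def by simp
  then have "spoiled N (admissible_family m Q) = spoiled N {{}}"
    by (intro spoiled_eqI) (auto simp: admissible_family_def)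
  then show ?thesis by (simp add: spoiled_def untouched_def)
qed

text \<open>Strands with \<open>m \<le> 2\<close> are strands of the edge ideal. They are due for
  \<open>p > card N + 6 - m\<close>, which is most demanding at \<open>m = 2\<close>. Strands with
  \<open>m \<ge> 3\<close> vanish in their range by
  \<open>vanishes_admissible_family\<close>.\<close>

theorem vanishes_cube_iff:
  "(\<forall>a B p. (\<forall>v. - 1 \<le> a v \<and> a v \<le> B) \<and> 3 \<le> B \<and> int p + sum a UNIV > 6 \<longrightarrow>
      vanishes TYPE('k::comm_ring_1) (box (power_exps adj 3) a (\<lambda>_. B)) p) \<longleftrightarrow>
   (\<forall>N p. p > card N + 4 \<longrightarrow> vanishes TYPE('k) {\<sigma>. N \<subseteq> \<sigma> \<and> \<not> edgeless \<sigma>} p)" (is "?L \<longleftrightarrow> ?R")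
proof
  assume R: ?R
  show ?L
  proof (intro allI impI, elim conjE)
    fix a :: "'v \<Rightarrow> int" and B :: int and p
    assume a: "\<forall>v. - 1 \<le> a v \<and> a v \<le> B" and B: "3 \<le> B" and p: "int p + sum a UNIV > 6"
    define N where "N = {v. a v = - 1}"
    define m where "m = card (clones a)"
    have sum: "sum a UNIV = int m - int (card N)" unfolding m_def N_def using sum_eq_card_clones a by blast
    have eq: "box (power_exps adj 3) a (\<lambda>_. B) = spoiled N (admissible_family m (clones a))"
      unfolding N_def m_def using box_eq_spoiled a B by blast
    show "vanishes TYPE('k) (box (power_exps adj 3) a (\<lambda>_. B)) p"
    proof (cases "m \<le> 2")
      case True
      then show ?thesis unfolding eq spoiled_few[OF True] using R p sum by simp
    next
      case False
      then have "clones a \<noteq> {}" unfolding m_def by auto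
      then obtain q where q: "q \<in> clones a" by auto
      have out: "fst q \<notin> N" if "q \<in> clones a" for q
        using that unfolding clones_def N_def by auto
      show ?thesis unfolding eq
        by (rule vanishes_admissible_family[OF finite_clones _ _ _ out[OF q]])
          (use out False p sum m_def in auto)
    qed
  qed
next
  assume L: ?L
  show ?R
  proof (intro allI impI)
    fix N :: "'v set" and p assume p: "p > card N + 4"
    show "vanishes TYPE('k) {\<sigma>. N \<subseteq> \<sigma> \<and> \<not> edgeless \<sigma>} p"
    proof (cases "N = UNIV")
      case True
      show ?thesis
        by (rule vanishes_if_none) (use True p card_mono[of "UNIV :: 'v set"] in \<open>force dest: top_le\<close>)
    next
      case False
      then obtain z where z: "z \<notin> N" by auto
      \<comment> \<open>Two clones of one vertex outside \<open>N\<close> realise the extremal case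
        \<open>m = 2\<close> with negative part \<open>N\<close>.\<close>
      define a where "a v = (if v \<in> N then - 1 else if v = z then 2 else 0 :: int)" for v
      have cl: "clones a = {(z, 0), (z, 1)}"
        using z unfolding clones_def a_def by (auto split: if_splits)
      have N: "{v. a v = - 1} = N" unfolding a_def by auto
      have m: "card (clones a) = 2" unfolding cl by simp
      have a: "- 1 \<le> a v" "a v \<le> 3" for v unfolding a_def by simp_all
      have "sum a UNIV = 2 - int (card N)" using sum_eq_card_clones[of a, OF a(1)] unfolding N m by simp
      then have "vanishes TYPE('k) (box (power_exps adj 3) a (\<lambda>_. 3)) p" using L a p by simp
      then show ?thesis unfolding box_eq_spoiled[of a 3, OF a(1) order_refl] N m by (simp add: spoiled_few)
    qed
  qed
qed

end

section \<open>A gap obstructs linearity of the cube\<close>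

lemma power_exps_induced_edge:
  assumes sym: "\<And>x y. adj x y \<Longrightarrow> adj y x" and irrefl: "\<And>x. \<not> adj x x"
    and u: "u \<in> power_exps adj s" and supp: "\<And>v. v \<notin> {a, b, d} \<Longrightarrow> u v \<le> 0"
    and no: "\<not> adj a d" "\<not> adj b d"
  shows "int s \<le> u a"
proof -
  obtain occ where adj: "\<And>i. i < s \<Longrightarrow> adj (occ (2 * i)) (occ (2 * i + 1))"
    and le: "\<And>v. int (card {k. k < 2 * s \<and> occ k = v}) \<le> u v"
    using u unfolding power_exps_def by blast
  have mem: "occ k \<in> {a, b, d}" if "k < 2 * s" for k
  proof (rule ccontr)
    assume "occ k \<notin> {a, b, d}"
    then have "card {l. l < 2 * s \<and> occ l = occ k} = 0" using le[of "occ k"] supp[of "occ k"] by linarith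
    then have "{l. l < 2 * s \<and> occ l = occ k} = {}" by simp
    then show False using that by blast
  qed
  \<comment> \<open>Within \<open>{a, b, d}\<close> only \<open>a b\<close> is an edge, so each of
    the \<open>s\<close> edges occupies \<open>a\<close>.\<close>
  have "\<exists>k. (k = 2 * i \<or> k = 2 * i + 1) \<and> occ k = a" if "i < s" for i
    using mem[of "2 * i"] mem[of "2 * i + 1"] adj[OF that] that no sym irrefl by auto
  then obtain kk where kk: "\<And>i. i < s \<Longrightarrow> (kk i = 2 * i \<or> kk i = 2 * i + 1) \<and> occ (kk i) = a" by metis
  have "inj_on kk {..<s}"
  proof (rule inj_onI)
    fix i j assume "i \<in> {..<s}" "j \<in> {..<s}" "kk i = kk j"
    then have "kk i = 2 * i \<or> kk i = 2 * i + 1" "kk j = 2 * j \<or> kk j = 2 * j + 1" "kk i = kk j"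
      using kk[of i] kk[of j] by auto
    then show "i = j" by presburger
  qed
  moreover have "kk ` {..<s} \<subseteq> {k. k < 2 * s \<and> occ k = a}" using kk by fastforce
  ultimately have "card {..<s} \<le> card {k. k < 2 * s \<and> occ k = a}" by (rule card_inj_on_le) simp
  then show ?thesis using le[of a] by simp
qed

lemma box_notin_if_negative:
  "v \<notin> \<sigma> \<Longrightarrow> lo v < 0 \<Longrightarrow> \<sigma> \<notin> box (power_exps adj s) lo hi"
  using power_exps_nonneg[of "\<lambda>v. if v \<in> \<sigma> then hi v else lo v" adj s v] unfolding box_def by auto

text \<open>
  The strand below sees a gap \<open>ab, cd\<close> as the 4-cycle \<open>acbd\<close>, whose first cohomology is nonzero.
\<close>

lemma gap_not_vanishes:
  fixes adj :: "'v::{finite,linorder} \<Rightarrow> 'v \<Rightarrow> bool"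
  assumes sym: "\<And>x y. adj x y \<Longrightarrow> adj y x" and irrefl: "\<And>x. \<not> adj x x"
    and abcd: "distinct [a, b, c, d]" "adj a b" "adj c d"
      "\<not> adj a c" "\<not> adj a d" "\<not> adj b c" "\<not> adj b d"
    and lo: "lo = (\<lambda>v. if v \<in> {a, b} then 2 else if v \<in> {c, d} then 0 else - 1 :: int)"
  shows "\<not> vanishes TYPE('k::comm_ring_1) (box (power_exps adj 3) lo (\<lambda>v. lo v + 1)) (card (UNIV :: 'v set) - 1)"
proof
  let ?U = "box (power_exps adj 3) lo (\<lambda>v. lo v + 1)" and ?n = "card (UNIV :: 'v set)"
  define s where "s i \<tau> = (- 1 :: 'k) ^ card {l \<in> \<tau>. l < i}" for i :: 'v and \<tau>
  have ss: "s i \<tau> * s i \<tau> = 1" for i \<tau>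
    unfolding s_def by (simp flip: power_add mult_2)
  have dist: "a \<noteq> b" "a \<noteq> c" "a \<noteq> d" "b \<noteq> c" "b \<noteq> d" "c \<noteq> d" using abcd(1) by auto
  have n: "?n > 0" by (simp add: card_gt_0_iff)
  have in_U: "UNIV - {a} \<in> ?U" "UNIV - {c} \<in> ?U"
  proof -
    \<comment> \<open>The monomials \<open>(ab)^2 cd\<close> and \<open>(ab)^3\<close> divide those
      at \<open>UNIV - {a}\<close> and \<open>UNIV - {c}\<close>, whose exponents on
      \<open>a, b, c, d\<close> are 2, 3, 1, 1 and 3, 3, 0, 1.\<close>
    define occ where "occ = (!) [a, b, a, b, c, d]"
    define occ' where "occ' = (!) [a, b, a, b, a, b]"
    have six: "k < 2 * 3 \<longleftrightarrow> k \<in> {0, 1, 2, 3, 4, 5}" for k :: nat by (simp, arith)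
    have set: "{k. k < 2 * (3::nat) \<and> P k} = set (filter P [0, 1, 2, 3, 4, 5])" for P
      unfolding six set_filter list.set ..
    have "\<forall>i<3. adj (occ (2 * i)) (occ (2 * i + 1))" "\<forall>i<3. adj (occ' (2 * i)) (occ' (2 * i + 1))"
      using abcd unfolding occ_def occ'_def by (auto simp: less_Suc_eq numeral_eq_Suc)
    moreover have "int (card {k. k < 2 * (3::nat) \<and> occ k = v}) \<le> (if v \<in> UNIV - {a} then lo v + 1 else lo v)" for v
      unfolding set occ_def lo using dist by simp
    moreover have "int (card {k. k < 2 * (3::nat) \<and> occ' k = v}) \<le> (if v \<in> UNIV - {c} then lo v + 1 else lo v)" for v
      unfolding set occ'_def lo using dist by simp
    ultimately show "UNIV - {a} \<in> ?U" "UNIV - {c} \<in> ?U" unfolding box_def power_exps_def by blast+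
  qed
  \<comment> \<open>Omitting \<open>x\<close> leaves it exponent 2. Omitting a vertex
    \<open>i\<close> outside \<open>{a, b}\<close> as well gives a negative exponent or removes
    \<open>c\<close> or \<open>d\<close>; then \<open>a b\<close> is the only edge left, and its
    cube needs exponent 3 at \<open>x\<close>.\<close>
  have notin: "UNIV - {x, i} \<notin> ?U" if "{x, y} = {a, b}" "i \<notin> {a, b}" for x y i
  proof
    assume U: "UNIV - {x, i} \<in> ?U"
    have xy: "x \<noteq> y" "x \<in> {a, b}" "y \<in> {a, b}" using that(1) dist by (auto simp: doubleton_eq_iff)
    have "lo i \<ge> 0" using box_notin_if_negative[of i "UNIV - {x, i}" lo] U by fastforce
    then have i: "i = c \<or> i = d" using that(2) unfolding lo by (auto split: if_splits)
    define j where "j = (if i = c then d else c)"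
    have "int 3 \<le> (if x \<in> UNIV - {x, i} then lo x + 1 else lo x)"
    proof (rule power_exps_induced_edge[where adj = adj and s = 3 and a = x and b = y and d = j
        and u = "\<lambda>v. if v \<in> UNIV - {x, i} then lo v + 1 else lo v", OF sym irrefl])
      show "(\<lambda>v. if v \<in> UNIV - {x, i} then lo v + 1 else lo v) \<in> power_exps adj 3"
        using U unfolding box_def by simp
      show "(if v \<in> UNIV - {x, i} then lo v + 1 else lo v) \<le> 0" if "v \<notin> {x, y, j}" for v
        using that i xy \<open>{x, y} = {a, b}\<close> unfolding lo j_def by (auto simp: doubleton_eq_iff split: if_splits)
      show "\<not> adj x j" "\<not> adj y j" using xy abcd unfolding j_def by auto
    qed
    then show False using xy unfolding lo by auto
  qed
  have coface: "koszul_diff (\<lambda>_. 1) g (UNIV - {x}) = s y (UNIV - {x}) * g (UNIV - {a, b})"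
    if xy: "{x, y} = {a, b}" "x \<noteq> y" and g: "\<And>\<sigma>. \<sigma> \<notin> ?U \<Longrightarrow> g \<sigma> = 0" for g :: "'v set \<Rightarrow> 'k" and x y
  proof -
    have "koszul_diff (\<lambda>_. 1) g (UNIV - {x}) = (\<Sum>i\<in>UNIV - {x}. if i = y then s y (UNIV - {x}) * g (UNIV - {a, b}) else 0)"
      unfolding koszul_diff_def
    proof (rule sum.cong[OF refl])
      fix i assume i: "i \<in> UNIV - {x}"
      have e: "UNIV - {x} - {i} = UNIV - {x, i}" by auto
      show "(- 1) ^ card {l \<in> UNIV - {x}. l < i} * 1 * g (UNIV - {x} - {i}) =
          (if i = y then s y (UNIV - {x}) * g (UNIV - {a, b}) else 0)"
      proof (cases "i = y")
        case True
        then show ?thesis unfolding e s_def using xy(1) by simp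
      next
        case False
        then have "i \<notin> {a, b}" using i xy by auto
        then show ?thesis unfolding e using g[OF notin[OF xy(1)]] False by simp
      qed
    qed
    also have "\<dots> = s y (UNIV - {x}) * g (UNIV - {a, b})" using xy(2) by simp
    finally show ?thesis .
  qed
  assume van: "vanishes TYPE('k) ?U (?n - 1)"
  \<comment> \<open>The cocycle lives on the sets omitting \<open>a\<close> and \<open>c\<close>. A
    primitive would have to be a unit at \<open>UNIV - {a, b}\<close>, seen from the set omitting
    \<open>a\<close>, and zero there, seen from the set omitting \<open>b\<close>.\<close>
  define f where "f \<sigma> = (if \<sigma> = UNIV - {a} then s a UNIV else if \<sigma> = UNIV - {c} then - s c UNIV else 0)" for \<sigma>
  have fac: "f (UNIV - {i}) = (if i = a then s a UNIV else if i = c then - s c UNIV else 0)" for i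
  proof -
    have "UNIV - {i} = UNIV - {j} \<longleftrightarrow> i = j" for i j :: 'v by blast
    then show ?thesis unfolding f_def by simp
  qed
  have "koszul_diff (\<lambda>_. 1) f \<tau> = 0" if "card \<tau> = Suc (?n - 1)" for \<tau>
  proof -
    have "\<tau> = UNIV" using that n by (intro card_seteq) auto
    moreover have "koszul_diff (\<lambda>_. 1) f UNIV = (\<Sum>i\<in>UNIV. (if i = a then 1 else 0) + (if i = c then - 1 else 0))"
      unfolding koszul_diff_def s_def[symmetric] fac
      by (intro sum.cong) (use dist in \<open>auto simp: ss\<close>)
    ultimately show ?thesis by (simp add: sum.distrib)
  qed
  moreover have "f \<sigma> = 0" if "\<sigma> \<notin> ?U" for \<sigma> unfolding f_def using in_U that by auto
  ultimately obtain g where g: "\<And>\<sigma>. \<sigma> \<notin> ?U \<Longrightarrow> g \<sigma> = 0" "\<And>\<sigma>. card \<sigma> = ?n - 1 \<Longrightarrow> f \<sigma> = koszul_diff (\<lambda>_. 1) g \<sigma>"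
    using vanishesE[OF van, of f] by blast
  have cc: "card (UNIV - {x}) = ?n - 1" for x :: 'v by simp
  have "s a UNIV = s b (UNIV - {a}) * g (UNIV - {a, b})"
    using g(2)[OF cc[of a]] coface[of a b g] g(1) dist fac[of a] by simp
  moreover have "0 = s a (UNIV - {b}) * g (UNIV - {a, b})"
    using g(2)[OF cc[of b]] coface[of b a g] g(1) dist fac[of b] by (simp add: insert_commute)
  then have "g (UNIV - {a, b}) = 0"
    using ss[of a "UNIV - {b}"] by (metis mult.assoc mult_1 mult_zero_right)
  ultimately have "s a UNIV = 0" by simp
  then show False using ss[of a UNIV] by simp
qed

section \<open>Coefficients and monomial ideals\<close>

definition expo :: "('v::finite \<Rightarrow> int) \<Rightarrow> 'v \<Rightarrow>\<^sub>0 nat" where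
  "expo u = Abs_poly_mapping (\<lambda>v. nat (u v))"

lemma lookup_expo [simp]: "Poly_Mapping.lookup (expo u) v = nat (u v)"
  unfolding expo_def by simp

text \<open>Coefficients are indexed by integer exponent vectors and vanish outside the nonnegative ones.\<close>

definition mcoeff :: "('v::finite, 'k::comm_ring_1) mpoly \<Rightarrow> ('v \<Rightarrow> int) \<Rightarrow> 'k" where
  "mcoeff f u = (if \<forall>v. 0 \<le> u v then Poly_Mapping.lookup f (expo u) else 0)"

lemma mcoeff_nonneg: "mcoeff f u \<noteq> 0 \<Longrightarrow> 0 \<le> u v"
  unfolding mcoeff_def by (auto split: if_splits)

lemma expo_lookup: "expo (\<lambda>v. int (Poly_Mapping.lookup t v)) = t"
  by (rule poly_mapping_eqI) simp

lemma mcoeff_lookup: "mcoeff f (\<lambda>v. int (Poly_Mapping.lookup t v)) = Poly_Mapping.lookup f t"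
  unfolding mcoeff_def by (simp add: expo_lookup)

lemma mcoeff_eqI: "(\<And>u. mcoeff f u = mcoeff g u) \<Longrightarrow> f = g"
  by (rule poly_mapping_eqI) (metis mcoeff_lookup)

lemma mcoeff_0 [simp]: "mcoeff 0 u = 0" unfolding mcoeff_def by simp
lemma mcoeff_add: "mcoeff (f + g) u = mcoeff f u + mcoeff g u" unfolding mcoeff_def by (simp add: lookup_add)
lemma mcoeff_diff: "mcoeff (f - g) u = mcoeff f u - mcoeff g u" unfolding mcoeff_def by (simp add: lookup_minus)
lemma mcoeff_uminus: "mcoeff (- f) u = - mcoeff f u" unfolding mcoeff_def by simp

lemma mcoeff_sum: "mcoeff (\<Sum>i\<in>I. f i) u = (\<Sum>i\<in>I. mcoeff (f i) u)"
  by (induction I rule: infinite_finite_induct) (simp_all add: mcoeff_add)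

lemma mcoeff_sign_mult: "mcoeff ((- 1) ^ n * f) u = (- 1) ^ n * mcoeff f u"
  by (induction n) (simp_all add: mcoeff_uminus)

lemma lookup_single_mult:
  fixes f :: "('v::finite, 'k::comm_ring_1) mpoly"
  shows "Poly_Mapping.lookup (Poly_Mapping.single t c * f) s =
    (if \<forall>v. Poly_Mapping.lookup t v \<le> Poly_Mapping.lookup s v then c * Poly_Mapping.lookup f (s - t) else 0)"
proof -
  have "Poly_Mapping.lookup (Poly_Mapping.single t c * f) s
      = (\<Sum>l. (c * (\<Sum>q. Poly_Mapping.lookup f q when s = t + q)) when l = t)"
    unfolding lookup_mult lookup_single
    by (rule arg_cong[where f = Sum_any]) (auto simp: when_def)
  also have "\<dots> = c * (\<Sum>q. Poly_Mapping.lookup f q when s = t + q)" by simp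
  also have "(\<Sum>q. Poly_Mapping.lookup f q when s = t + q) =
    (if \<forall>v. Poly_Mapping.lookup t v \<le> Poly_Mapping.lookup s v then Poly_Mapping.lookup f (s - t) else 0)"
  proof (cases "\<forall>v. Poly_Mapping.lookup t v \<le> Poly_Mapping.lookup s v")
    case True
    have "s = t + (s - t)"
      by (rule poly_mapping_eqI) (use True in \<open>simp add: lookup_add lookup_minus\<close>)
    then have "s = t + q \<longleftrightarrow> q = s - t" for q by (metis add_diff_cancel_left')
    then show ?thesis using True by simp
  next
    case False
    have "s \<noteq> t + q" for q using False by (auto simp: lookup_add)
    then show ?thesis using False by (simp only: when_def if_False) simp
  qed
  finally show ?thesis by simp
qed

lemma mcoeff_single_mult:
  fixes f :: "('v::finite, 'k::comm_ring_1) mpoly"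
  shows "mcoeff (Poly_Mapping.single t c * f) u = c * mcoeff f (\<lambda>v. u v - int (Poly_Mapping.lookup t v))"
proof (cases "\<forall>v. 0 \<le> u v - int (Poly_Mapping.lookup t v)")
  case True
  then have nn: "\<forall>v. 0 \<le> u v" by (metis diff_ge_0_iff_ge of_nat_0_le_iff order_trans)
  have "expo u - t = expo (\<lambda>v. u v - int (Poly_Mapping.lookup t v))"
    by (rule poly_mapping_eqI) (simp add: lookup_minus nat_diff_distrib')
  moreover have "\<forall>v. Poly_Mapping.lookup t v \<le> nat (u v)"
    using True by (simp add: nat_le_iff le_nat_iff nn)
  ultimately show ?thesis using True nn unfolding mcoeff_def by (simp add: lookup_single_mult)
next
  case False
  then obtain v where v: "u v < int (Poly_Mapping.lookup t v)" by (auto simp: not_le)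
  have "mcoeff (Poly_Mapping.single t c * f) u = 0"
  proof (cases "\<forall>v. 0 \<le> u v")
    case True
    then have "\<not> Poly_Mapping.lookup t v \<le> nat (u v)" using v by (simp add: nat_le_iff le_nat_iff)
    then show ?thesis unfolding mcoeff_def by (auto simp: lookup_single_mult)
  qed (auto simp: mcoeff_def)
  moreover have "mcoeff f (\<lambda>v. u v - int (Poly_Mapping.lookup t v)) = 0"
    using False unfolding mcoeff_def by auto
  ultimately show ?thesis by simp
qed

lemma single_power: "Poly_Mapping.single t (1 :: 'k::comm_ring_1) ^ n = Poly_Mapping.single ((\<Sum>_<n. t) :: 'v \<Rightarrow>\<^sub>0 nat) 1"
proof (induction n)
  case (Suc n)
  then show ?case by (simp add: mult_single add.commute)
qed simp

lemma lookup_sum_const: "Poly_Mapping.lookup (\<Sum>_<n::nat. t :: 'v \<Rightarrow>\<^sub>0 nat) v = n * Poly_Mapping.lookup t v"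
  by (simp add: lookup_sum)

lemma mcoeff_var_power_mult:
  fixes f :: "('v::finite, 'k::comm_ring_1) mpoly"
  shows "mcoeff (var i ^ n * f) u = mcoeff f (u(i := u i - int n))"
proof -
  have "(\<lambda>v. u v - int (Poly_Mapping.lookup (\<Sum>_<n. Poly_Mapping.single i (1::nat)) v)) = u(i := u i - int n)"
    unfolding lookup_sum_const by (auto simp: lookup_single when_def)
  then show ?thesis unfolding var_def single_power mcoeff_single_mult by simp
qed

lemma var_prod_eq_single:
  fixes \<sigma> :: "'v::finite set"
  shows "(var_prod \<sigma> :: ('v, 'k::comm_ring_1) mpoly) = Poly_Mapping.single (\<Sum>v\<in>\<sigma>. Poly_Mapping.single v 1) 1"
proof -
  have "finite \<sigma>" by simp
  then show ?thesis unfolding var_prod_def var_def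
    by (induction \<sigma> rule: finite_induct) (simp_all add: mult_single)
qed

lemma mcoeff_var_prod_power_mult:
  fixes f :: "('v::finite, 'k::comm_ring_1) mpoly"
  shows "mcoeff (var_prod \<sigma> ^ n * f) u = mcoeff f (\<lambda>v. u v - (if v \<in> \<sigma> then int n else 0))"
proof -
  have "(\<lambda>v. u v - int (Poly_Mapping.lookup (\<Sum>_<n. \<Sum>w\<in>\<sigma>. Poly_Mapping.single w (1::nat)) v))
      = (\<lambda>v. u v - (if v \<in> \<sigma> then int n else 0))"
    unfolding lookup_sum_const lookup_sum by (auto simp: lookup_single when_def)
  then show ?thesis unfolding var_prod_eq_single single_power mcoeff_single_mult by simp
qed

lemma finite_mcoeff_support: "finite {u. mcoeff f u \<noteq> 0}"
proof -
  have "{u. mcoeff f u \<noteq> 0} \<subseteq> (\<lambda>t v. int (Poly_Mapping.lookup t v)) ` Poly_Mapping.keys f"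
  proof
    fix u assume "u \<in> {u. mcoeff f u \<noteq> 0}"
    then have u: "\<forall>v. 0 \<le> u v" "expo u \<in> Poly_Mapping.keys f"
      unfolding mcoeff_def by (auto split: if_splits simp: in_keys_iff)
    then have "u = (\<lambda>v. int (Poly_Mapping.lookup (expo u) v))" by auto
    then show "u \<in> (\<lambda>t v. int (Poly_Mapping.lookup t v)) ` Poly_Mapping.keys f" using u(2) by blast
  qed
  then show ?thesis by (rule finite_subset) simp
qed

lemma homogeneous_iff: "homogeneous d f \<longleftrightarrow> (\<forall>u. mcoeff f u \<noteq> 0 \<longrightarrow> sum u UNIV = d)"
proof
  assume h: "homogeneous d f"
  show "\<forall>u. mcoeff f u \<noteq> 0 \<longrightarrow> sum u UNIV = d"
  proof (intro allI impI)
    fix u assume "mcoeff f u \<noteq> 0"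
    then have u: "\<forall>v. 0 \<le> u v" "expo u \<in> Poly_Mapping.keys f"
      unfolding mcoeff_def by (auto split: if_splits simp: in_keys_iff)
    then have "int (\<Sum>v\<in>UNIV. Poly_Mapping.lookup (expo u) v) = d" using h unfolding homogeneous_def by blast
    then show "sum u UNIV = d" using u(1) by simp
  qed
next
  assume "\<forall>u. mcoeff f u \<noteq> 0 \<longrightarrow> sum u UNIV = d"
  then show "homogeneous d f" unfolding homogeneous_def
    by (metis (no_types, lifting) mcoeff_lookup in_keys_iff of_nat_sum sum.cong)
qed

text \<open>Inverse to \<open>mcoeff\<close> on finitely supported families of nonnegative
  exponents; it assembles a polynomial from data found one multidegree at a time.\<close>

definition poly_of :: "(('v::finite \<Rightarrow> int) \<Rightarrow> 'k::comm_ring_1) \<Rightarrow> ('v, 'k) mpoly" where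
  "poly_of c = (\<Sum>u | c u \<noteq> 0. Poly_Mapping.single (expo u) (c u))"

lemma mcoeff_poly_of:
  assumes "finite {u. c u \<noteq> 0}" "\<And>u v. c u \<noteq> 0 \<Longrightarrow> 0 \<le> u v"
  shows "mcoeff (poly_of c) u = c u"
proof -
  have "mcoeff (Poly_Mapping.single (expo w) (c w)) u = (if w = u then c u else 0)" if "c w \<noteq> 0" for w
  proof (cases "\<forall>v. 0 \<le> u v")
    case True
    have "expo w = expo u \<longleftrightarrow> w = u"
    proof
      assume "expo w = expo u"
      then have "nat (w v) = nat (u v)" for v by (metis lookup_expo)
      then show "w = u" using True assms(2)[OF that] by (metis eq_nat_nat_iff ext)
    qed simp
    then show ?thesis using True unfolding mcoeff_def by (auto simp: lookup_single when_def)
  next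
    case False
    then have "w \<noteq> u" using assms(2)[OF that] by auto
    then show ?thesis using False unfolding mcoeff_def by auto
  qed
  then have "mcoeff (poly_of c) u = (\<Sum>w | c w \<noteq> 0. if w = u then c u else 0)"
    unfolding poly_of_def mcoeff_sum by (intro sum.cong) auto
  also have "\<dots> = c u" using assms(1) by simp
  finally show ?thesis .
qed

definition mon_ideal :: "('v::finite \<Rightarrow> int) set \<Rightarrow> ('v, 'k::comm_ring_1) mpoly set" where
  "mon_ideal X = {f. \<forall>u. mcoeff f u \<noteq> 0 \<longrightarrow> u \<in> X}"

lemma module_mult: "Modules.module ((*) :: 'a::comm_ring_1 \<Rightarrow> 'a \<Rightarrow> 'a)"
  by unfold_locales (simp_all add: algebra_simps)

lemma mcoeff_mult_nonzeroE:
  assumes "mcoeff (f * g) u \<noteq> 0"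
  obtains w w' where "mcoeff f w \<noteq> 0" "mcoeff g w' \<noteq> 0" "u = (\<lambda>v. w v + w' v)"
proof -
  have u: "\<forall>v. 0 \<le> u v" "expo u \<in> Poly_Mapping.keys (f * g)"
    using assms unfolding mcoeff_def by (auto split: if_splits simp: in_keys_iff)
  then obtain t t' where t: "t \<in> Poly_Mapping.keys f" "t' \<in> Poly_Mapping.keys g" "expo u = t + t'"
    using keys_mult[of f g] by blast
  have "u v = int (Poly_Mapping.lookup t v) + int (Poly_Mapping.lookup t' v)" for v
  proof -
    have "nat (u v) = Poly_Mapping.lookup t v + Poly_Mapping.lookup t' v"
      using t(3) by (metis lookup_add lookup_expo)
    then show ?thesis using u(1)[rule_format, of v] by linarith
  qed
  then show thesis
    by (intro that[of "\<lambda>v. int (Poly_Mapping.lookup t v)" "\<lambda>v. int (Poly_Mapping.lookup t' v)"])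
      (use t(1,2) in \<open>auto simp: mcoeff_lookup in_keys_iff\<close>)
qed

lemma subspace_mon_ideal:
  assumes "up_exps X"
  shows "module.subspace (*) (mon_ideal X :: ('v::finite, 'k::comm_ring_1) mpoly set)"
  unfolding module.subspace_def[OF module_mult]
proof (intro conjI ballI allI)
  fix f g :: "('v, 'k) mpoly" assume "f \<in> mon_ideal X" "g \<in> mon_ideal X"
  moreover have "mcoeff f u \<noteq> 0 \<or> mcoeff g u \<noteq> 0" if "mcoeff (f + g) u \<noteq> 0" for u
    using that unfolding mcoeff_add by auto
  ultimately show "f + g \<in> mon_ideal X" unfolding mon_ideal_def by blast
next
  fix h f :: "('v, 'k) mpoly" assume f: "f \<in> mon_ideal X"
  show "h * f \<in> mon_ideal X" unfolding mon_ideal_def mem_Collect_eq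
  proof (intro allI impI)
    fix u assume "mcoeff (h * f) u \<noteq> 0"
    then obtain w w' where w: "mcoeff h w \<noteq> 0" "mcoeff f w' \<noteq> 0" "u = (\<lambda>v. w v + w' v)" by (rule mcoeff_mult_nonzeroE)
    have "w' \<in> X" using f w(2) unfolding mon_ideal_def by blast
    then show "u \<in> X" by (rule up_expsD[OF assms]) (use w(3) mcoeff_nonneg[OF w(1)] in simp)
  qed
qed (simp add: mon_ideal_def)

text \<open>A polynomial is the sum of its terms, so it suffices that every term with exponent in
  \<open>X\<close> is a multiple of a generator.\<close>

lemma ideal_gen_eq_mon_idealI:
  fixes B :: "('v::finite, 'k::comm_ring_1) mpoly set"
  assumes up: "up_exps X" and sub: "B \<subseteq> mon_ideal X"
    and gen: "\<And>t c. (\<lambda>v. int (Poly_Mapping.lookup t v)) \<in> X \<Longrightarrow>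
      \<exists>h. \<exists>b\<in>B. Poly_Mapping.single t (c :: 'k) = h * b"
  shows "ideal_gen B = mon_ideal X"
proof
  show "ideal_gen B \<subseteq> mon_ideal X"
    unfolding ideal_gen_def by (rule module.span_minimal[OF module_mult sub subspace_mon_ideal[OF up]])
  show "mon_ideal X \<subseteq> ideal_gen B"
  proof
    fix f :: "('v, 'k) mpoly" assume f: "f \<in> mon_ideal X"
    have "poly_of (mcoeff f) \<in> ideal_gen B"
      unfolding poly_of_def ideal_gen_def
    proof (rule module.span_sum[OF module_mult])
      fix u assume u: "u \<in> {u. mcoeff f u \<noteq> 0}"
      then have "u \<in> X" using f unfolding mon_ideal_def by blast
      moreover have "u = (\<lambda>v. int (Poly_Mapping.lookup (expo u) v))" using mcoeff_nonneg[of f u] u by auto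
      ultimately obtain h b where "b \<in> B" "Poly_Mapping.single (expo u) (mcoeff f u) = h * b" using gen by metis
      then show "Poly_Mapping.single (expo u) (mcoeff f u) \<in> module.span (*) B"
        using module.span_scale[OF module_mult module.span_base[OF module_mult]] by metis
    qed
    moreover have "poly_of (mcoeff f) = f"
      by (rule mcoeff_eqI) (rule mcoeff_poly_of[OF finite_mcoeff_support], rule mcoeff_nonneg)
    ultimately show "f \<in> ideal_gen B" by simp
  qed
qed

text \<open>The last two positions of \<open>occ\<close> carry the new edge. All slack in the
  exponents goes to the second summand, so equality is possible although membership demands only an
  inequality.\<close>

lemma power_exps_Suc:
  "u \<in> power_exps adj (Suc s) \<longleftrightarrow> (\<exists>w\<in>power_exps adj 1. \<exists>w'\<in>power_exps adj s. \<forall>v. u v = w v + w' v)"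
proof -
  have split: "card {k. k < 2 * Suc s \<and> occ k = v} = card {k. k < 2 * s \<and> occ k = v} + card {k. k < 2 * (1::nat) \<and> occ (2 * s + k) = v}"
    for occ :: "nat \<Rightarrow> 'a" and v
  proof -
    have "{k. k < 2 * Suc s \<and> occ k = v} = {k. k < 2 * s \<and> occ k = v} \<union> (+) (2 * s) ` {k. k < 2 * (1::nat) \<and> occ (2 * s + k) = v}"
      (is "?A = ?B \<union> ?C")
    proof (intro equalityI subsetI)
      fix k assume k: "k \<in> ?A"
      show "k \<in> ?B \<union> ?C"
      proof (cases "k < 2 * s")
        case False
        then have "k = 2 * s + (k - 2 * s)" "k - 2 * s < 2 * 1" using k by auto
        then show ?thesis using k by (intro UnI2 image_eqI[of _ _ "k - 2 * s"]) auto
      qed (use k in auto)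
    qed auto
    moreover have "card (?B \<union> ?C) = card ?B + card ?C" by (rule card_Un_disjoint) auto
    moreover have "card ?C = card {k. k < 2 * (1::nat) \<and> occ (2 * s + k) = v}" by (rule card_image) simp
    ultimately show ?thesis by simp
  qed
  show ?thesis
  proof
    assume "u \<in> power_exps adj (Suc s)"
    then obtain occ where adj: "\<And>i. i < Suc s \<Longrightarrow> adj (occ (2 * i)) (occ (2 * i + 1))"
      and le: "\<And>v. int (card {k. k < 2 * Suc s \<and> occ k = v}) \<le> u v"
      unfolding power_exps_def by blast
    define w where "w v = int (card {k. k < 2 * (1::nat) \<and> occ (2 * s + k) = v})" for v
    have "w \<in> power_exps adj 1"
      unfolding power_exps_def mem_Collect_eq using adj[of s]
      by (intro exI[of _ "\<lambda>k. occ (2 * s + k)"]) (simp add: w_def)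
    moreover have "(\<lambda>v. u v - w v) \<in> power_exps adj s"
      unfolding power_exps_def mem_Collect_eq
    proof (intro exI[of _ occ] conjI allI impI)
      show "int (card {k. k < 2 * s \<and> occ k = v}) \<le> u v - w v" for v
        using le[of v] unfolding split w_def by simp
    qed (use adj in simp)
    ultimately show "\<exists>w\<in>power_exps adj 1. \<exists>w'\<in>power_exps adj s. \<forall>v. u v = w v + w' v"
      by (intro bexI[of _ w] bexI[of _ "\<lambda>v. u v - w v"]) auto
  next
    assume "\<exists>w\<in>power_exps adj 1. \<exists>w'\<in>power_exps adj s. \<forall>v. u v = w v + w' v"
    then obtain w w' where u: "\<And>v. u v = w v + w' v" and "w \<in> power_exps adj 1" "w' \<in> power_exps adj s" by blast
    then obtain o1 o2 where o1: "adj (o1 0) (o1 1)" "\<And>v. int (card {k. k < 2 * (1::nat) \<and> o1 k = v}) \<le> w v"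
      and o2: "\<And>i. i < s \<Longrightarrow> adj (o2 (2 * i)) (o2 (2 * i + 1))" "\<And>v. int (card {k. k < 2 * s \<and> o2 k = v}) \<le> w' v"
      unfolding power_exps_def by fastforce
    define occ where "occ k = (if k < 2 * s then o2 k else o1 (k - 2 * s))" for k
    have "int (card {k. k < 2 * Suc s \<and> occ k = v}) \<le> u v" for v
    proof -
      have "{k. k < 2 * s \<and> occ k = v} = {k. k < 2 * s \<and> o2 k = v}"
        "{k. k < 2 * (1::nat) \<and> occ (2 * s + k) = v} = {k. k < 2 * (1::nat) \<and> o1 k = v}"
        by (auto simp: occ_def)
      then show ?thesis using o1(2)[of v] o2(2)[of v] u[of v] unfolding split by simp
    qed
    moreover have "adj (occ (2 * i)) (occ (2 * i + 1))" if "i < Suc s" for i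
      using o1(1) o2(1)[of i] that by (cases "i = s") (auto simp: occ_def)
    ultimately show "u \<in> power_exps adj (Suc s)" unfolding power_exps_def by blast
  qed
qed

lemma power_exps_0: "u \<in> power_exps adj 0 \<longleftrightarrow> (\<forall>v. 0 \<le> u v)"
  unfolding power_exps_def by simp

lemma less_two_mult_one: "k < 2 * (1::nat) \<longleftrightarrow> k = 0 \<or> k = 1"
  by auto

lemma pair_in_power_exps_1:
  assumes "adj x y" "\<And>v. (if v = x then 1 else 0) + (if v = y then 1 else 0) \<le> u v"
  shows "u \<in> power_exps adj 1"
  unfolding power_exps_def mem_Collect_eq
proof (intro exI[of _ "\<lambda>k. if k = 0 then x else y"] conjI allI impI)
  fix v
  have "{k. k < 2 * (1::nat) \<and> (if k = 0 then x else y) = v} = (if v = x then {0} else {}) \<union> (if v = y then {1} else {})"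
    unfolding less_two_mult_one by auto
  then show "int (card {k. k < 2 * (1::nat) \<and> (if k = 0 then x else y) = v}) \<le> u v"
    using assms(2)[of v] by (auto split: if_splits)
qed (use assms(1) in auto)

lemma power_exps_1E:
  assumes "u \<in> power_exps adj 1"
  obtains x y where "adj x y" "\<And>v. (if v = x then 1 else 0) + (if v = y then 1 else 0) \<le> u v"
proof -
  obtain occ where adj: "adj (occ 0) (occ 1)" and le: "\<And>v. int (card {k. k < 2 * (1::nat) \<and> occ k = v}) \<le> u v"
    using assms unfolding power_exps_def by auto
  show thesis
  proof (rule that[OF adj])
    fix v
    have "{k. k < 2 * (1::nat) \<and> occ k = v} = (if v = occ 0 then {0} else {}) \<union> (if v = occ 1 then {1} else {})"
      unfolding less_two_mult_one by (auto intro!: gr0I)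
    then have "card {k. k < 2 * (1::nat) \<and> occ k = v} = (if v = occ 0 then 1 else 0) + (if v = occ 1 then 1 else 0)"
      by auto
    then show "(if v = occ 0 then 1 else 0) + (if v = occ 1 then 1 else 0) \<le> u v" using le[of v] by (auto split: if_splits)
  qed
qed

lemma var_mult_var: "(var i * var j :: ('v, 'k::comm_ring_1) mpoly) =
    Poly_Mapping.single (Poly_Mapping.single i 1 + Poly_Mapping.single j 1) 1"
  unfolding var_def by (simp add: mult_single)

lemma mcoeff_single: "mcoeff (Poly_Mapping.single t c) u = (if u = (\<lambda>v. int (Poly_Mapping.lookup t v)) then c else 0)"
proof (cases "u = (\<lambda>v. int (Poly_Mapping.lookup t v))")
  case True
  then have "mcoeff (Poly_Mapping.single t c) u = Poly_Mapping.lookup (Poly_Mapping.single t c) t"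
    by (simp only: mcoeff_lookup)
  then show ?thesis using True by simp
next
  case False
  have "mcoeff (Poly_Mapping.single t c) u = 0"
  proof (cases "\<forall>v. 0 \<le> u v")
    case True
    then have "u = (\<lambda>v. int (Poly_Mapping.lookup (expo u) v))" by simp
    then have "t \<noteq> expo u" using False by metis
    then show ?thesis unfolding mcoeff_def by (simp add: lookup_single_not_eq)
  qed (auto simp: mcoeff_def)
  then show ?thesis using False by simp
qed

lemma single_in_mon_ideal:
  "(\<lambda>v. int (Poly_Mapping.lookup t v)) \<in> X \<Longrightarrow> Poly_Mapping.single t c \<in> mon_ideal X"
  unfolding mon_ideal_def mcoeff_single mem_Collect_eq by (metis (full_types))

lemma edge_ideal_eq:
  fixes E :: "'v::finite set set"
  shows "(edge_ideal E :: ('v, 'k::comm_ring_1) mpoly set) = mon_ideal (power_exps (\<lambda>x y. {x, y} \<in> E) 1)"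
  unfolding edge_ideal_def
proof (rule ideal_gen_eq_mon_idealI[OF up_exps_power_exps])
  show "{var i * var j |i j. {i, j} \<in> E} \<subseteq> (mon_ideal (power_exps (\<lambda>x y. {x, y} \<in> E) 1) :: ('v, 'k) mpoly set)"
  proof clarify
    fix i j assume "{i, j} \<in> E"
    then show "var i * var j \<in> mon_ideal (power_exps (\<lambda>x y. {x, y} \<in> E) 1)"
      unfolding var_mult_var
      by (intro single_in_mon_ideal pair_in_power_exps_1[of _ i j]) (auto simp: lookup_add lookup_single when_def)
  qed
next
  fix t and c :: 'k assume "(\<lambda>v. int (Poly_Mapping.lookup t v)) \<in> power_exps (\<lambda>x y. {x, y} \<in> E) 1"
  then obtain x y where xy: "{x, y} \<in> E"
    "\<And>v. (if v = x then 1 else 0) + (if v = y then 1 else 0) \<le> int (Poly_Mapping.lookup t v)"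
    by (rule power_exps_1E) (rule that)
  let ?e = "Poly_Mapping.single x (1::nat) + Poly_Mapping.single y 1"
  have "t = (t - ?e) + ?e"
  proof (rule poly_mapping_eqI)
    fix v show "Poly_Mapping.lookup t v = Poly_Mapping.lookup (t - ?e + ?e) v"
      using xy(2)[of v] by (auto simp: lookup_add lookup_minus lookup_single when_def split: if_splits)
  qed
  then have "Poly_Mapping.single t c = Poly_Mapping.single (t - ?e) c * (var x * var y)"
    unfolding var_mult_var mult_single by simp
  then show "\<exists>h. \<exists>b\<in>{var i * var j |i j. {i, j} \<in> E}. Poly_Mapping.single t c = h * b"
    using xy(1) by blast
qed

lemma ideal_power_eq:
  fixes E :: "'v::finite set set"
  shows "ideal_power (edge_ideal E :: ('v, 'k::comm_ring_1) mpoly set) s = mon_ideal (power_exps (\<lambda>x y. {x, y} \<in> E) s)"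
proof (induction s)
  case 0
  then show ?case by (auto simp: mon_ideal_def power_exps_0 intro: mcoeff_nonneg)
next
  case (Suc s)
  let ?X = "power_exps (\<lambda>x y. {x, y} \<in> E)"
  show ?case unfolding ideal_power.simps Suc unfolding edge_ideal_eq
  proof (rule ideal_gen_eq_mon_idealI[OF up_exps_power_exps])
    show "{a * b |a b. a \<in> mon_ideal (?X 1) \<and> b \<in> mon_ideal (?X s)} \<subseteq> (mon_ideal (?X (Suc s)) :: ('v, 'k) mpoly set)"
    proof clarify
      fix a b :: "('v, 'k) mpoly" assume a: "a \<in> mon_ideal (?X 1)" and b: "b \<in> mon_ideal (?X s)"
      show "a * b \<in> mon_ideal (?X (Suc s))" unfolding mon_ideal_def mem_Collect_eq
      proof (intro allI impI)
        fix u assume "mcoeff (a * b) u \<noteq> 0"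
        then obtain w w' where "mcoeff a w \<noteq> 0" "mcoeff b w' \<noteq> 0" "u = (\<lambda>v. w v + w' v)" by (rule mcoeff_mult_nonzeroE)
        then show "u \<in> ?X (Suc s)" using a b unfolding power_exps_Suc mon_ideal_def by blast
      qed
    qed
  next
    fix t and c :: 'k assume "(\<lambda>v. int (Poly_Mapping.lookup t v)) \<in> ?X (Suc s)"
    then obtain w w' where w: "w \<in> ?X 1" "w' \<in> ?X s" "\<And>v. int (Poly_Mapping.lookup t v) = w v + w' v"
      unfolding power_exps_Suc by blast
    have ew: "(\<lambda>v. int (Poly_Mapping.lookup (expo w) v)) = w" "(\<lambda>v. int (Poly_Mapping.lookup (expo w') v)) = w'"
      using power_exps_nonneg[OF w(1)] power_exps_nonneg[OF w(2)] by auto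
    have "t = expo w + expo w'"
    proof (rule poly_mapping_eqI)
      fix v show "Poly_Mapping.lookup t v = Poly_Mapping.lookup (expo w + expo w') v"
        using w(3)[of v] power_exps_nonneg[OF w(1), of v] power_exps_nonneg[OF w(2), of v]
        by (simp add: lookup_add)
    qed
    then have "Poly_Mapping.single t c = 1 * (Poly_Mapping.single (expo w) 1 * Poly_Mapping.single (expo w') c)"
      by (simp add: mult_single)
    moreover have "Poly_Mapping.single (expo w) 1 \<in> (mon_ideal (?X 1) :: ('v, 'k) mpoly set)"
      "Poly_Mapping.single (expo w') c \<in> (mon_ideal (?X s) :: ('v, 'k) mpoly set)"
      by (rule single_in_mon_ideal, simp only: ew w(1,2))+
    ultimately show "\<exists>h. \<exists>b\<in>{a * b |a b. a \<in> mon_ideal (?X 1) \<and> b \<in> mon_ideal (?X s)}. Poly_Mapping.single t c = h * b"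
      by blast
  qed
qed

section \<open>Local cohomology of the edge ideal\<close>

text \<open>The coefficient of \<open>m \<sigma> / x\<sigma>^N\<close> in multidegree
  \<open>a\<close> is that of \<open>m \<sigma>\<close> at this exponent. With \<open>N = 1\<close>
  the same shift grades the Koszul complex.\<close>

definition shift_exps :: "nat \<Rightarrow> 'v set \<Rightarrow> ('v \<Rightarrow> int) \<Rightarrow> 'v \<Rightarrow> int" where
  "shift_exps N \<sigma> a = (\<lambda>v. a v + (if v \<in> \<sigma> then int N else 0))"

lemma sum_shift_exps: "sum (shift_exps N \<sigma> a) (UNIV :: 'v::finite set) = sum a UNIV + int (N * card \<sigma>)"
  unfolding shift_exps_def by (simp add: sum.distrib sum.If_cases)

lemma shift_exps_unshift: "shift_exps N \<sigma> (\<lambda>v. u v - (if v \<in> \<sigma> then int N else 0)) = u"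
  unfolding shift_exps_def by auto

lemma shift_exps_inj: "shift_exps N \<sigma> a = shift_exps N \<sigma> b \<longleftrightarrow> a = b"
  unfolding shift_exps_def by (auto simp: fun_eq_iff)

lemma cech_diff_eq: "cech_diff (*) (N, m) = (N, koszul_diff (\<lambda>i. var i ^ N) m)"
  unfolding cech_diff_def koszul_diff_def by simp

text \<open>Multiplication by \<open>var i ^ N\<close> is absorbed by the change of the shift from
  one set to the next, so in a fixed multidegree the differential has unit weights. The reductions
  to set families rest on this.\<close>

lemma mcoeff_koszul_diff_shift:
  fixes m :: "'v::{finite,linorder} set \<Rightarrow> ('v, 'k::comm_ring_1) mpoly"
  shows "mcoeff (koszul_diff (\<lambda>i. var i ^ N) m \<tau>) (shift_exps N \<tau> a) =
    koszul_diff (\<lambda>_. 1) (\<lambda>\<sigma>. mcoeff (m \<sigma>) (shift_exps N \<sigma> a)) \<tau>"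
proof -
  have "mcoeff ((- 1) ^ n * var i ^ N * m (\<tau> - {i})) (shift_exps N \<tau> a) = (- 1) ^ n * 1 * mcoeff (m (\<tau> - {i})) (shift_exps N (\<tau> - {i}) a)"
    if "i \<in> \<tau>" for i n
  proof -
    have "(shift_exps N \<tau> a)(i := shift_exps N \<tau> a i - int N) = shift_exps N (\<tau> - {i}) a"
      using that by (auto simp: shift_exps_def)
    then show ?thesis by (simp add: mult.assoc mcoeff_sign_mult mcoeff_var_power_mult)
  qed
  then show ?thesis unfolding koszul_diff_def mcoeff_sum by (intro sum.cong) auto
qed

text \<open>Multiplication by a monomial shifts coefficients and loses none, so the clearing
  exponent \<open>M\<close> disappears and fractions are compared in each multidegree.\<close>

lemma cech_eq_iff:
  fixes m m' :: "'v::{finite,linorder} set \<Rightarrow> ('v, 'k::comm_ring_1) mpoly"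
  shows "cech_eq (*) p (N, m) (N', m') \<longleftrightarrow>
    (\<forall>\<sigma>. card \<sigma> = p \<longrightarrow> (\<forall>a. mcoeff (m \<sigma>) (shift_exps N \<sigma> a) = mcoeff (m' \<sigma>) (shift_exps N' \<sigma> a)))"
proof -
  have "(\<exists>M. var_prod \<sigma> ^ (M + N') * m \<sigma> = var_prod \<sigma> ^ (M + N) * m' \<sigma>) \<longleftrightarrow>
    (\<forall>a. mcoeff (m \<sigma>) (shift_exps N \<sigma> a) = mcoeff (m' \<sigma>) (shift_exps N' \<sigma> a))" for \<sigma>
  proof
    assume "\<exists>M. var_prod \<sigma> ^ (M + N') * m \<sigma> = var_prod \<sigma> ^ (M + N) * m' \<sigma>"
    then obtain M where M: "var_prod \<sigma> ^ (M + N') * m \<sigma> = var_prod \<sigma> ^ (M + N) * m' \<sigma>" by blast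
    show "\<forall>a. mcoeff (m \<sigma>) (shift_exps N \<sigma> a) = mcoeff (m' \<sigma>) (shift_exps N' \<sigma> a)"
    proof
      fix a
      let ?u = "shift_exps (M + N + N') \<sigma> a"
      have 1: "(\<lambda>v. ?u v - (if v \<in> \<sigma> then int (M + N') else 0)) = shift_exps N \<sigma> a"
        and 2: "(\<lambda>v. ?u v - (if v \<in> \<sigma> then int (M + N) else 0)) = shift_exps N' \<sigma> a"
        by (auto simp: shift_exps_def)
      show "mcoeff (m \<sigma>) (shift_exps N \<sigma> a) = mcoeff (m' \<sigma>) (shift_exps N' \<sigma> a)"
        using arg_cong[OF M, of "\<lambda>f. mcoeff f ?u"] unfolding mcoeff_var_prod_power_mult 1 2 .
    qed
  next
    assume *: "\<forall>a. mcoeff (m \<sigma>) (shift_exps N \<sigma> a) = mcoeff (m' \<sigma>) (shift_exps N' \<sigma> a)"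
    have "var_prod \<sigma> ^ (0 + N') * m \<sigma> = var_prod \<sigma> ^ (0 + N) * m' \<sigma>"
    proof (rule mcoeff_eqI)
      fix u
      let ?a = "\<lambda>v. u v - (if v \<in> \<sigma> then int (N + N') else 0)"
      have 1: "(\<lambda>v. u v - (if v \<in> \<sigma> then int (0 + N') else 0)) = shift_exps N \<sigma> ?a"
        and 2: "(\<lambda>v. u v - (if v \<in> \<sigma> then int (0 + N) else 0)) = shift_exps N' \<sigma> ?a"
        by (auto simp: shift_exps_def)
      show "mcoeff (var_prod \<sigma> ^ (0 + N') * m \<sigma>) u = mcoeff (var_prod \<sigma> ^ (0 + N) * m' \<sigma>) u"
        unfolding mcoeff_var_prod_power_mult 1 2 using * by blast
    qed
    then show "\<exists>M. var_prod \<sigma> ^ (M + N') * m \<sigma> = var_prod \<sigma> ^ (M + N) * m' \<sigma>" by blast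
  qed
  then show ?thesis unfolding cech_eq_def by simp
qed

text \<open>The sets \<open>\<sigma>\<close> at which the localization of the edge ideal at \<open>x\<sigma>\<close> is nonzero in multidegree \<open>a\<close>.\<close>

definition cech_support :: "('v \<Rightarrow> 'v \<Rightarrow> bool) \<Rightarrow> ('v \<Rightarrow> int) \<Rightarrow> 'v set set" where
  "cech_support adj a = {\<sigma>. (\<forall>v. v \<notin> \<sigma> \<longrightarrow> 0 \<le> a v) \<and>
     (\<exists>x y. adj x y \<and> (x \<in> \<sigma> \<or> 0 < a x) \<and> (y \<in> \<sigma> \<or> 0 < a y))}"

lemma cech_support_if_exps:
  assumes "shift_exps N \<sigma> a \<in> power_exps adj 1"
  shows "\<sigma> \<in> cech_support adj a"
proof -
  obtain x y where xy: "adj x y" "\<And>v. (if v = x then 1 else 0) + (if v = y then 1 else 0) \<le> shift_exps N \<sigma> a v"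
    using power_exps_1E[OF assms] by metis
  have "x \<in> \<sigma> \<or> 0 < a x" "y \<in> \<sigma> \<or> 0 < a y"
    using xy(2)[of x] xy(2)[of y] by (auto simp: shift_exps_def split: if_splits)
  moreover have "0 \<le> a v" if "v \<notin> \<sigma>" for v
    using power_exps_nonneg[OF assms, of v] that by (simp add: shift_exps_def)
  ultimately show ?thesis using xy(1) unfolding cech_support_def by blast
qed

lemma exps_if_cech_support:
  assumes "\<And>x. \<not> adj x x" "\<sigma> \<in> cech_support adj a" "\<And>v. v \<in> \<sigma> \<Longrightarrow> 1 \<le> a v + int N"
  shows "shift_exps N \<sigma> a \<in> power_exps adj 1"
proof -
  obtain x y where xy: "adj x y" "x \<in> \<sigma> \<or> 0 < a x" "y \<in> \<sigma> \<or> 0 < a y" and nn: "\<And>v. v \<notin> \<sigma> \<Longrightarrow> 0 \<le> a v"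
    using assms(2) unfolding cech_support_def by blast
  have "x \<noteq> y" using xy(1) assms(1) by auto
  then have "(if v = x then 1 else 0) + (if v = y then 1 else 0) \<le> shift_exps N \<sigma> a v" for v
    using xy(2,3) nn[of v] assms(3)[of v] by (cases "v \<in> \<sigma>") (auto simp: shift_exps_def)
  then show ?thesis by (rule pair_in_power_exps_1[where adj = adj, OF xy(1)])
qed

text \<open>The edge ideal is squarefree: where \<open>a v\<close> is positive, inverting the
  variable of \<open>v\<close> changes nothing in this multidegree.\<close>

lemma vanishes_cech_support_pos:
  assumes "0 < a v"
  shows "vanishes TYPE('k::comm_ring_1) (cech_support adj a) p"
proof (rule vanishes_toggle[of v])
  fix \<sigma>
  have "0 \<le> a v" using assms by simp
  then have "(\<forall>w. w \<notin> insert v \<sigma> \<longrightarrow> 0 \<le> a w) \<longleftrightarrow> (\<forall>w. w \<notin> \<sigma> \<longrightarrow> 0 \<le> a w)" by (metis insert_iff)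
  moreover have "x \<in> insert v \<sigma> \<or> 0 < a x \<longleftrightarrow> x \<in> \<sigma> \<or> 0 < a x" for x using assms by auto
  ultimately show "insert v \<sigma> \<in> cech_support adj a \<longleftrightarrow> \<sigma> \<in> cech_support adj a"
    unfolding cech_support_def by simp
qed

lemma cech_support_nonpos:
  assumes "\<And>v. a v \<le> 0"
  shows "cech_support adj a = {\<sigma>. {v. a v < 0} \<subseteq> \<sigma> \<and> (\<exists>x\<in>\<sigma>. \<exists>y\<in>\<sigma>. adj x y)}"
proof -
  have "\<not> 0 < a v" for v using assms[of v] by simp
  moreover have "(\<forall>v. v \<notin> \<sigma> \<longrightarrow> 0 \<le> a v) \<longleftrightarrow> {v. a v < 0} \<subseteq> \<sigma>" for \<sigma>
    by (auto simp: not_less[symmetric])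
  ultimately show ?thesis unfolding cech_support_def by (simp add: Bex_def) blast
qed

abbreviation edge_module_gr :: "('v::finite \<Rightarrow> 'v \<Rightarrow> bool) \<Rightarrow> int \<Rightarrow> ('v, 'k::comm_ring_1) mpoly set" where
  "edge_module_gr adj \<equiv> \<lambda>j. {f \<in> mon_ideal (power_exps adj 1). homogeneous j f}"

lemma finite_shifted_support: "finite {a. mcoeff f (shift_exps N \<sigma> a) \<noteq> 0}"
proof -
  have "{a. mcoeff f (shift_exps N \<sigma> a) \<noteq> 0} \<subseteq> (\<lambda>u v. u v - (if v \<in> \<sigma> then int N else 0)) ` {u. mcoeff f u \<noteq> 0}"
  proof
    fix a assume "a \<in> {a. mcoeff f (shift_exps N \<sigma> a) \<noteq> 0}"
    moreover have "a = (\<lambda>v. shift_exps N \<sigma> a v - (if v \<in> \<sigma> then int N else 0))" by (auto simp: shift_exps_def)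
    ultimately show "a \<in> (\<lambda>u v. u v - (if v \<in> \<sigma> then int N else 0)) ` {u. mcoeff f u \<noteq> 0}" by blast
  qed
  then show ?thesis by (rule finite_subset) (simp add: finite_mcoeff_support)
qed

text \<open>Only finitely many multidegrees occur in a cocycle. Each is solved in its set family,
  and the solutions are put over one common denominator.\<close>

lemma local_cohomology_zero_if_vanishes:
  fixes adj :: "'v::{finite,linorder} \<Rightarrow> 'v \<Rightarrow> bool"
  assumes irrefl: "\<And>x. \<not> adj x x"
    and van: "\<And>a. sum a UNIV = j \<Longrightarrow> vanishes TYPE('k::comm_ring_1) (cech_support adj a) p"
  shows "\<not> local_cohomology_nonzero (*) (edge_module_gr adj :: int \<Rightarrow> ('v, 'k) mpoly set) p j"
  unfolding local_cohomology_nonzero_def not_not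
proof
  fix c :: "nat \<times> ('v set \<Rightarrow> ('v, 'k) mpoly)"
  assume c: "c \<in> cech_cocycles (*) (edge_module_gr adj) p j"
  obtain N m where Nm: "c = (N, m)" by (cases c)
  have coch: "c \<in> cech_cochains (edge_module_gr adj) p j" using c unfolding cech_cocycles_def by blast
  then have gr: "m \<sigma> \<in> mon_ideal (power_exps adj 1)" "homogeneous (j + int (N * p)) (m \<sigma>)" if "card \<sigma> = p" for \<sigma>
    using that unfolding cech_cochains_def Nm by auto
  have "cech_eq (*) (Suc p) (cech_diff (*) c) (0, \<lambda>_. 0)" using c unfolding cech_cocycles_def by blast
  then have cyc: "koszul_diff (\<lambda>_. 1) (\<lambda>\<sigma>. mcoeff (m \<sigma>) (shift_exps N \<sigma> a)) \<tau> = 0" if "card \<tau> = Suc p" for \<tau> a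
    using that unfolding Nm cech_diff_eq cech_eq_iff mcoeff_koszul_diff_shift by simp
  define F where "F a \<sigma> = (if card \<sigma> = p then mcoeff (m \<sigma>) (shift_exps N \<sigma> a) else 0)" for a \<sigma>
  have Fne: "\<exists>\<sigma>. card \<sigma> = p \<and> mcoeff (m \<sigma>) (shift_exps N \<sigma> a) \<noteq> 0" if "F a \<noteq> (\<lambda>_. 0)" for a
    using that unfolding F_def fun_eq_iff by (auto split: if_splits)
  have Fsum: "sum a UNIV = j" if nz: "F a \<noteq> (\<lambda>_. 0)" for a
  proof -
    obtain \<sigma> where \<sigma>: "card \<sigma> = p" "mcoeff (m \<sigma>) (shift_exps N \<sigma> a) \<noteq> 0" using Fne[OF nz] by blast
    then have "sum (shift_exps N \<sigma> a) UNIV = j + int (N * p)" using gr(2) unfolding homogeneous_iff by blast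
    then show ?thesis using \<sigma>(1) by (simp add: sum_shift_exps)
  qed
  have Fsupp: "F a \<sigma> = 0" if "\<sigma> \<notin> cech_support adj a" for a \<sigma>
  proof (rule ccontr)
    assume "F a \<sigma> \<noteq> 0"
    then have "card \<sigma> = p" "mcoeff (m \<sigma>) (shift_exps N \<sigma> a) \<noteq> 0" unfolding F_def by (auto split: if_splits)
    then have "shift_exps N \<sigma> a \<in> power_exps adj 1" using gr(1) unfolding mon_ideal_def by blast
    then show False using that cech_support_if_exps by blast
  qed
  \<comment> \<open>The third clause picks the zero solution in multidegrees that do not occur, so
    the solutions have finite support.\<close>
  have "\<exists>g. (\<forall>\<sigma>. \<sigma> \<notin> cech_support adj a \<longrightarrow> g \<sigma> = 0) \<and> (\<forall>\<sigma>. card \<sigma> = p \<longrightarrow> F a \<sigma> = koszul_diff (\<lambda>_. 1) g \<sigma>)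
    \<and> (F a = (\<lambda>_. 0) \<longrightarrow> g = (\<lambda>_. 0))" for a
  proof (cases "F a = (\<lambda>_. 0)")
    case True
    then show ?thesis by (intro exI[of _ "\<lambda>_. 0"]) (simp add: koszul_diff_def)
  next
    case False
    have "koszul_diff (\<lambda>_. 1) (F a) \<tau> = 0" if "card \<tau> = Suc p" for \<tau>
    proof -
      have "koszul_diff (\<lambda>_. 1) (F a) \<tau> = koszul_diff (\<lambda>_. 1) (\<lambda>\<sigma>. mcoeff (m \<sigma>) (shift_exps N \<sigma> a)) \<tau>"
        by (rule koszul_diff_cong) (use that in \<open>simp add: F_def\<close>)
      then show ?thesis using cyc[OF that] by simp
    qed
    then obtain g where "\<And>\<sigma>. \<sigma> \<notin> cech_support adj a \<Longrightarrow> g \<sigma> = 0" "\<And>\<sigma>. card \<sigma> = p \<Longrightarrow> F a \<sigma> = koszul_diff (\<lambda>_. 1) g \<sigma>"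
      using vanishesE[OF van[OF Fsum[OF False]], of "F a"] Fsupp by blast
    then show ?thesis using False by blast
  qed
  then obtain G where G: "\<And>a \<sigma>. \<sigma> \<notin> cech_support adj a \<Longrightarrow> G a \<sigma> = 0"
    "\<And>a \<sigma>. card \<sigma> = p \<Longrightarrow> F a \<sigma> = koszul_diff (\<lambda>_. 1) (G a) \<sigma>"
    "\<And>a. F a = (\<lambda>_. 0) \<Longrightarrow> G a = (\<lambda>_. 0)" by metis
  have "{a. F a \<noteq> (\<lambda>_. 0)} \<subseteq> (\<Union>\<sigma>. {a. mcoeff (m \<sigma>) (shift_exps N \<sigma> a) \<noteq> 0})"
    using Fne by blast
  then have finF: "finite {a. F a \<noteq> (\<lambda>_. 0)}"
    by (rule finite_subset) (simp add: finite_shifted_support)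
  have Flow: "- int N \<le> a v" if nz: "F a \<noteq> (\<lambda>_. 0)" for a v
  proof -
    obtain \<sigma> where "mcoeff (m \<sigma>) (shift_exps N \<sigma> a) \<noteq> 0" using Fne[OF nz] by blast
    then show ?thesis using mcoeff_nonneg[of "m \<sigma>" "shift_exps N \<sigma> a" v] by (auto simp: shift_exps_def split: if_splits)
  qed
  show "c \<in> cech_coboundaries (*) (edge_module_gr adj) p j"
  proof (cases p)
    case 0
    have "mcoeff (m \<sigma>) (shift_exps N \<sigma> a) = 0" if "card \<sigma> = 0" for \<sigma> a
    proof -
      have "\<sigma> = {}" using that by simp
      then show ?thesis using G(2)[of \<sigma> a] 0 by (simp add: F_def koszul_diff_def)
    qed
    then have "cech_eq (*) 0 c (0, \<lambda>_. 0)" unfolding Nm cech_eq_iff by simp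
    then show ?thesis using coch unfolding cech_coboundaries_def 0 by simp
  next
    case (Suc q)
    \<comment> \<open>Occurring multidegrees satisfy \<open>a v \<ge> - N\<close>. One more factor
      in the denominator makes the exponents at the inverted variables at least 1, as an edge
      through them requires.\<close>
    define N' where "N' = N + 1"
    define C where "C \<rho> u = G (\<lambda>v. u v - (if v \<in> \<rho> then int N' else 0)) \<rho>" for \<rho> u
    define m' where "m' \<rho> = poly_of (C \<rho>)" for \<rho>
    have Gne: "F a \<noteq> (\<lambda>_. 0) \<and> shift_exps N' \<rho> a \<in> power_exps adj 1" if "G a \<rho> \<noteq> 0" for a \<rho>
    proof -
      have "F a \<noteq> (\<lambda>_. 0)" using that G(3) by force
      moreover have "\<rho> \<in> cech_support adj a" using that G(1) by blast
      moreover have "1 \<le> a v + int N'" for v using Flow[OF calculation(1), of v] by (simp add: N'_def)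
      ultimately show ?thesis using exps_if_cech_support[where adj = adj and N = N' and \<sigma> = \<rho> and a = a, OF irrefl] by simp
    qed
    have Cne: "(\<exists>a. F a \<noteq> (\<lambda>_. 0) \<and> u = shift_exps N' \<rho> a) \<and> u \<in> power_exps adj 1" if "C \<rho> u \<noteq> 0" for \<rho> u
      using Gne[OF that[unfolded C_def]] shift_exps_unshift[of N' \<rho> u] by metis
    have finC: "finite {u. C \<rho> u \<noteq> 0}" for \<rho>
    proof (rule finite_subset)
      show "{u. C \<rho> u \<noteq> 0} \<subseteq> shift_exps N' \<rho> ` {a. F a \<noteq> (\<lambda>_. 0)}" using Cne by blast
    qed (simp add: finF)
    have Cnn: "0 \<le> u v" if "C \<rho> u \<noteq> 0" for \<rho> u v
      by (rule power_exps_nonneg) (rule Cne[OF that, THEN conjunct2])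
    have mcoeff_m': "mcoeff (m' \<rho>) u = C \<rho> u" for \<rho> u
      unfolding m'_def by (rule mcoeff_poly_of[OF finC]) (rule Cnn)
    have mcoeff_m'_shift: "mcoeff (m' \<rho>) (shift_exps N' \<rho> a) = G a \<rho>" for \<rho> a
      unfolding mcoeff_m' C_def by (rule arg_cong[where f = "\<lambda>b. G b \<rho>"]) (auto simp: shift_exps_def)
    have "(N', m') \<in> cech_cochains (edge_module_gr adj) q j"
      unfolding cech_cochains_def
    proof (clarify, intro conjI)
      fix \<rho> :: "'v set" assume "q = card \<rho>"
      show "m' \<rho> \<in> mon_ideal (power_exps adj 1)"
        unfolding mon_ideal_def mem_Collect_eq mcoeff_m' using Cne by blast
      show "homogeneous (j + int (N' * card \<rho>)) (m' \<rho>)"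
        unfolding homogeneous_iff mcoeff_m'
      proof (intro allI impI)
        fix u assume "C \<rho> u \<noteq> 0"
        then obtain a where "F a \<noteq> (\<lambda>_. 0)" "u = shift_exps N' \<rho> a" using Cne by blast
        then show "sum u UNIV = j + int (N' * card \<rho>)" using Fsum by (simp add: sum_shift_exps)
      qed
    qed
    moreover have "cech_eq (*) p c (cech_diff (*) (N', m'))"
      unfolding Nm cech_diff_eq cech_eq_iff mcoeff_koszul_diff_shift mcoeff_m'_shift
      using G(2) by (auto simp: F_def split: if_splits)
    ultimately show ?thesis using coch unfolding cech_coboundaries_def Suc by auto
  qed
qed

text \<open>A cocycle of the set family is placed in the single multidegree \<open>a\<close>. The
  denominator exponent 2 suffices, since \<open>a\<close> is at least \<open>- 1\<close> and the
  exponents on \<sigma> have to reach 1.\<close>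

lemma vanishes_if_local_cohomology_zero:
  fixes adj :: "'v::{finite,linorder} \<Rightarrow> 'v \<Rightarrow> bool"
  assumes irrefl: "\<And>x. \<not> adj x x" and low: "\<And>v. - 1 \<le> a v"
    and lc: "\<not> local_cohomology_nonzero (*) (edge_module_gr adj :: int \<Rightarrow> ('v, 'k::comm_ring_1) mpoly set) p (sum a UNIV)"
  shows "vanishes TYPE('k) (cech_support adj a) p"
proof (rule vanishesI)
  fix f :: "'v set \<Rightarrow> 'k"
  assume supp: "\<And>\<sigma>. \<sigma> \<notin> cech_support adj a \<Longrightarrow> f \<sigma> = 0"
    and cyc: "\<And>\<tau>. card \<tau> = Suc p \<Longrightarrow> koszul_diff (\<lambda>_. 1) f \<tau> = 0"
  let ?j = "sum a UNIV"
  define m where "m \<sigma> = Poly_Mapping.single (expo (shift_exps 2 \<sigma> a)) (f \<sigma>)" for \<sigma>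
  have exps: "shift_exps 2 \<sigma> a \<in> power_exps adj 1" if "f \<sigma> \<noteq> 0" for \<sigma>
  proof (rule exps_if_cech_support[where adj = adj, OF irrefl])
    show "\<sigma> \<in> cech_support adj a" using supp that by blast
    show "1 \<le> a v + int 2" for v using low[of v] by simp
  qed
  have mcoeff_m: "mcoeff (m \<sigma>) u = (if u = shift_exps 2 \<sigma> a then f \<sigma> else 0)" for \<sigma> u
  proof (cases "f \<sigma> = 0")
    case False
    have "(\<lambda>v. int (Poly_Mapping.lookup (expo (shift_exps 2 \<sigma> a)) v)) = shift_exps 2 \<sigma> a"
      using power_exps_nonneg[OF exps[OF False]] by auto
    then show ?thesis unfolding m_def mcoeff_single by simp
  qed (simp add: m_def)
  have coch: "(2, m) \<in> cech_cochains (edge_module_gr adj) p ?j"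
    unfolding cech_cochains_def
  proof (clarify, intro conjI)
    fix \<sigma> :: "'v set"
    show "m \<sigma> \<in> mon_ideal (power_exps adj 1)"
      unfolding mon_ideal_def mem_Collect_eq mcoeff_m using exps by auto
    show "homogeneous (?j + int (2 * card \<sigma>)) (m \<sigma>)"
      unfolding homogeneous_iff mcoeff_m by (auto simp: sum_shift_exps)
  qed
  have mcoeff_m_shift: "mcoeff (m \<sigma>) (shift_exps 2 \<sigma> b) = (if b = a then f \<sigma> else 0)" for \<sigma> b
    unfolding mcoeff_m shift_exps_inj ..
  have "koszul_diff (\<lambda>_. 1) (\<lambda>\<sigma>. if b = a then f \<sigma> else 0) \<tau> = 0" if "card \<tau> = Suc p" for \<tau> b
    using cyc[OF that] by (cases "b = a") (simp_all add: koszul_diff_def)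
  then have "cech_eq (*) (Suc p) (cech_diff (*) (2, m)) (0, \<lambda>_. 0)"
    unfolding cech_diff_eq cech_eq_iff mcoeff_koszul_diff_shift mcoeff_m_shift by simp
  then have "(2, m) \<in> cech_coboundaries (*) (edge_module_gr adj) p ?j"
    using coch lc unfolding local_cohomology_nonzero_def cech_cocycles_def by blast
  show "\<exists>g. (\<forall>\<sigma>. \<sigma> \<notin> cech_support adj a \<longrightarrow> g \<sigma> = 0) \<and> (\<forall>\<sigma>. card \<sigma> = p \<longrightarrow> f \<sigma> = koszul_diff (\<lambda>_. 1) g \<sigma>)"
  proof (cases p)
    case 0
    then have "cech_eq (*) 0 (2, m) (0, \<lambda>_. 0)"
      using \<open>(2, m) \<in> cech_coboundaries (*) (edge_module_gr adj) p ?j\<close> unfolding cech_coboundaries_def by simp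
    then have "mcoeff (m \<sigma>) (shift_exps 2 \<sigma> a) = 0" if "card \<sigma> = p" for \<sigma>
      using that 0 unfolding cech_eq_iff by simp
    then have "f \<sigma> = 0" if "card \<sigma> = p" for \<sigma>
      using that unfolding mcoeff_m_shift by auto
    then show ?thesis by (intro exI[of _ "\<lambda>_. 0"]) (simp add: koszul_diff_def)
  next
    case (Suc q)
    then obtain b where b: "b \<in> cech_cochains (edge_module_gr adj) q ?j" "cech_eq (*) p (2, m) (cech_diff (*) b)"
      using \<open>(2, m) \<in> cech_coboundaries (*) (edge_module_gr adj) p ?j\<close> unfolding cech_coboundaries_def by auto
    obtain N m1 where Nm: "b = (N, m1)" by (cases b)
    define g where "g \<rho> = (if card \<rho> = q then mcoeff (m1 \<rho>) (shift_exps N \<rho> a) else 0)" for \<rho>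
    have "g \<rho> = 0" if "\<rho> \<notin> cech_support adj a" for \<rho>
    proof (rule ccontr)
      assume "g \<rho> \<noteq> 0"
      then have "card \<rho> = q" "mcoeff (m1 \<rho>) (shift_exps N \<rho> a) \<noteq> 0" unfolding g_def by (auto split: if_splits)
      moreover from this have "m1 \<rho> \<in> mon_ideal (power_exps adj 1)" using b(1) unfolding Nm cech_cochains_def by auto
      ultimately have "shift_exps N \<rho> a \<in> power_exps adj 1" unfolding mon_ideal_def by blast
      then show False using that cech_support_if_exps by blast
    qed
    moreover have "f \<sigma> = koszul_diff (\<lambda>_. 1) g \<sigma>" if "card \<sigma> = p" for \<sigma>
    proof -
      have "f \<sigma> = koszul_diff (\<lambda>_. 1) (\<lambda>\<rho>. mcoeff (m1 \<rho>) (shift_exps N \<rho> a)) \<sigma>"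
        using b(2) that mcoeff_m_shift[of \<sigma> a] unfolding Nm cech_diff_eq cech_eq_iff mcoeff_koszul_diff_shift by simp
      also have "\<dots> = koszul_diff (\<lambda>_. 1) g \<sigma>"
        by (rule koszul_diff_cong) (use that Suc in \<open>simp add: g_def\<close>)
      finally show ?thesis .
    qed
    ultimately show ?thesis by blast
  qed
qed

text \<open>\<open>Greatest\<close> says something only if a maximum exists; one element and an
  upper bound provide it.\<close>

lemma Greatest_int_attained:
  fixes P :: "int \<Rightarrow> bool"
  assumes "P r0" "\<And>r. P r \<Longrightarrow> r \<le> n"
  shows "P (Greatest P) \<and> (\<forall>r. P r \<longrightarrow> r \<le> Greatest P)"
proof -
  obtain r where r: "P r" "\<And>r'. P r' \<Longrightarrow> nat (n - r) \<le> nat (n - r')"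
    using ex_has_least_nat[of P r0 "\<lambda>r. nat (n - r)"] assms(1) by blast
  have max: "r' \<le> r" if "P r'" for r'
    using r(2)[OF that] assms(2)[OF that] assms(2)[OF r(1)] by linarith
  then have "Greatest P = r" by (intro Greatest_equality r)
  then show ?thesis using r(1) max by simp
qed

text \<open>Multidegrees with a positive coordinate contribute nothing. For the others the family
  depends only on the negative part \<open>N\<close>, and the largest total degree with that
  negative part is \<open>- card N\<close>, attained by entries \<open>- 1\<close> and 0.\<close>

theorem ideal_reg_le_iff:
  fixes adj :: "'v::{finite,linorder} \<Rightarrow> 'v \<Rightarrow> bool"
  assumes irrefl: "\<And>x. \<not> adj x x" and edge: "adj x0 y0" and s: "0 \<le> s"
  shows "ideal_reg (mon_ideal (power_exps adj 1) :: ('v, 'k::comm_ring_1) mpoly set) \<le> s \<longleftrightarrow>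
    (\<forall>N p. int p > int (card N) + s \<longrightarrow>
      vanishes TYPE('k) {\<sigma>. N \<subseteq> \<sigma> \<and> (\<exists>x\<in>\<sigma>. \<exists>y\<in>\<sigma>. adj x y)} p)" (is "_ \<longleftrightarrow> ?R")
proof -
  let ?LC = "local_cohomology_nonzero (*) (edge_module_gr adj :: int \<Rightarrow> ('v, 'k) mpoly set)"
  let ?P = "\<lambda>r. \<exists>i j. r = int i + j \<and> ?LC i j"
  let ?n = "card (UNIV :: 'v set)"
  have reg: "ideal_reg (mon_ideal (power_exps adj 1) :: ('v, 'k) mpoly set) = Greatest ?P"
    unfolding ideal_reg_def regularity_def ..
  have pos: "\<exists>v. 0 < a v" if "0 < sum a UNIV" for a :: "'v \<Rightarrow> int"
    using that sum_nonpos[of UNIV a] by (metis not_le UNIV_I)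
  \<comment> \<open>In the multidegree with all entries \<open>- 1\<close> the only set is
    \<open>UNIV\<close>, so the top cohomology is nonzero and the set of values is not
    empty.\<close>
  have "?LC ?n (- int ?n)"
  proof (rule ccontr)
    let ?a = "\<lambda>_ :: 'v. - 1 :: int"
    assume "\<not> ?LC ?n (- int ?n)"
    then have van: "vanishes TYPE('k) (cech_support adj ?a) ?n"
      using vanishes_if_local_cohomology_zero[where adj = adj and a = ?a and 'k = 'k] irrefl by simp
    have U: "cech_support adj ?a = {UNIV}" using edge unfolding cech_support_def by auto
    define f :: "'v set \<Rightarrow> 'k" where "f \<sigma> = (if \<sigma> = UNIV then 1 else 0)" for \<sigma>
    have "card \<tau> \<noteq> Suc ?n" for \<tau> :: "'v set" using card_mono[of UNIV \<tau>] by auto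
    then obtain g where g: "\<And>\<sigma>. \<sigma> \<notin> {UNIV} \<Longrightarrow> g \<sigma> = 0" "\<And>\<sigma>. card \<sigma> = ?n \<Longrightarrow> f \<sigma> = koszul_diff (\<lambda>_. 1) g \<sigma>"
      using vanishesE[OF van[unfolded U], of f] by (auto simp: f_def)
    have "g (UNIV - {x}) = 0" for x by (rule g(1)) blast
    then have "koszul_diff (\<lambda>_. 1) g UNIV = 0" by (simp add: koszul_diff_def)
    then show False using g(2)[of UNIV] by (simp add: f_def)
  qed
  then have "?P (int ?n + - int ?n)" by blast
  \<comment> \<open>The values are bounded: \<open>i\<close> is at most the number of variables, and
    \<open>j > 0\<close> forces a positive coordinate.\<close>
  moreover have "r \<le> int ?n" if P: "?P r" for r
  proof -
    obtain i j where ij: "r = int i + j" "?LC i j" using P by blast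
    have "i \<le> ?n"
    proof (rule ccontr)
      assume "\<not> i \<le> ?n"
      then have "vanishes TYPE('k) (cech_support adj a) i" for a
        by (intro vanishes_if_none) (use card_mono[of "UNIV :: 'v set"] in fastforce)
      then show False using ij(2) local_cohomology_zero_if_vanishes[where adj = adj, OF irrefl] by blast
    qed
    moreover have "j \<le> 0"
    proof (rule ccontr)
      assume "\<not> j \<le> 0"
      then have "vanishes TYPE('k) (cech_support adj a) i" if "sum a UNIV = j" for a
        using pos[of a] that vanishes_cech_support_pos by force
      then show False using ij(2) local_cohomology_zero_if_vanishes[where adj = adj, OF irrefl] by blast
    qed
    ultimately show ?thesis using ij(1) by simp
  qed
  ultimately have G: "?P (Greatest ?P)" "\<And>r. ?P r \<Longrightarrow> r \<le> Greatest ?P"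
    using Greatest_int_attained[of ?P] by blast+
  show ?thesis unfolding reg
  proof
    assume le: "Greatest ?P \<le> s"
    show ?R
    proof (intro allI impI)
      fix N :: "'v set" and p assume p: "int p > int (card N) + s"
      define a where "a v = (if v \<in> N then - 1 else 0 :: int)" for v
      have sum: "sum a UNIV = - int (card N)" unfolding a_def by (simp add: sum.If_cases)
      have "\<not> ?LC p (sum a UNIV)"
      proof
        assume "?LC p (sum a UNIV)"
        then have "int p + sum a UNIV \<le> Greatest ?P" by (intro G(2)) blast
        then have "int p + sum a UNIV \<le> s" using le by linarith
        then show False using p sum by simp
      qed
      then have "vanishes TYPE('k) (cech_support adj a) p"
        by (intro vanishes_if_local_cohomology_zero[where adj = adj, OF irrefl]) (simp_all add: a_def)
      moreover have "{v. a v < 0} = N" unfolding a_def by auto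
      ultimately show "vanishes TYPE('k) {\<sigma>. N \<subseteq> \<sigma> \<and> (\<exists>x\<in>\<sigma>. \<exists>y\<in>\<sigma>. adj x y)} p"
        using cech_support_nonpos[of a adj] by (simp add: a_def)
    qed
  next
    assume R: ?R
    obtain i j where ij: "Greatest ?P = int i + j" "?LC i j" using G(1) by blast
    show "Greatest ?P \<le> s"
    proof (rule ccontr)
      assume "\<not> Greatest ?P \<le> s"
      then have gt: "int i + j > s" using ij(1) by simp
      have "vanishes TYPE('k) (cech_support adj a) i" if a: "sum a UNIV = j" for a
      proof (cases "\<exists>v. 0 < a v")
        case True
        then show ?thesis using vanishes_cech_support_pos by blast
      next
        case False
        then have np: "a v \<le> 0" for v by (meson not_less)
        have "sum a UNIV \<le> (\<Sum>v\<in>UNIV. if a v < 0 then - 1 else 0)"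
          by (rule sum_mono) (use np in auto)
        also have "\<dots> = - int (card {v. a v < 0})" by (simp add: sum.If_cases)
        finally have "int i > int (card {v. a v < 0}) + s" using gt a by simp
        then show ?thesis using R cech_support_nonpos[of a adj, OF np] by simp
      qed
      then show False using ij(2) local_cohomology_zero_if_vanishes[where adj = adj, OF irrefl] by blast
    qed
  qed
qed

section \<open>The Koszul complex of a monomial ideal by multidegrees\<close>

lemma box_succ_iff: "\<sigma> \<in> box X a (\<lambda>v. a v + 1) \<longleftrightarrow> shift_exps 1 \<sigma> a \<in> X"
proof -
  have "(\<lambda>v. if v \<in> \<sigma> then a v + 1 else a v) = shift_exps 1 \<sigma> a" by (auto simp: shift_exps_def)
  then show ?thesis unfolding box_def by simp
qed

lemma mcoeff_koszul_diff_var: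
  fixes m :: "'v::{finite,linorder} set \<Rightarrow> ('v, 'k::comm_ring_1) mpoly"
  shows "mcoeff (koszul_diff var m \<tau>) (shift_exps 1 \<tau> a) =
    koszul_diff (\<lambda>_. 1) (\<lambda>\<sigma>. mcoeff (m \<sigma>) (shift_exps 1 \<sigma> a)) \<tau>"
  using mcoeff_koszul_diff_shift[of 1 m \<tau> a] by simp

text \<open>The same splitting without denominators. Only \<open>a\<close> with entries at least
  \<open>- 1\<close> occur, since a shift by one has to reach a nonnegative exponent.\<close>

lemma koszul_exact_if_vanishes:
  fixes c :: "'v::{finite,linorder} set \<Rightarrow> ('v, 'k::comm_ring_1) mpoly"
  assumes nonneg: "\<And>u v. u \<in> X \<Longrightarrow> 0 \<le> u v"
    and van: "\<And>a. sum a UNIV = e \<Longrightarrow> (\<And>v. - 1 \<le> a v) \<Longrightarrow> vanishes TYPE('k) (box X a (\<lambda>v. a v + 1)) p"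
    and c: "\<And>\<sigma>. c \<sigma> \<in> mon_ideal X" "\<And>\<sigma>. homogeneous (e + int (card \<sigma>)) (c \<sigma>)"
    and cyc: "\<And>\<tau>. card \<tau> = Suc p \<Longrightarrow> koszul_diff var c \<tau> = 0"
  shows "\<exists>y. (\<forall>\<sigma>. y \<sigma> \<in> mon_ideal X \<and> homogeneous (e + int (card \<sigma>)) (y \<sigma>)) \<and>
    (\<forall>\<sigma>. card \<sigma> = p \<longrightarrow> c \<sigma> = koszul_diff var y \<sigma>)"
proof -
  define F where "F a \<sigma> = (if card \<sigma> = p then mcoeff (c \<sigma>) (shift_exps 1 \<sigma> a) else 0)" for a \<sigma>
  have Fne: "\<exists>\<sigma>. mcoeff (c \<sigma>) (shift_exps 1 \<sigma> a) \<noteq> 0" if "F a \<noteq> (\<lambda>_. 0)" for a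
    using that unfolding F_def fun_eq_iff by (auto split: if_splits)
  have Fsum: "sum a UNIV = e" if nz: "F a \<noteq> (\<lambda>_. 0)" for a
  proof -
    obtain \<sigma> where \<sigma>: "mcoeff (c \<sigma>) (shift_exps 1 \<sigma> a) \<noteq> 0" using Fne[OF nz] by blast
    then have "sum (shift_exps 1 \<sigma> a) UNIV = e + int (card \<sigma>)" using c(2) unfolding homogeneous_iff by blast
    then show ?thesis by (simp add: sum_shift_exps)
  qed
  have Flow: "- 1 \<le> a v" if nz: "F a \<noteq> (\<lambda>_. 0)" for a v
  proof -
    obtain \<sigma> where "mcoeff (c \<sigma>) (shift_exps 1 \<sigma> a) \<noteq> 0" using Fne[OF nz] by blast
    then show ?thesis using mcoeff_nonneg[of "c \<sigma>" "shift_exps 1 \<sigma> a" v] by (auto simp: shift_exps_def split: if_splits)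
  qed
  have Fsupp: "F a \<sigma> = 0" if "\<sigma> \<notin> box X a (\<lambda>v. a v + 1)" for a \<sigma>
    using c(1)[of \<sigma>] that unfolding F_def box_succ_iff mon_ideal_def by auto
  have "\<exists>g. (\<forall>\<sigma>. \<sigma> \<notin> box X a (\<lambda>v. a v + 1) \<longrightarrow> g \<sigma> = 0) \<and> (\<forall>\<sigma>. card \<sigma> = p \<longrightarrow> F a \<sigma> = koszul_diff (\<lambda>_. 1) g \<sigma>)
    \<and> (F a = (\<lambda>_. 0) \<longrightarrow> g = (\<lambda>_. 0))" for a
  proof (cases "F a = (\<lambda>_. 0)")
    case True
    then show ?thesis by (intro exI[of _ "\<lambda>_. 0"]) (simp add: koszul_diff_def)
  next
    case False
    have "koszul_diff (\<lambda>_. 1) (F a) \<tau> = 0" if "card \<tau> = Suc p" for \<tau>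
    proof -
      have "koszul_diff (\<lambda>_. 1) (F a) \<tau> = koszul_diff (\<lambda>_. 1) (\<lambda>\<sigma>. mcoeff (c \<sigma>) (shift_exps 1 \<sigma> a)) \<tau>"
        by (rule koszul_diff_cong) (use that in \<open>simp add: F_def\<close>)
      then show ?thesis using cyc[OF that] mcoeff_koszul_diff_var[of c \<tau> a] by simp
    qed
    then obtain g where "\<And>\<sigma>. \<sigma> \<notin> box X a (\<lambda>v. a v + 1) \<Longrightarrow> g \<sigma> = 0" "\<And>\<sigma>. card \<sigma> = p \<Longrightarrow> F a \<sigma> = koszul_diff (\<lambda>_. 1) g \<sigma>"
      using vanishesE[OF van[OF Fsum[OF False] Flow[OF False]], of "F a"] Fsupp by blast
    then show ?thesis using False by blast
  qed
  then obtain G where G: "\<And>a \<sigma>. \<sigma> \<notin> box X a (\<lambda>v. a v + 1) \<Longrightarrow> G a \<sigma> = 0"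
    "\<And>a \<sigma>. card \<sigma> = p \<Longrightarrow> F a \<sigma> = koszul_diff (\<lambda>_. 1) (G a) \<sigma>"
    "\<And>a. F a = (\<lambda>_. 0) \<Longrightarrow> G a = (\<lambda>_. 0)" by metis
  have "{a. F a \<noteq> (\<lambda>_. 0)} \<subseteq> (\<Union>\<sigma>. {a. mcoeff (c \<sigma>) (shift_exps 1 \<sigma> a) \<noteq> 0})"
    using Fne by blast
  then have finF: "finite {a. F a \<noteq> (\<lambda>_. 0)}"
    by (rule finite_subset) (simp add: finite_shifted_support)
  define C where "C \<rho> u = G (\<lambda>v. u v - (if v \<in> \<rho> then int 1 else 0)) \<rho>" for \<rho> u
  define y where "y \<rho> = poly_of (C \<rho>)" for \<rho>
  have Cne: "(\<exists>a. F a \<noteq> (\<lambda>_. 0) \<and> u = shift_exps 1 \<rho> a) \<and> u \<in> X" if nz: "C \<rho> u \<noteq> 0" for \<rho> u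
  proof -
    let ?a = "\<lambda>v. u v - (if v \<in> \<rho> then int 1 else 0)"
    have "F ?a \<noteq> (\<lambda>_. 0)" using nz G(3)[of ?a] unfolding C_def by force
    moreover have "\<rho> \<in> box X ?a (\<lambda>v. ?a v + 1)" using nz G(1) unfolding C_def by blast
    moreover have "shift_exps 1 \<rho> ?a = u" by (rule shift_exps_unshift)
    ultimately show ?thesis unfolding box_succ_iff by metis
  qed
  have finC: "finite {u. C \<rho> u \<noteq> 0}" for \<rho>
  proof (rule finite_subset)
    show "{u. C \<rho> u \<noteq> 0} \<subseteq> shift_exps 1 \<rho> ` {a. F a \<noteq> (\<lambda>_. 0)}" using Cne by blast
  qed (simp add: finF)
  have Cnn: "0 \<le> u v" if "C \<rho> u \<noteq> 0" for \<rho> u v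
    by (rule nonneg) (rule Cne[OF that, THEN conjunct2])
  have mcoeff_y: "mcoeff (y \<rho>) u = C \<rho> u" for \<rho> u
    unfolding y_def by (rule mcoeff_poly_of[OF finC]) (rule Cnn)
  have mcoeff_y_shift: "mcoeff (y \<rho>) (shift_exps 1 \<rho> a) = G a \<rho>" for \<rho> a
    unfolding mcoeff_y C_def by (rule arg_cong[where f = "\<lambda>b. G b \<rho>"]) (auto simp: shift_exps_def)
  have "y \<rho> \<in> mon_ideal X" for \<rho>
    unfolding mon_ideal_def mem_Collect_eq mcoeff_y using Cne by blast
  moreover have "homogeneous (e + int (card \<rho>)) (y \<rho>)" for \<rho>
    unfolding homogeneous_iff mcoeff_y
  proof (intro allI impI)
    fix u assume "C \<rho> u \<noteq> 0"
    then obtain a where "F a \<noteq> (\<lambda>_. 0)" "u = shift_exps 1 \<rho> a" using Cne by blast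
    then show "sum u UNIV = e + int (card \<rho>)" using Fsum by (simp add: sum_shift_exps)
  qed
  moreover have "c \<sigma> = koszul_diff var y \<sigma>" if "card \<sigma> = p" for \<sigma>
  proof (rule mcoeff_eqI)
    fix u
    let ?a = "\<lambda>v. u v - (if v \<in> \<sigma> then int 1 else 0)"
    have "mcoeff (c \<sigma>) (shift_exps 1 \<sigma> ?a) = mcoeff (koszul_diff var y \<sigma>) (shift_exps 1 \<sigma> ?a)"
      unfolding mcoeff_koszul_diff_var mcoeff_y_shift using G(2)[OF that, of ?a] that by (simp add: F_def)
    then show "mcoeff (c \<sigma>) u = mcoeff (koszul_diff var y \<sigma>) u" unfolding shift_exps_unshift .
  qed
  ultimately show ?thesis by blast
qed

lemma vanishes_if_koszul_exact:
  fixes a :: "'v::{finite,linorder} \<Rightarrow> int"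
  assumes nonneg: "\<And>u v. u \<in> X \<Longrightarrow> 0 \<le> u v"
    and exact: "\<And>c. (\<And>\<sigma>. c \<sigma> \<in> (mon_ideal X :: ('v, 'k::comm_ring_1) mpoly set)) \<Longrightarrow>
      (\<And>\<sigma>. homogeneous (sum a UNIV + int (card \<sigma>)) (c \<sigma>)) \<Longrightarrow>
      (\<And>\<tau>. card \<tau> = Suc p \<Longrightarrow> koszul_diff var c \<tau> = 0) \<Longrightarrow>
      \<exists>y. (\<forall>\<sigma>. y \<sigma> \<in> mon_ideal X) \<and> (\<forall>\<sigma>. card \<sigma> = p \<longrightarrow> c \<sigma> = koszul_diff var y \<sigma>)"
  shows "vanishes TYPE('k) (box X a (\<lambda>v. a v + 1)) p"
proof (rule vanishesI)
  fix f :: "'v set \<Rightarrow> 'k"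
  assume supp: "\<And>\<sigma>. \<sigma> \<notin> box X a (\<lambda>v. a v + 1) \<Longrightarrow> f \<sigma> = 0"
    and cyc: "\<And>\<tau>. card \<tau> = Suc p \<Longrightarrow> koszul_diff (\<lambda>_. 1) f \<tau> = 0"
  define c where "c \<sigma> = Poly_Mapping.single (expo (shift_exps 1 \<sigma> a)) (f \<sigma>)" for \<sigma>
  have exps: "shift_exps 1 \<sigma> a \<in> X" if "f \<sigma> \<noteq> 0" for \<sigma>
    using supp that unfolding box_succ_iff by blast
  have mcoeff_c: "mcoeff (c \<sigma>) u = (if u = shift_exps 1 \<sigma> a then f \<sigma> else 0)" for \<sigma> u
  proof (cases "f \<sigma> = 0")
    case False
    have "(\<lambda>v. int (Poly_Mapping.lookup (expo (shift_exps 1 \<sigma> a)) v)) = shift_exps 1 \<sigma> a"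
      using nonneg[OF exps[OF False]] by auto
    then show ?thesis unfolding c_def mcoeff_single by simp
  qed (simp add: c_def)
  have mcoeff_c_shift: "mcoeff (c \<sigma>) (shift_exps 1 \<sigma> b) = (if b = a then f \<sigma> else 0)" for \<sigma> b
    unfolding mcoeff_c shift_exps_inj ..
  have "koszul_diff var c \<tau> = 0" if "card \<tau> = Suc p" for \<tau>
  proof (rule mcoeff_eqI)
    fix u
    let ?b = "\<lambda>v. u v - (if v \<in> \<tau> then int 1 else 0)"
    have "koszul_diff (\<lambda>_. 1) (\<lambda>\<sigma>. if ?b = a then f \<sigma> else 0) \<tau> = 0"
      using cyc[OF that] by (cases "?b = a") (simp_all add: koszul_diff_def)
    then have "mcoeff (koszul_diff var c \<tau>) (shift_exps 1 \<tau> ?b) = 0"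
      unfolding mcoeff_koszul_diff_var mcoeff_c_shift .
    then show "mcoeff (koszul_diff var c \<tau>) u = mcoeff 0 u" unfolding shift_exps_unshift by simp
  qed
  moreover have "c \<sigma> \<in> mon_ideal X" for \<sigma>
    unfolding mon_ideal_def mem_Collect_eq mcoeff_c using exps by auto
  moreover have "homogeneous (sum a UNIV + int (card \<sigma>)) (c \<sigma>)" for \<sigma>
    unfolding homogeneous_iff mcoeff_c by (auto simp: sum_shift_exps)
  ultimately obtain y where y: "\<And>\<sigma>. y \<sigma> \<in> mon_ideal X" "\<And>\<sigma>. card \<sigma> = p \<Longrightarrow> c \<sigma> = koszul_diff var y \<sigma>"
    using exact[of c] by blast
  define g where "g \<rho> = mcoeff (y \<rho>) (shift_exps 1 \<rho> a)" for \<rho>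
  have "f \<sigma> = koszul_diff (\<lambda>_. 1) g \<sigma>" if "card \<sigma> = p" for \<sigma>
    using y(2)[OF that] mcoeff_c_shift[of \<sigma> a] mcoeff_koszul_diff_var[of y \<sigma> a] unfolding g_def by simp
  moreover have "g \<rho> = 0" if "\<rho> \<notin> box X a (\<lambda>v. a v + 1)" for \<rho>
    using y(1)[of \<rho>] that unfolding box_succ_iff mon_ideal_def g_def by auto
  ultimately show "\<exists>g. (\<forall>\<sigma>. \<sigma> \<notin> box X a (\<lambda>v. a v + 1) \<longrightarrow> g \<sigma> = 0) \<and>
      (\<forall>\<sigma>. card \<sigma> = p \<longrightarrow> f \<sigma> = koszul_diff (\<lambda>_. 1) g \<sigma>)" by blast
qed

text \<open>Exactness of the Koszul complex of the polynomial ring away from the constants.\<close>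

lemma vanishes_nonneg_box:
  fixes a :: "'v::{finite,linorder} \<Rightarrow> int"
  assumes "\<And>v. - 1 \<le> a v" "int p + sum a UNIV \<noteq> 0"
  shows "vanishes TYPE('k::comm_ring_1) (box {u. \<forall>v. 0 \<le> u v} a (\<lambda>v. a v + 1)) p"
proof (cases "\<exists>v. 0 \<le> a v")
  case True
  then obtain v where v: "0 \<le> a v" by blast
  show ?thesis
  proof (rule vanishes_toggle[of v])
    fix \<sigma>
    have "0 \<le> (if w \<in> insert v \<sigma> then a w + 1 else a w) \<longleftrightarrow> 0 \<le> (if w \<in> \<sigma> then a w + 1 else a w)" for w
      using v by (cases "w = v") auto
    then show "insert v \<sigma> \<in> box {u. \<forall>v. 0 \<le> u v} a (\<lambda>v. a v + 1) \<longleftrightarrow> \<sigma> \<in> box {u. \<forall>v. 0 \<le> u v} a (\<lambda>v. a v + 1)"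
      unfolding box_def mem_Collect_eq by presburger
  qed
next
  case False
  have a: "a = (\<lambda>_. - 1)"
  proof (intro ext)
    fix v have "\<not> 0 \<le> a v" using False by blast
    then show "a v = - 1" using assms(1)[of v] by simp
  qed
  have "\<sigma> = UNIV" if "\<sigma> \<in> box {u. \<forall>v. 0 \<le> u v} a (\<lambda>v. a v + 1)" for \<sigma>
    using that unfolding box_def a by (auto split: if_splits)
  then show ?thesis
    by (intro vanishes_if_none) (use assms(2) a in auto)
qed

lemma homogeneous_0 [simp]: "homogeneous d 0"
  unfolding homogeneous_iff by simp

lemma homogeneous_add: "homogeneous d f \<Longrightarrow> homogeneous d g \<Longrightarrow> homogeneous d (f + g)"
  unfolding homogeneous_iff mcoeff_add by (metis add_0)

lemma homogeneous_sum: "(\<And>i. i \<in> I \<Longrightarrow> homogeneous d (f i)) \<Longrightarrow> homogeneous d (\<Sum>i\<in>I. f i)"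
  by (induction I rule: infinite_finite_induct) (simp_all add: homogeneous_add)

lemma homogeneous_mult:
  assumes "homogeneous d f" "homogeneous e g"
  shows "homogeneous (d + e) (f * g)"
  unfolding homogeneous_iff
proof (intro allI impI)
  fix u assume "mcoeff (f * g) u \<noteq> 0"
  then obtain w w' where "mcoeff f w \<noteq> 0" "mcoeff g w' \<noteq> 0" "u = (\<lambda>v. w v + w' v)" by (rule mcoeff_mult_nonzeroE)
  then show "sum u UNIV = d + e" using assms unfolding homogeneous_iff by (simp add: sum.distrib)
qed

lemma homogeneous_var: "homogeneous 1 (var i)"
  unfolding homogeneous_def var_def by (simp add: lookup_single when_def)

lemma homogeneous_const: "homogeneous 0 (Poly_Mapping.single 0 k)"
  unfolding homogeneous_def by simp

lemma homogeneous_negative: "homogeneous d f \<Longrightarrow> d < 0 \<Longrightarrow> f = 0"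
proof (rule mcoeff_eqI)
  fix u assume h: "homogeneous d f" "d < 0"
  have "mcoeff f u = 0"
  proof (rule ccontr)
    assume nz: "mcoeff f u \<noteq> 0"
    then have "sum u UNIV = d" using h(1) unfolding homogeneous_iff by blast
    moreover have "0 \<le> sum u UNIV" by (rule sum_nonneg) (rule mcoeff_nonneg[OF nz])
    ultimately show False using h(2) by simp
  qed
  then show "mcoeff f u = mcoeff 0 u" by simp
qed

lemma homogeneous_constE:
  assumes "homogeneous 0 f"
  obtains k where "f = Poly_Mapping.single 0 k"
proof
  show "f = Poly_Mapping.single 0 (mcoeff f (\<lambda>_. 0))"
  proof (rule mcoeff_eqI)
    fix u
    show "mcoeff f u = mcoeff (Poly_Mapping.single 0 (mcoeff f (\<lambda>_. 0))) u"
    proof (cases "u = (\<lambda>_. 0)")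
      case False
      have "mcoeff f u = 0"
      proof (rule ccontr)
        assume nz: "mcoeff f u \<noteq> 0"
        then have "sum u UNIV = 0" using assms unfolding homogeneous_iff by blast
        then have "u v = 0" for v using mcoeff_nonneg[OF nz] by (simp add: sum_nonneg_eq_0_iff)
        then show False using False by auto
      qed
      then show ?thesis using False by (simp add: mcoeff_single)
    qed (simp add: mcoeff_single)
  qed
qed

section \<open>Graded submodules of free modules\<close>

type_synonym ('v, 'k) pvec = "nat \<Rightarrow> ('v, 'k) mpoly"

text \<open>Vectors are functions on all of \<open>nat\<close>, zero from \<open>r\<close> on, so
  that modules of different ranks share one type.\<close>

definition free_piece :: "nat \<Rightarrow> int \<Rightarrow> ('v::finite, 'k::comm_ring_1) pvec set" where
  "free_piece r e = {x. \<forall>l. homogeneous e (x l) \<and> (r \<le> l \<longrightarrow> x l = 0)}"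

text \<open>As multipliers only variables and constants are demanded, which is what the Koszul
  differential needs; other homogeneous multipliers follow in
  \<open>graded_submodule_mult\<close>.\<close>

definition graded_submodule :: "nat \<Rightarrow> (int \<Rightarrow> ('v::finite, 'k::comm_ring_1) pvec set) \<Rightarrow> bool" where
  "graded_submodule r G \<longleftrightarrow> (\<forall>e. G e \<subseteq> free_piece r e \<and> (\<lambda>_. 0) \<in> G e \<and>
     (\<forall>x\<in>G e. \<forall>y\<in>G e. (\<lambda>l. x l + y l) \<in> G e) \<and>
     (\<forall>x\<in>G e. \<forall>i. (\<lambda>l. var i * x l) \<in> G (e + 1)) \<and>
     (\<forall>x\<in>G e. \<forall>k. (\<lambda>l. Poly_Mapping.single 0 k * x l) \<in> G e))"

lemma graded_submoduleD:
  assumes "graded_submodule r G"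
  shows "x \<in> G e \<Longrightarrow> x \<in> free_piece r e" "(\<lambda>_. 0) \<in> G e"
    "x \<in> G e \<Longrightarrow> y \<in> G e \<Longrightarrow> (\<lambda>l. x l + y l) \<in> G e"
    "x \<in> G e \<Longrightarrow> (\<lambda>l. var i * x l) \<in> G (e + 1)"
    "x \<in> G e \<Longrightarrow> (\<lambda>l. Poly_Mapping.single 0 k * x l) \<in> G e"
  using assms unfolding graded_submodule_def by blast+

lemma neg_one_power_single: "(- 1 :: ('v, 'k::comm_ring_1) mpoly) ^ n = Poly_Mapping.single 0 ((- 1) ^ n)"
proof (induction n)
  case (Suc n)
  have "(- 1 :: ('v, 'k) mpoly) = Poly_Mapping.single 0 (- 1)" by (simp add: single_uminus)
  then show ?case using Suc by (simp add: mult_single del: single_uminus)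
qed simp

lemma graded_submodule_diff:
  assumes "graded_submodule r G" "x \<in> G e" "y \<in> G e"
  shows "(\<lambda>l. x l - y l) \<in> G e"
proof -
  have "(\<lambda>l. Poly_Mapping.single 0 (- 1) * y l) \<in> G e" by (rule graded_submoduleD(5)[OF assms(1,3)])
  from graded_submoduleD(3)[OF assms(1,2) this] show ?thesis
    by (simp add: single_uminus)
qed

lemma graded_submodule_sum:
  assumes "graded_submodule r G" "\<And>i. i \<in> I \<Longrightarrow> f i \<in> G e"
  shows "(\<lambda>l. \<Sum>i\<in>I. f i l) \<in> G e"
  using assms(2)
  by (induction I rule: infinite_finite_induct) (simp_all add: graded_submoduleD(2,3)[OF assms(1)])

definition koszul_vec :: "('v::linorder set \<Rightarrow> ('v, 'k::comm_ring_1) pvec) \<Rightarrow> 'v set \<Rightarrow> ('v, 'k) pvec" where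
  "koszul_vec c \<tau> = (\<lambda>l. koszul_diff var (\<lambda>\<sigma>. c \<sigma> l) \<tau>)"

lemma koszul_vec_koszul_vec: "koszul_vec (koszul_vec c) (\<tau> :: 'v::{finite,linorder} set) = (\<lambda>_. 0)"
  unfolding koszul_vec_def by (simp add: koszul_diff_koszul_diff)

lemma koszul_vec_diff: "koszul_vec (\<lambda>\<sigma> l. x \<sigma> l - y \<sigma> l) \<tau> = (\<lambda>l. koszul_vec x \<tau> l - koszul_vec y \<tau> l)"
  unfolding koszul_vec_def koszul_diff_diff ..

lemma koszul_vec_cong: "(\<And>\<sigma>. Suc (card \<sigma>) = card \<tau> \<Longrightarrow> x \<sigma> = y \<sigma>) \<Longrightarrow> koszul_vec x \<tau> = koszul_vec y \<tau>"
  unfolding koszul_vec_def by (intro ext koszul_diff_cong) simp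

lemma koszul_vec_zero [simp]: "koszul_vec (\<lambda>_ _. 0) \<tau> = (\<lambda>_. 0)"
  unfolding koszul_vec_def koszul_diff_def by simp

lemma koszul_vec_in:
  fixes \<tau> :: "'v::{finite,linorder} set"
  assumes G: "graded_submodule r G" and c: "\<And>\<sigma>. c \<sigma> \<in> G (e + int (card \<sigma>))"
  shows "koszul_vec c \<tau> \<in> G (e + int (card \<tau>))"
proof -
  have "(\<lambda>l. (- 1) ^ card {l \<in> \<tau>. l < i} * var i * c (\<tau> - {i}) l) \<in> G (e + int (card \<tau>))" if "i \<in> \<tau>" for i
  proof -
    have "Suc (card (\<tau> - {i})) = card \<tau>" using that by (intro card_Suc_Diff1) simp
    then have eq: "e + int (card (\<tau> - {i})) + 1 = e + int (card \<tau>)" by linarith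
    have "(\<lambda>l. var i * c (\<tau> - {i}) l) \<in> G (e + int (card \<tau>))"
      using graded_submoduleD(4)[OF G c[of "\<tau> - {i}"], of i] unfolding eq .
    then show ?thesis
      using graded_submoduleD(5)[OF G, of "\<lambda>l. var i * c (\<tau> - {i}) l"]
      by (simp add: neg_one_power_single mult.assoc)
  qed
  then show ?thesis unfolding koszul_vec_def koszul_diff_def by (rule graded_submodule_sum[OF G])
qed

text \<open>
  With \<open>n\<close> indeterminates, this is the vanishing of \<open>Tor\<close> of the module \<open>G\<close> and the residue field in
  homological degree \<open>n - p\<close> and internal degree \<open>e + n\<close>.
\<close>

definition exact_at :: "(int \<Rightarrow> ('v::{finite,linorder}, 'k::comm_ring_1) pvec set) \<Rightarrow> nat \<Rightarrow> int \<Rightarrow> bool" where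
  "exact_at G p e \<longleftrightarrow> (\<forall>c. (\<forall>\<sigma>. c \<sigma> \<in> G (e + int (card \<sigma>))) \<longrightarrow>
     (\<forall>\<tau>. card \<tau> = Suc p \<longrightarrow> koszul_vec c \<tau> = (\<lambda>_. 0)) \<longrightarrow>
     (\<exists>y. (\<forall>\<sigma>. y \<sigma> \<in> G (e + int (card \<sigma>))) \<and> (\<forall>\<sigma>. card \<sigma> = p \<longrightarrow> c \<sigma> = koszul_vec y \<sigma>)))"

lemma exact_atI:
  assumes "\<And>c. (\<And>\<sigma>. c \<sigma> \<in> G (e + int (card \<sigma>))) \<Longrightarrow> (\<And>\<tau>. card \<tau> = Suc p \<Longrightarrow> koszul_vec c \<tau> = (\<lambda>_. 0)) \<Longrightarrow>
     \<exists>y. (\<forall>\<sigma>. y \<sigma> \<in> G (e + int (card \<sigma>))) \<and> (\<forall>\<sigma>. card \<sigma> = p \<longrightarrow> c \<sigma> = koszul_vec y \<sigma>)"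
  shows "exact_at G p e"
  unfolding exact_at_def using assms by blast

lemma exact_atE:
  assumes "exact_at G p e" "\<And>\<sigma>. c \<sigma> \<in> G (e + int (card \<sigma>))" "\<And>\<tau>. card \<tau> = Suc p \<Longrightarrow> koszul_vec c \<tau> = (\<lambda>_. 0)"
  obtains y where "\<And>\<sigma>. y \<sigma> \<in> G (e + int (card \<sigma>))" "\<And>\<sigma>. card \<sigma> = p \<Longrightarrow> c \<sigma> = koszul_vec y \<sigma>"
proof -
  have "\<exists>y. (\<forall>\<sigma>. y \<sigma> \<in> G (e + int (card \<sigma>))) \<and> (\<forall>\<sigma>. card \<sigma> = p \<longrightarrow> c \<sigma> = koszul_vec y \<sigma>)"
    using assms(1)[unfolded exact_at_def, rule_format, of c] assms(2,3) by simp
  then show thesis using that by blast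
qed

lemma graded_submodule_free: "graded_submodule r (free_piece r)"
proof -
  have "homogeneous (e + 1) (var i * f)" if "homogeneous e f" for e i and f :: "('a, 'b) mpoly"
    using homogeneous_mult[OF homogeneous_var that] by (simp add: add.commute)
  moreover have "homogeneous e (Poly_Mapping.single 0 k * f)" if "homogeneous e f" for e k and f :: "('a, 'b) mpoly"
    using homogeneous_mult[OF homogeneous_const that] by simp
  ultimately show ?thesis
    unfolding graded_submodule_def free_piece_def by (simp add: homogeneous_add)
qed

text \<open>Componentwise this is the Koszul complex of the polynomial ring. With \<open>n\<close>
  variables its only cohomology sits at \<open>p = n\<close>, \<open>e = - n\<close>, on the
  excluded line.\<close>

lemma exact_at_free:
  assumes "int p + e \<noteq> 0"
  shows "exact_at (free_piece r :: int \<Rightarrow> ('v::{finite,linorder}, 'k::comm_ring_1) pvec set) p e"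
proof (rule exact_atI)
  fix c :: "'v set \<Rightarrow> ('v, 'k) pvec"
  assume c: "\<And>\<sigma>. c \<sigma> \<in> free_piece r (e + int (card \<sigma>))"
    and cyc: "\<And>\<tau>. card \<tau> = Suc p \<Longrightarrow> koszul_vec c \<tau> = (\<lambda>_. 0)"
  have "\<exists>y. (\<forall>\<sigma>. homogeneous (e + int (card \<sigma>)) (y \<sigma>)) \<and> (\<forall>\<sigma>. card \<sigma> = p \<longrightarrow> c \<sigma> l = koszul_diff var y \<sigma>)" for l
  proof -
    have "\<exists>y. (\<forall>\<sigma>. y \<sigma> \<in> mon_ideal {u. \<forall>v. 0 \<le> u v} \<and> homogeneous (e + int (card \<sigma>)) (y \<sigma>)) \<and>
      (\<forall>\<sigma>. card \<sigma> = p \<longrightarrow> c \<sigma> l = koszul_diff var y \<sigma>)"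
    proof (rule koszul_exact_if_vanishes)
      fix a :: "'v \<Rightarrow> int" assume "sum a UNIV = e" "\<And>v. - 1 \<le> a v"
      then show "vanishes TYPE('k) (box {u. \<forall>v. 0 \<le> u v} a (\<lambda>v. a v + 1)) p"
        using assms by (intro vanishes_nonneg_box) auto
    next
      fix \<sigma>
      show "c \<sigma> l \<in> mon_ideal {u. \<forall>v. 0 \<le> u v}" unfolding mon_ideal_def using mcoeff_nonneg by auto
      show "homogeneous (e + int (card \<sigma>)) (c \<sigma> l)" using c[of \<sigma>] unfolding free_piece_def by blast
    next
      fix \<tau> :: "'v set" assume "card \<tau> = Suc p"
      then show "koszul_diff var (\<lambda>\<sigma>. c \<sigma> l) \<tau> = 0" using fun_cong[OF cyc, of \<tau> l] by (simp add: koszul_vec_def)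
    qed auto
    then show ?thesis by blast
  qed
  then obtain y where y: "\<And>l \<sigma>. homogeneous (e + int (card \<sigma>)) (y l \<sigma>)"
    "\<And>l \<sigma>. card \<sigma> = p \<Longrightarrow> c \<sigma> l = koszul_diff var (y l) \<sigma>" by metis
  define z where "z \<sigma> l = (if r \<le> l then 0 else y l \<sigma>)" for \<sigma> l
  have "z \<sigma> \<in> free_piece r (e + int (card \<sigma>))" for \<sigma>
    unfolding free_piece_def z_def using y(1) by simp
  moreover have "c \<sigma> = koszul_vec z \<sigma>" if "card \<sigma> = p" for \<sigma>
  proof
    fix l
    show "c \<sigma> l = koszul_vec z \<sigma> l"
    proof (cases "r \<le> l")
      case True
      then have "c \<sigma> l = 0" using c[of \<sigma>] unfolding free_piece_def by blast
      then show ?thesis using True by (simp add: koszul_vec_def z_def koszul_diff_def)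
    next
      case False
      then have "(\<lambda>\<sigma>. z \<sigma> l) = y l" by (auto simp: z_def)
      then show ?thesis using y(2)[OF that] by (simp add: koszul_vec_def)
    qed
  qed
  ultimately show "\<exists>y. (\<forall>\<sigma>. y \<sigma> \<in> free_piece r (e + int (card \<sigma>))) \<and> (\<forall>\<sigma>. card \<sigma> = p \<longrightarrow> c \<sigma> = koszul_vec y \<sigma>)"
    by blast
qed

text \<open>Matrices are functions of the row and column index; only the entries in the first \<open>r'\<close> rows and \<open>r\<close> columns matter.\<close>

definition mat_apply :: "(nat \<Rightarrow> nat \<Rightarrow> ('v, 'k::comm_ring_1) mpoly) \<Rightarrow> nat \<Rightarrow> nat \<Rightarrow> ('v, 'k) pvec \<Rightarrow> ('v, 'k) pvec" where
  "mat_apply A r' r x = (\<lambda>k. if k < r' then \<Sum>l<r. A k l * x l else 0)"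

definition homogeneous_matrix :: "(nat \<Rightarrow> nat \<Rightarrow> ('v::finite, 'k::comm_ring_1) mpoly) \<Rightarrow> nat \<Rightarrow> nat \<Rightarrow> int \<Rightarrow> bool" where
  "homogeneous_matrix A r' r d \<longleftrightarrow> (\<forall>k<r'. \<forall>l<r. homogeneous d (A k l))"

definition ker_piece :: "(nat \<Rightarrow> nat \<Rightarrow> ('v::finite, 'k::comm_ring_1) mpoly) \<Rightarrow> nat \<Rightarrow> nat \<Rightarrow> int \<Rightarrow> ('v, 'k) pvec set" where
  "ker_piece A r' r e = {x \<in> free_piece r e. mat_apply A r' r x = (\<lambda>_. 0)}"

definition im_piece :: "(nat \<Rightarrow> nat \<Rightarrow> ('v::finite, 'k::comm_ring_1) mpoly) \<Rightarrow> nat \<Rightarrow> nat \<Rightarrow> int \<Rightarrow> int \<Rightarrow> ('v, 'k) pvec set" where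
  "im_piece A r' r d e = mat_apply A r' r ` free_piece r (e - d)"

lemma mat_apply_in_free:
  assumes "homogeneous_matrix A r' r d" "x \<in> free_piece r e"
  shows "mat_apply A r' r x \<in> free_piece r' (d + e)"
  using assms unfolding free_piece_def mat_apply_def homogeneous_matrix_def
  by (auto intro!: homogeneous_sum homogeneous_mult)

lemma mat_apply_add: "mat_apply A r' r (\<lambda>l. x l + y l) = (\<lambda>k. mat_apply A r' r x k + mat_apply A r' r y k)"
  unfolding mat_apply_def by (auto simp: distrib_left sum.distrib)

lemma mat_apply_diff: "mat_apply A r' r (\<lambda>l. x l - y l) = (\<lambda>k. mat_apply A r' r x k - mat_apply A r' r y k)"
  unfolding mat_apply_def by (auto simp: right_diff_distrib sum_subtractf)

lemma mat_apply_mult: "mat_apply A r' r (\<lambda>l. f * x l) = (\<lambda>k. f * mat_apply A r' r x k)"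
  unfolding mat_apply_def by (auto simp: sum_distrib_left mult.left_commute)

lemma mat_apply_zero [simp]: "mat_apply A r' r (\<lambda>_. 0) = (\<lambda>_. 0)"
  unfolding mat_apply_def by auto

lemma mat_apply_koszul_vec: "mat_apply A r' r (koszul_vec c \<tau>) = koszul_vec (\<lambda>\<sigma>. mat_apply A r' r (c \<sigma>)) \<tau>"
proof
  fix k
  show "mat_apply A r' r (koszul_vec c \<tau>) k = koszul_vec (\<lambda>\<sigma>. mat_apply A r' r (c \<sigma>)) \<tau> k"
  proof (cases "k < r'")
    case True
    have "mat_apply A r' r (koszul_vec c \<tau>) k = (\<Sum>l<r. \<Sum>i\<in>\<tau>. A k l * ((- 1) ^ card {l \<in> \<tau>. l < i} * var i * c (\<tau> - {i}) l))"
      using True by (simp add: mat_apply_def koszul_vec_def koszul_diff_def sum_distrib_left)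
    also have "\<dots> = (\<Sum>i\<in>\<tau>. \<Sum>l<r. A k l * ((- 1) ^ card {l \<in> \<tau>. l < i} * var i * c (\<tau> - {i}) l))"
      by (rule sum.swap)
    also have "\<dots> = koszul_vec (\<lambda>\<sigma>. mat_apply A r' r (c \<sigma>)) \<tau> k"
      using True by (simp add: mat_apply_def koszul_vec_def koszul_diff_def sum_distrib_left mult.left_commute mult.assoc)
    finally show ?thesis .
  qed (simp add: mat_apply_def koszul_vec_def koszul_diff_def)
qed

lemma graded_submodule_ker:
  assumes "homogeneous_matrix A r' r d"
  shows "graded_submodule r (ker_piece A r' r)"
  unfolding graded_submodule_def ker_piece_def
  using graded_submoduleD[OF graded_submodule_free[of r]]
  by (auto simp: mat_apply_add mat_apply_mult)

lemma graded_submodule_im: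
  assumes "homogeneous_matrix A r' r d"
  shows "graded_submodule r' (im_piece A r' r d)"
  unfolding graded_submodule_def im_piece_def
proof (intro allI conjI ballI)
  fix e
  show "mat_apply A r' r ` free_piece r (e - d) \<subseteq> free_piece r' e" using mat_apply_in_free[OF assms, of _ "e - d"] by auto
  show "(\<lambda>_. 0) \<in> mat_apply A r' r ` free_piece r (e - d)"
    by (rule image_eqI[of _ _ "\<lambda>_. 0"]) (simp_all add: free_piece_def)
next
  fix e x y assume "x \<in> mat_apply A r' r ` free_piece r (e - d)" "y \<in> mat_apply A r' r ` free_piece r (e - d)"
  then obtain x' y' where *: "x' \<in> free_piece r (e - d)" "x = mat_apply A r' r x'" "y' \<in> free_piece r (e - d)" "y = mat_apply A r' r y'" by blast
  show "(\<lambda>l. x l + y l) \<in> mat_apply A r' r ` free_piece r (e - d)"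
    unfolding *(2,4) mat_apply_add[symmetric]
    by (rule imageI) (rule graded_submoduleD(3)[OF graded_submodule_free *(1,3)])
next
  fix e x and i :: 'a assume "x \<in> mat_apply A r' r ` free_piece r (e - d)"
  then obtain x' where *: "x' \<in> free_piece r (e - d)" "x = mat_apply A r' r x'" by blast
  have eq: "e + 1 - d = e - d + 1" by simp
  show "(\<lambda>l. var i * x l) \<in> mat_apply A r' r ` free_piece r (e + 1 - d)"
    unfolding *(2) mat_apply_mult[symmetric] eq
    by (rule imageI) (rule graded_submoduleD(4)[OF graded_submodule_free *(1)])
next
  fix e x k assume "x \<in> mat_apply A r' r ` free_piece r (e - d)"
  then obtain x' where *: "x' \<in> free_piece r (e - d)" "x = mat_apply A r' r x'" by blast
  show "(\<lambda>l. Poly_Mapping.single 0 k * x l) \<in> mat_apply A r' r ` free_piece r (e - d)"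
    unfolding *(2) mat_apply_mult[symmetric]
    by (rule imageI) (rule graded_submoduleD(5)[OF graded_submodule_free *(1)])
qed

text \<open>The connecting map of the sequence \<open>0 \<rightarrow> ker A \<rightarrow> S(- d)\<^sup>r \<rightarrow> im A \<rightarrow> 0\<close> shifts Koszul cohomology by one.\<close>

lemma exact_im_if_exact_ker:
  fixes A :: "nat \<Rightarrow> nat \<Rightarrow> ('v::{finite,linorder}, 'k::comm_ring_1) mpoly"
  assumes A: "homogeneous_matrix A r' r d"
    and ker: "exact_at (ker_piece A r' r) (Suc p) (e - d)" and ne: "int p + e \<noteq> d"
  shows "exact_at (im_piece A r' r d) p e"
proof (rule exact_atI)
  fix c :: "'v set \<Rightarrow> ('v, 'k) pvec"
  assume c: "\<And>\<sigma>. c \<sigma> \<in> im_piece A r' r d (e + int (card \<sigma>))"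
    and cyc: "\<And>\<tau>. card \<tau> = Suc p \<Longrightarrow> koszul_vec c \<tau> = (\<lambda>_. 0)"
  have shift: "e + int n - d = e - d + int n" for n by simp
  have "\<exists>x. x \<in> free_piece r (e - d + int (card \<sigma>)) \<and> c \<sigma> = mat_apply A r' r x" for \<sigma>
    using c[of \<sigma>] unfolding im_piece_def shift by blast
  then obtain x where x: "\<And>\<sigma>. x \<sigma> \<in> free_piece r (e - d + int (card \<sigma>))" "\<And>\<sigma>. c \<sigma> = mat_apply A r' r (x \<sigma>)" by metis
  have cx: "c = (\<lambda>\<sigma>. mat_apply A r' r (x \<sigma>))" using x(2) by auto
  \<comment> \<open>Cut to cardinality \<open>Suc p\<close>: only there does the cocycle condition
    put the coboundary of the lift into the kernel.\<close>
  define z0 where "z0 \<tau> = (if card \<tau> = Suc p then koszul_vec x \<tau> else (\<lambda>_. 0))" for \<tau>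
  have z0: "z0 \<tau> \<in> ker_piece A r' r (e - d + int (card \<tau>))" for \<tau>
  proof (cases "card \<tau> = Suc p")
    case True
    have "mat_apply A r' r (koszul_vec x \<tau>) = (\<lambda>_. 0)" unfolding mat_apply_koszul_vec using cyc[OF True] cx by simp
    moreover have "koszul_vec x \<tau> \<in> free_piece r (e - d + int (card \<tau>))"
      by (rule koszul_vec_in[OF graded_submodule_free]) (rule x(1))
    ultimately show ?thesis using True unfolding z0_def ker_piece_def by simp
  qed (simp add: z0_def graded_submoduleD(2)[OF graded_submodule_ker[OF A]])
  have "koszul_vec z0 \<tau> = (\<lambda>_. 0)" if "card \<tau> = Suc (Suc p)" for \<tau>
  proof -
    have "koszul_vec z0 \<tau> = koszul_vec (koszul_vec x) \<tau>" by (rule koszul_vec_cong) (use that in \<open>simp add: z0_def\<close>)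
    then show ?thesis by (simp add: koszul_vec_koszul_vec)
  qed
  then obtain z where z: "\<And>\<sigma>. z \<sigma> \<in> ker_piece A r' r (e - d + int (card \<sigma>))" "\<And>\<sigma>. card \<sigma> = Suc p \<Longrightarrow> z0 \<sigma> = koszul_vec z \<sigma>"
    using exact_atE[OF ker, of z0] z0 by blast
  have zf: "z \<sigma> \<in> free_piece r (e - d + int (card \<sigma>))" for \<sigma> using z(1) unfolding ker_piece_def by blast
  define w where "w \<sigma> = (\<lambda>l. x \<sigma> l - z \<sigma> l)" for \<sigma>
  have w: "w \<sigma> \<in> free_piece r (e - d + int (card \<sigma>))" for \<sigma>
    unfolding w_def by (rule graded_submodule_diff[OF graded_submodule_free x(1) zf])
  have "koszul_vec w \<tau> = (\<lambda>_. 0)" if "card \<tau> = Suc p" for \<tau>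
    using z(2)[OF that] that unfolding w_def koszul_vec_diff z0_def by simp
  moreover have "int p + (e - d) \<noteq> 0" using ne by simp
  ultimately obtain y where y: "\<And>\<sigma>. y \<sigma> \<in> free_piece r (e - d + int (card \<sigma>))" "\<And>\<sigma>. card \<sigma> = p \<Longrightarrow> w \<sigma> = koszul_vec y \<sigma>"
    using exact_atE[OF exact_at_free, of p "e - d" w r] w by blast
  show "\<exists>y. (\<forall>\<sigma>. y \<sigma> \<in> im_piece A r' r d (e + int (card \<sigma>))) \<and> (\<forall>\<sigma>. card \<sigma> = p \<longrightarrow> c \<sigma> = koszul_vec y \<sigma>)"
  proof (intro exI[of _ "\<lambda>\<sigma>. mat_apply A r' r (y \<sigma>)"] conjI allI impI)
    fix \<sigma>
    show "mat_apply A r' r (y \<sigma>) \<in> im_piece A r' r d (e + int (card \<sigma>))"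
      using y(1) unfolding im_piece_def shift by blast
    assume "card \<sigma> = p"
    then have "koszul_vec (\<lambda>\<sigma>. mat_apply A r' r (y \<sigma>)) \<sigma> = mat_apply A r' r (w \<sigma>)" using y(2) by (simp add: mat_apply_koszul_vec)
    also have "\<dots> = c \<sigma>" using z(1)[of \<sigma>] unfolding w_def mat_apply_diff ker_piece_def cx by simp
    finally show "c \<sigma> = koszul_vec (\<lambda>\<sigma>. mat_apply A r' r (y \<sigma>)) \<sigma>" by simp
  qed
qed

text \<open>The same sequence read in the other direction. On the line \<open>int p + e = 0\<close>,
  where the free module may fail to be exact, the cochains have degree 0, and independence of the
  columns over the constants leaves only zero.\<close>

lemma exact_ker_if_exact_im:
  fixes A :: "nat \<Rightarrow> nat \<Rightarrow> ('v::{finite,linorder}, 'k::comm_ring_1) mpoly"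
  assumes A: "homogeneous_matrix A r' r d"
    and im: "\<And>q. p = Suc q \<Longrightarrow> exact_at (im_piece A r' r d) q (e + d)"
    and indep: "ker_piece A r' r 0 = {\<lambda>_. 0}"
  shows "exact_at (ker_piece A r' r) p e"
proof (rule exact_atI)
  fix c :: "'v set \<Rightarrow> ('v, 'k) pvec"
  assume c: "\<And>\<sigma>. c \<sigma> \<in> ker_piece A r' r (e + int (card \<sigma>))"
    and cyc: "\<And>\<tau>. card \<tau> = Suc p \<Longrightarrow> koszul_vec c \<tau> = (\<lambda>_. 0)"
  note zero = graded_submoduleD(2)[OF graded_submodule_ker[OF A]]
  show "\<exists>y. (\<forall>\<sigma>. y \<sigma> \<in> ker_piece A r' r (e + int (card \<sigma>))) \<and> (\<forall>\<sigma>. card \<sigma> = p \<longrightarrow> c \<sigma> = koszul_vec y \<sigma>)"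
  proof (cases "int p + e = 0")
    case True
    have "c \<sigma> = (\<lambda>_. 0)" if "card \<sigma> = p" for \<sigma>
    proof -
      have "e + int (card \<sigma>) = 0" using True that by simp
      then show ?thesis using c[of \<sigma>] indep by simp
    qed
    then show ?thesis by (intro exI[of _ "\<lambda>_ _. 0"]) (simp add: zero)
  next
    case False
    have mcoeff: "c \<sigma> \<in> free_piece r (e + int (card \<sigma>))" for \<sigma> using c unfolding ker_piece_def by blast
    obtain y where y: "\<And>\<sigma>. y \<sigma> \<in> free_piece r (e + int (card \<sigma>))" "\<And>\<sigma>. card \<sigma> = p \<Longrightarrow> c \<sigma> = koszul_vec y \<sigma>"
      using exact_atE[OF exact_at_free[OF False], of c r] mcoeff cyc by blast
    show ?thesis
    proof (cases p)
      case 0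
      have "c \<sigma> = (\<lambda>_. 0)" if "card \<sigma> = p" for \<sigma>
      proof -
        have "\<sigma> = {}" using that 0 by simp
        then show ?thesis using y(2)[OF that] by (simp add: koszul_vec_def koszul_diff_def)
      qed
      then show ?thesis by (intro exI[of _ "\<lambda>_ _. 0"]) (simp add: zero)
    next
      case (Suc q)
      have shift: "e + d + int n - d = e + int n" for n by simp
      have "koszul_vec (\<lambda>\<sigma>. mat_apply A r' r (y \<sigma>)) \<tau> = (\<lambda>_. 0)" if "card \<tau> = Suc q" for \<tau>
        using y(2)[of \<tau>] c[of \<tau>] that Suc unfolding mat_apply_koszul_vec[symmetric] ker_piece_def by simp
      moreover have "mat_apply A r' r (y \<sigma>) \<in> im_piece A r' r d (e + d + int (card \<sigma>))" for \<sigma>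
        using y(1) unfolding im_piece_def shift by blast
      ultimately obtain w where w: "\<And>\<sigma>. w \<sigma> \<in> im_piece A r' r d (e + d + int (card \<sigma>))"
        "\<And>\<sigma>. card \<sigma> = q \<Longrightarrow> mat_apply A r' r (y \<sigma>) = koszul_vec w \<sigma>"
        using exact_atE[OF im[OF Suc], of "\<lambda>\<sigma>. mat_apply A r' r (y \<sigma>)"] by blast
      have "\<exists>x. x \<in> free_piece r (e + int (card \<sigma>)) \<and> w \<sigma> = mat_apply A r' r x" for \<sigma>
        using w(1)[of \<sigma>] unfolding im_piece_def shift by blast
      then obtain x where x: "\<And>\<sigma>. x \<sigma> \<in> free_piece r (e + int (card \<sigma>))" "\<And>\<sigma>. w \<sigma> = mat_apply A r' r (x \<sigma>)" by metis
      have wx: "w = (\<lambda>\<sigma>. mat_apply A r' r (x \<sigma>))" using x(2) by auto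
      define y' where "y' \<sigma> = (if card \<sigma> = q then (\<lambda>l. y \<sigma> l - koszul_vec x \<sigma> l) else (\<lambda>_. 0))" for \<sigma>
      have "y' \<sigma> \<in> ker_piece A r' r (e + int (card \<sigma>))" for \<sigma>
      proof (cases "card \<sigma> = q")
        case True
        have "mat_apply A r' r (\<lambda>l. y \<sigma> l - koszul_vec x \<sigma> l) = (\<lambda>_. 0)"
          using w(2)[OF True] unfolding mat_apply_diff mat_apply_koszul_vec wx by simp
        moreover have "(\<lambda>l. y \<sigma> l - koszul_vec x \<sigma> l) \<in> free_piece r (e + int (card \<sigma>))"
          by (rule graded_submodule_diff[OF graded_submodule_free y(1)]) (rule koszul_vec_in[OF graded_submodule_free x(1)])
        ultimately show ?thesis using True unfolding ker_piece_def y'_def by simp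
      qed (simp add: y'_def zero)
      moreover have "c \<sigma> = koszul_vec y' \<sigma>" if "card \<sigma> = p" for \<sigma>
      proof -
        have "koszul_vec y' \<sigma> = koszul_vec (\<lambda>\<sigma> l. y \<sigma> l - koszul_vec x \<sigma> l) \<sigma>"
          by (rule koszul_vec_cong) (use that Suc in \<open>simp add: y'_def\<close>)
        then show ?thesis using y(2)[OF that] by (simp add: koszul_vec_diff koszul_vec_koszul_vec)
      qed
      ultimately show ?thesis by blast
    qed
  qed
qed

section \<open>Bases of graded pieces and linear presentations\<close>

lemma sum_fun_apply: "(\<Sum>i\<in>I. f i) x = (\<Sum>i\<in>I. f i x)" for f :: "'i \<Rightarrow> 'x \<Rightarrow> 'y::comm_monoid_add"
  by (induction I rule: infinite_finite_induct) simp_all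

definition const_scale :: "'k \<Rightarrow> ('v, 'k::comm_ring_1) pvec \<Rightarrow> ('v, 'k) pvec" where
  "const_scale k x = (\<lambda>l. Poly_Mapping.single 0 k * x l)"

lemma vector_space_const_scale: "vector_space (const_scale :: 'k::field \<Rightarrow> ('v, 'k) pvec \<Rightarrow> ('v, 'k) pvec)"
proof
  fix a b :: 'k and x y :: "('v, 'k) pvec"
  show "const_scale a (x + y) = const_scale a x + const_scale a y"
    by (auto simp: const_scale_def distrib_left)
  show "const_scale (a + b) x = const_scale a x + const_scale b x"
    by (auto simp: const_scale_def distrib_right single_add)
  show "const_scale a (const_scale b x) = const_scale (a * b) x"
  proof
    fix l
    have "Poly_Mapping.single (0 :: 'v \<Rightarrow>\<^sub>0 nat) a * Poly_Mapping.single 0 b = Poly_Mapping.single 0 (a * b)"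
      by (simp add: mult_single)
    then show "const_scale a (const_scale b x) l = const_scale (a * b) x l"
      unfolding const_scale_def by (simp flip: mult.assoc)
  qed
  show "const_scale 1 x = x" by (simp add: const_scale_def)
qed

interpretation const_vs: vector_space "const_scale :: 'k::field \<Rightarrow> ('v, 'k) pvec \<Rightarrow> ('v, 'k) pvec"
  by (rule vector_space_const_scale)

lemma finite_exps_of_degree: "finite {u :: 'v::finite \<Rightarrow> int. (\<forall>v. 0 \<le> u v) \<and> sum u UNIV = d}"
proof (rule finite_subset)
  show "{u :: 'v \<Rightarrow> int. (\<forall>v. 0 \<le> u v) \<and> sum u UNIV = d} \<subseteq> PiE UNIV (\<lambda>_. {0..d})"
    by (auto simp: PiE_UNIV_domain intro!: member_le_sum)
qed (simp add: finite_PiE)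

definition unit_vec_mono :: "nat \<Rightarrow> ('v::finite \<Rightarrow> int) \<Rightarrow> ('v, 'k::comm_ring_1) pvec" where
  "unit_vec_mono j u = (\<lambda>l. if l = j then Poly_Mapping.single (expo u) 1 else 0)"

lemma poly_of_mcoeff: "poly_of (mcoeff f) = f"
  by (rule mcoeff_eqI) (rule mcoeff_poly_of[OF finite_mcoeff_support], rule mcoeff_nonneg)

text \<open>Finitely many monomial vectors span a fixed degree, which makes bases of graded pieces
  finite.\<close>

lemma free_piece_subset_span:
  "(free_piece r d :: ('v::finite, 'k::field) pvec set) \<subseteq>
    const_vs.span ((\<lambda>(j, u). unit_vec_mono j u) ` ({..<r} \<times> {u. (\<forall>v. 0 \<le> u v) \<and> sum u UNIV = d}))"
    (is "_ \<subseteq> const_vs.span ?T")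
proof
  fix x :: "('v, 'k) pvec" assume x: "x \<in> free_piece r d"
  have "x = (\<Sum>j<r. \<Sum>u | mcoeff (x j) u \<noteq> 0. const_scale (mcoeff (x j) u) (unit_vec_mono j u))"
  proof
    fix l
    have "(\<Sum>j<r. \<Sum>u | mcoeff (x j) u \<noteq> 0. const_scale (mcoeff (x j) u) (unit_vec_mono j u)) l
      = (\<Sum>j<r. \<Sum>u | mcoeff (x j) u \<noteq> 0. if l = j then Poly_Mapping.single (expo u) (mcoeff (x j) u) else 0)"
      unfolding sum_fun_apply const_scale_def unit_vec_mono_def
      by (intro sum.cong refl) (simp add: mult_single)
    also have "\<dots> = (\<Sum>j<r. if l = j then poly_of (mcoeff (x j)) else 0)"
      unfolding poly_of_def by (intro sum.cong refl) auto
    also have "\<dots> = (if l < r then x l else 0)" by (simp add: poly_of_mcoeff)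
    also have "\<dots> = x l" using x unfolding free_piece_def by auto
    finally show "x l = (\<Sum>j<r. \<Sum>u | mcoeff (x j) u \<noteq> 0. const_scale (mcoeff (x j) u) (unit_vec_mono j u)) l" ..
  qed
  also have "\<dots> \<in> const_vs.span ?T"
  proof (intro const_vs.span_sum const_vs.span_scale const_vs.span_base)
    fix j u assume "j \<in> {..<r}" "u \<in> {u. mcoeff (x j) u \<noteq> 0}"
    moreover from this have "sum u UNIV = d" using x unfolding free_piece_def homogeneous_iff by blast
    ultimately have "(j, u) \<in> {..<r} \<times> {u. (\<forall>v. 0 \<le> u v) \<and> sum u UNIV = d}" using mcoeff_nonneg[of "x j" u] by auto
    then show "unit_vec_mono j u \<in> ?T" by (metis (no_types, lifting) case_prod_conv image_eqI)
  qed
  finally show "x \<in> const_vs.span ?T" .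
qed

lemma graded_piece_basis:
  fixes G :: "int \<Rightarrow> ('v::finite, 'k::field) pvec set"
  assumes G: "graded_submodule r' G"
  shows "\<exists>(r :: nat) b. (\<forall>l<r. b l \<in> G d) \<and>
    (\<forall>x\<in>G d. \<exists>\<kappa>. x = (\<lambda>k. \<Sum>l<r. Poly_Mapping.single 0 (\<kappa> l) * b l k)) \<and>
    (\<forall>\<kappa>. (\<lambda>k. \<Sum>l<r. Poly_Mapping.single 0 (\<kappa> l) * b l k) = (\<lambda>_. 0) \<longrightarrow> (\<forall>l<r. \<kappa> l = 0))"
proof -
  let ?T = "(\<lambda>(j, u). unit_vec_mono j u :: ('v, 'k) pvec) ` ({..<r'} \<times> {u. (\<forall>v. 0 \<le> u v) \<and> sum u UNIV = d})"
  obtain B where B: "B \<subseteq> G d" "const_vs.independent B" "G d \<subseteq> const_vs.span B"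
    by (rule const_vs.maximal_independent_subset)
  have "finite ?T" using finite_exps_of_degree by (intro finite_imageI finite_cartesian_product) auto
  moreover have "B \<subseteq> const_vs.span ?T"
    using B(1) graded_submoduleD(1)[OF G] free_piece_subset_span by blast
  ultimately have fin: "finite B" using const_vs.independent_span_bound[OF _ B(2)] by blast
  obtain b where b: "bij_betw b {0..<card B} B" using ex_bij_betw_nat_finite[OF fin] by blast
  then have b': "bij_betw b {..<card B} B" by (simp add: atLeast0LessThan)
  have reindex: "(\<lambda>k. \<Sum>l<card B. Poly_Mapping.single 0 (\<kappa> (b l)) * b l k) = (\<Sum>v\<in>B. const_scale (\<kappa> v) v)" for \<kappa>
  proof
    fix k
    show "(\<Sum>l<card B. Poly_Mapping.single 0 (\<kappa> (b l)) * b l k) = (\<Sum>v\<in>B. const_scale (\<kappa> v) v) k"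
      unfolding sum_fun_apply const_scale_def
      by (rule sum.reindex_bij_betw[OF b', of "\<lambda>v. Poly_Mapping.single 0 (\<kappa> v) * v k"])
  qed
  show ?thesis
  proof (intro exI[of _ "card B"] exI[of _ b] conjI ballI allI impI)
    show "b l \<in> G d" if "l < card B" for l using that b' B(1) unfolding bij_betw_def by blast
  next
    fix x assume "x \<in> G d"
    then have "x \<in> range (\<lambda>u. \<Sum>v\<in>B. const_scale (u v) v)" using B(3) const_vs.span_finite[OF fin] by blast
    then obtain u where "x = (\<Sum>v\<in>B. const_scale (u v) v)" by blast
    then show "\<exists>\<kappa>. x = (\<lambda>k. \<Sum>l<card B. Poly_Mapping.single 0 (\<kappa> l) * b l k)"
      using reindex[of u] by (intro exI[of _ "\<lambda>l. u (b l)"]) simp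
  next
    fix \<kappa> :: "nat \<Rightarrow> 'k" assume 0: "(\<lambda>k. \<Sum>l<card B. Poly_Mapping.single 0 (\<kappa> l) * b l k) = (\<lambda>_. 0)"
    define u where "u v = \<kappa> (the_inv_into {..<card B} b v)" for v
    have inv: "the_inv_into {..<card B} b (b l) = l" if "l < card B" for l
      using b' that unfolding bij_betw_def by (intro the_inv_into_f_f) auto
    have "(\<lambda>k. \<Sum>l<card B. Poly_Mapping.single 0 (u (b l)) * b l k) = (\<lambda>_. 0)"
      unfolding 0[symmetric] u_def by (intro ext sum.cong refl) (simp add: inv)
    then have "(\<Sum>v\<in>B. const_scale (u v) v) = 0" unfolding reindex by (simp add: zero_fun_def)
    then have "u v = 0" if "v \<in> B" for v
      using B(2) that unfolding const_vs.dependent_finite[OF fin] by blast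
    then show "\<kappa> l = 0" if "l < card B" for l
      using inv[OF that] b' that unfolding u_def bij_betw_def by (metis image_eqI lessThan_iff)
  qed
qed

lemma graded_submodule_mult:
  fixes G :: "int \<Rightarrow> ('v::finite, 'k::comm_ring_1) pvec set"
  assumes G: "graded_submodule r G" and x: "x \<in> G e" and f: "homogeneous d f"
  shows "(\<lambda>l. f * x l) \<in> G (e + d)"
proof -
  have mono: "(\<lambda>l. Poly_Mapping.single t k * x l) \<in> G (e + int (\<Sum>v\<in>UNIV. Poly_Mapping.lookup t v))" for t k
  proof (induction "\<Sum>v\<in>UNIV. Poly_Mapping.lookup t v" arbitrary: t)
    case 0
    then have "t = 0" by (intro poly_mapping_eqI) simp
    then show ?case using graded_submoduleD(5)[OF G x] by simp
  next
    case (Suc n)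
    then obtain v where v: "Poly_Mapping.lookup t v \<noteq> 0" by (metis sum.neutral Zero_not_Suc)
    define t' where "t' = t - Poly_Mapping.single v 1"
    have t: "t = Poly_Mapping.single v 1 + t'"
      unfolding t'_def by (rule poly_mapping_eqI) (use v in \<open>auto simp: lookup_add lookup_minus lookup_single when_def\<close>)
    have deg: "(\<Sum>w\<in>UNIV. Poly_Mapping.lookup t w) = 1 + (\<Sum>w\<in>UNIV. Poly_Mapping.lookup t' w)"
      unfolding t by (simp add: lookup_add sum.distrib lookup_single when_def)
    then have "(\<lambda>l. Poly_Mapping.single t' k * x l) \<in> G (e + int (\<Sum>w\<in>UNIV. Poly_Mapping.lookup t' w))"
      using Suc.hyps(2) by (intro Suc.hyps(1)) simp
    from graded_submoduleD(4)[OF G this, of v]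
    have "(\<lambda>l. var v * (Poly_Mapping.single t' k * x l)) \<in> G (e + int (\<Sum>w\<in>UNIV. Poly_Mapping.lookup t w))"
      unfolding deg by (simp add: algebra_simps)
    moreover have "var v * (Poly_Mapping.single t' k * x l) = Poly_Mapping.single t k * x l" for l
      unfolding var_def t by (simp add: mult_single flip: mult.assoc)
    ultimately show ?case by simp
  qed
  have "(\<lambda>l. \<Sum>u | mcoeff f u \<noteq> 0. Poly_Mapping.single (expo u) (mcoeff f u) * x l) \<in> G (e + d)"
  proof (rule graded_submodule_sum[OF G])
    fix u assume u: "u \<in> {u. mcoeff f u \<noteq> 0}"
    then have "int (\<Sum>v\<in>UNIV. Poly_Mapping.lookup (expo u) v) = d"
      using f mcoeff_nonneg[of f u] unfolding homogeneous_iff by simp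
    then show "(\<lambda>l. Poly_Mapping.single (expo u) (mcoeff f u) * x l) \<in> G (e + d)"
      using mono[of "expo u" "mcoeff f u"] by simp
  qed
  moreover have "(\<Sum>u | mcoeff f u \<noteq> 0. Poly_Mapping.single (expo u) (mcoeff f u) * x l) = f * x l" for l
    unfolding sum_distrib_right[symmetric] poly_of_def[symmetric] poly_of_mcoeff ..
  ultimately show ?thesis by simp
qed

text \<open>Exactness in top position means that the module is generated in degree \<open>d\<close>.\<close>

lemma im_piece_eq_if_exact:
  fixes G :: "int \<Rightarrow> ('v::{finite,linorder}, 'k::comm_ring_1) pvec set"
  assumes G: "graded_submodule r' G" and A: "homogeneous_matrix A r' r d"
    and exact: "\<And>e. int (card (UNIV :: 'v set)) + e \<noteq> d \<Longrightarrow> exact_at G (card (UNIV :: 'v set)) e"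
    and col: "\<And>l. l < r \<Longrightarrow> (\<lambda>k. if k < r' then A k l else 0) \<in> G d"
    and gen: "\<And>x. x \<in> G d \<Longrightarrow> \<exists>\<kappa>. x = mat_apply A r' r (\<lambda>l. if l < r then Poly_Mapping.single 0 (\<kappa> l) else 0)"
  shows "G e = im_piece A r' r d e"
proof
  show "im_piece A r' r d e \<subseteq> G e"
  proof
    fix y assume "y \<in> im_piece A r' r d e"
    then obtain x where x: "x \<in> free_piece r (e - d)" "y = mat_apply A r' r x" unfolding im_piece_def by blast
    have "(\<lambda>k. \<Sum>l<r. x l * (if k < r' then A k l else 0)) \<in> G e"
    proof (rule graded_submodule_sum[OF G])
      fix l assume "l \<in> {..<r}"
      then have "(\<lambda>k. x l * (if k < r' then A k l else 0)) \<in> G (d + (e - d))"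
        using x(1) by (intro graded_submodule_mult[OF G col]) (auto simp: free_piece_def)
      then show "(\<lambda>k. x l * (if k < r' then A k l else 0)) \<in> G e" by simp
    qed
    moreover have "(\<lambda>k. \<Sum>l<r. x l * (if k < r' then A k l else 0)) = y"
      unfolding x(2) mat_apply_def by (auto simp: mult.commute)
    ultimately show "y \<in> G e" by simp
  qed
next
  let ?n = "card (UNIV :: 'v set)"
  note im = graded_submodule_im[OF A]
  show "G e \<subseteq> im_piece A r' r d e"
  \<comment> \<open>Induction on the degree, shifted by one so that the base case covers the
    negative degrees, where all pieces are zero.\<close>
  proof (induction "nat (e + 1)" arbitrary: e)
    case 0
    show ?case
    proof
      fix x assume "x \<in> G e"
      then have "x l = 0" for l
        using graded_submoduleD(1)[OF G, of x e] 0 homogeneous_negative[of e "x l"] unfolding free_piece_def by auto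
      then have "x = (\<lambda>_. 0)" by auto
      then show "x \<in> im_piece A r' r d e" using graded_submoduleD(2)[OF im] by simp
    qed
  next
    case (Suc j)
    have IH: "G (e - 1) \<subseteq> im_piece A r' r d (e - 1)" by (rule Suc(1)) (use Suc(2) in simp)
    show ?case
    proof
      fix x assume x: "x \<in> G e"
      show "x \<in> im_piece A r' r d e"
      proof (cases "e = d")
        case True
        then obtain \<kappa> where "x = mat_apply A r' r (\<lambda>l. if l < r then Poly_Mapping.single 0 (\<kappa> l) else 0)" using gen x by blast
        moreover have "(\<lambda>l. if l < r then Poly_Mapping.single 0 (\<kappa> l) else 0) \<in> free_piece r (e - d)"
          using True unfolding free_piece_def by (simp add: homogeneous_const)
        ultimately show ?thesis unfolding im_piece_def by blast
      next
        case False
        \<comment> \<open>Placed at the full set, \<open>x\<close> is a cocycle because no larger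
          set exists; a primitive expresses it by variables times elements of degree
          \<open>e - 1\<close>.\<close>
        define c where "c \<sigma> = (if \<sigma> = UNIV then x else (\<lambda>_. 0))" for \<sigma> :: "'v set"
        have "c \<sigma> \<in> G (e - int ?n + int (card \<sigma>))" for \<sigma>
          using x graded_submoduleD(2)[OF G] by (simp add: c_def)
        moreover have "card \<tau> \<noteq> Suc ?n" for \<tau> :: "'v set" using card_mono[of UNIV \<tau>] by auto
        moreover have "exact_at G ?n (e - int ?n)" using False by (intro exact) simp
        ultimately obtain y where y: "\<And>\<sigma>. y \<sigma> \<in> G (e - int ?n + int (card \<sigma>))" "\<And>\<sigma>. card \<sigma> = ?n \<Longrightarrow> c \<sigma> = koszul_vec y \<sigma>"
          using exact_atE[of G ?n "e - int ?n" c] by metis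
        define y' where "y' \<sigma> = (if Suc (card \<sigma>) = ?n then y \<sigma> else (\<lambda>_. 0))" for \<sigma>
        have y': "y' \<sigma> \<in> im_piece A r' r d (e - int ?n + int (card \<sigma>))" for \<sigma>
        proof (cases "Suc (card \<sigma>) = ?n")
          case True
          then have eq: "e - int ?n + int (card \<sigma>) = e - 1" by linarith
          show ?thesis using y(1)[of \<sigma>] IH True unfolding y'_def eq by auto
        qed (simp add: y'_def graded_submoduleD(2)[OF im])
        have "x = koszul_vec y UNIV" using y(2)[of UNIV] by (simp add: c_def)
        also have "\<dots> = koszul_vec y' UNIV" by (rule koszul_vec_cong) (simp add: y'_def)
        also have "\<dots> \<in> im_piece A r' r d (e - int ?n + int ?n)" by (rule koszul_vec_in[OF im y'])
        finally show ?thesis by simp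
      qed
    qed
  qed
qed

text \<open>A basis of the degree \<open>d\<close> piece gives the columns of \<open>A\<close>. They
  generate by exactness in top position, and their independence makes the presentation minimal, so
  the kernel satisfies the same hypothesis with 1 in place of \<open>d\<close> and the step can be
  repeated with linear matrices.\<close>

lemma linear_presentation_step:
  fixes G :: "int \<Rightarrow> ('v::{finite,linorder}, 'k::field) pvec set"
  assumes G: "graded_submodule r' G" and exact: "\<And>p e. int p + e \<noteq> d \<Longrightarrow> exact_at G p e"
  obtains r A where "homogeneous_matrix A r' r d" "\<And>e. G e = im_piece A r' r d e"
    "\<And>p e. int p + e \<noteq> 1 \<Longrightarrow> exact_at (ker_piece A r' r) p e"
proof -
  obtain r :: nat and b where b': "\<forall>l<r. b l \<in> G d"
    "\<forall>x\<in>G d. \<exists>\<kappa>. x = (\<lambda>k. \<Sum>l<r. Poly_Mapping.single 0 (\<kappa> l) * b l k)"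
    "\<forall>\<kappa>. (\<lambda>k. \<Sum>l<r. Poly_Mapping.single 0 (\<kappa> l) * b l k) = (\<lambda>_. 0) \<longrightarrow> (\<forall>l<r. \<kappa> l = 0)"
    using graded_piece_basis[OF G, of d] by (elim exE conjE) (rule that)
  note b = b'(1)[rule_format] b'(2)[THEN bspec] b'(3)[THEN spec, THEN mp]
  define A where "A k l = b l k" for k l
  have bfree: "homogeneous d (b l k)" "r' \<le> k \<Longrightarrow> b l k = 0" if "l < r" for l k
    using graded_submoduleD(1)[OF G b(1)[OF that]] unfolding free_piece_def by auto
  have A: "homogeneous_matrix A r' r d"
    unfolding homogeneous_matrix_def A_def using bfree(1) by blast
  have mat_apply: "mat_apply A r' r (\<lambda>l. if l < r then Poly_Mapping.single 0 (\<kappa> l) else 0) =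
      (\<lambda>k. \<Sum>l<r. Poly_Mapping.single 0 (\<kappa> l) * b l k)" for \<kappa>
  proof
    fix k
    show "mat_apply A r' r (\<lambda>l. if l < r then Poly_Mapping.single 0 (\<kappa> l) else 0) k =
      (\<Sum>l<r. Poly_Mapping.single 0 (\<kappa> l) * b l k)"
      unfolding mat_apply_def A_def using bfree(2) by (cases "k < r'") (auto simp: mult.commute)
  qed
  have col: "(\<lambda>k. if k < r' then A k l else 0) = b l" if "l < r" for l
    unfolding A_def using bfree(2)[OF that] by auto
  have im: "G e = im_piece A r' r d e" for e
    by (rule im_piece_eq_if_exact[OF G A exact]) (use b(1,2) col mat_apply in auto)
  have ker0: "ker_piece A r' r 0 = {\<lambda>_. 0}"
  proof (intro equalityI subsetI)
    fix x assume x: "x \<in> ker_piece A r' r 0"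
    then have "\<exists>k. x l = Poly_Mapping.single 0 k" for l
      unfolding ker_piece_def free_piece_def by (metis (mono_tags, lifting) homogeneous_constE mem_Collect_eq)
    then obtain \<kappa> where \<kappa>: "\<And>l. x l = Poly_Mapping.single 0 (\<kappa> l)" by metis
    have xr: "x l = 0" if "\<not> l < r" for l using x that unfolding ker_piece_def free_piece_def by auto
    then have "x = (\<lambda>l. if l < r then Poly_Mapping.single 0 (\<kappa> l) else 0)" using \<kappa> by auto
    then have "(\<lambda>k. \<Sum>l<r. Poly_Mapping.single 0 (\<kappa> l) * b l k) = (\<lambda>_. 0)"
      using x mat_apply[of \<kappa>] unfolding ker_piece_def by auto
    then have "\<forall>l<r. \<kappa> l = 0" by (rule b(3))
    then have "x l = 0" for l using \<kappa>[of l] xr[of l] by (cases "l < r") simp_all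
    then show "x \<in> {\<lambda>_. 0}" by auto
  qed (simp add: ker_piece_def free_piece_def)
  have "exact_at (ker_piece A r' r) p e" if "int p + e \<noteq> 1" for p e
  proof (rule exact_ker_if_exact_im[OF A _ ker0])
    fix q assume "p = Suc q"
    then have "exact_at G q (e + d)" using that by (intro exact) simp
    moreover have "im_piece A r' r d = G" using im by auto
    ultimately show "exact_at (im_piece A r' r d) q (e + d)" by simp
  qed
  then show thesis using that A im by blast
qed

section \<open>Homogeneous components: from graded pieces to whole modules\<close>

definition hom_part :: "int \<Rightarrow> ('v::finite, 'k::comm_ring_1) mpoly \<Rightarrow> ('v, 'k) mpoly" where
  "hom_part e f = poly_of (\<lambda>u. if sum u UNIV = e then mcoeff f u else 0)"

lemma mcoeff_hom_part: "mcoeff (hom_part e f) u = (if sum u UNIV = e then mcoeff f u else 0)"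
  unfolding hom_part_def
proof (rule mcoeff_poly_of)
  show "finite {u. (if sum u UNIV = e then mcoeff f u else 0) \<noteq> 0}"
    by (rule finite_subset[OF _ finite_mcoeff_support[of f]]) auto
qed (auto split: if_splits intro: mcoeff_nonneg)

lemma homogeneous_hom_part: "homogeneous e (hom_part e f)"
  unfolding homogeneous_iff mcoeff_hom_part by simp

lemma hom_part_homogeneous: "homogeneous d f \<Longrightarrow> hom_part e f = (if e = d then f else 0)"
  by (rule mcoeff_eqI) (auto simp: mcoeff_hom_part homogeneous_iff)

lemma hom_part_zero [simp]: "hom_part e 0 = 0"
  by (rule mcoeff_eqI) (simp add: mcoeff_hom_part)

lemma hom_part_sum: "hom_part e (\<Sum>i\<in>I. f i) = (\<Sum>i\<in>I. hom_part e (f i))"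
  by (rule mcoeff_eqI) (simp add: mcoeff_hom_part mcoeff_sum)

definition degrees :: "('v::finite, 'k::comm_ring_1) mpoly \<Rightarrow> int set" where
  "degrees f = (\<lambda>u. sum u UNIV) ` {u. mcoeff f u \<noteq> 0}"

lemma finite_degrees [simp]: "finite (degrees f)"
  unfolding degrees_def by (intro finite_imageI finite_mcoeff_support)

lemma sum_hom_part:
  assumes "finite S" "degrees f \<subseteq> S"
  shows "(\<Sum>e\<in>S. hom_part e f) = f"
proof (rule mcoeff_eqI)
  fix u
  show "mcoeff (\<Sum>e\<in>S. hom_part e f) u = mcoeff f u"
    using assms unfolding mcoeff_sum mcoeff_hom_part degrees_def by (cases "mcoeff f u = 0") auto
qed

lemma hom_part_mult:
  assumes "homogeneous d f"
  shows "hom_part (d + e) (f * g) = f * hom_part e g"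
proof -
  let ?S = "insert e (degrees g)"
  have "f * g = (\<Sum>i\<in>?S. f * hom_part i g)"
    unfolding sum_distrib_left[symmetric] by (subst sum_hom_part) auto
  then have "hom_part (d + e) (f * g) = (\<Sum>i\<in>?S. hom_part (d + e) (f * hom_part i g))" by (simp only: hom_part_sum)
  also have "\<dots> = (\<Sum>i\<in>?S. if i = e then f * hom_part e g else 0)"
    by (intro sum.cong refl) (use hom_part_homogeneous[OF homogeneous_mult[OF assms homogeneous_hom_part]] in auto)
  also have "\<dots> = f * hom_part e g" by (subst sum.delta) auto
  finally show ?thesis .
qed

definition supported :: "nat \<Rightarrow> (nat \<Rightarrow> 'a::zero) \<Rightarrow> bool" where
  "supported r x \<longleftrightarrow> (\<forall>l\<ge>r. x l = 0)"

lemma mat_apply_hom_part: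
  assumes "homogeneous_matrix A r' r d"
  shows "(\<lambda>k. hom_part (d + e) (mat_apply A r' r x k)) = mat_apply A r' r (\<lambda>l. hom_part e (x l))"
proof
  fix k
  show "hom_part (d + e) (mat_apply A r' r x k) = mat_apply A r' r (\<lambda>l. hom_part e (x l)) k"
  proof (cases "k < r'")
    case True
    then have "hom_part (d + e) (mat_apply A r' r x k) = (\<Sum>l<r. hom_part (d + e) (A k l * x l))" by (simp add: mat_apply_def hom_part_sum)
    also have "\<dots> = (\<Sum>l<r. A k l * hom_part e (x l))"
      using assms True unfolding homogeneous_matrix_def by (intro sum.cong refl hom_part_mult) auto
    finally show ?thesis using True by (simp add: mat_apply_def)
  qed (simp add: mat_apply_def)
qed

lemma hom_part_in_free: "supported r x \<Longrightarrow> (\<lambda>l. hom_part e (x l)) \<in> free_piece r e"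
  unfolding supported_def free_piece_def by (simp add: homogeneous_hom_part)

lemma supported_free: "x \<in> free_piece r e \<Longrightarrow> supported r x"
  unfolding supported_def free_piece_def by blast

lemma mat_apply_sum: "mat_apply A r' r (\<lambda>l. \<Sum>i\<in>I. x i l) = (\<lambda>k. \<Sum>i\<in>I. mat_apply A r' r (x i) k)"
proof
  fix k show "mat_apply A r' r (\<lambda>l. \<Sum>i\<in>I. x i l) k = (\<Sum>i\<in>I. mat_apply A r' r (x i) k)"
    unfolding mat_apply_def by (simp add: sum_distrib_left sum.swap[of _ _ I])
qed

text \<open>The matrix is homogeneous, so any preimage of a homogeneous vector may be replaced by
  its component of degree \<open>e - d\<close>.\<close>

lemma in_im_piece_iff:
  assumes "homogeneous_matrix A r' r d"
  shows "y \<in> im_piece A r' r d e \<longleftrightarrow> y \<in> free_piece r' e \<and> (\<exists>x. supported r x \<and> y = mat_apply A r' r x)"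
proof
  assume "y \<in> im_piece A r' r d e"
  then show "y \<in> free_piece r' e \<and> (\<exists>x. supported r x \<and> y = mat_apply A r' r x)"
    using graded_submoduleD(1)[OF graded_submodule_im[OF assms]] supported_free unfolding im_piece_def by blast
next
  assume "y \<in> free_piece r' e \<and> (\<exists>x. supported r x \<and> y = mat_apply A r' r x)"
  then obtain x where y: "y \<in> free_piece r' e" and x: "supported r x" "y = mat_apply A r' r x" by blast
  have "hom_part (d + (e - d)) (y k) = y k" for k
    using y hom_part_homogeneous[of e "y k" e] unfolding free_piece_def by simp
  then have "y = (\<lambda>k. hom_part (d + (e - d)) (y k))" by simp
  also have "\<dots> = mat_apply A r' r (\<lambda>l. hom_part (e - d) (x l))" unfolding x(2) by (rule mat_apply_hom_part[OF assms])
  finally show "y \<in> im_piece A r' r d e" unfolding im_piece_def using hom_part_in_free[OF x(1)] by blast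
qed

lemma in_image_if_pieces:
  assumes A: "homogeneous_matrix A r' r d" and y: "supported r' y"
    and pieces: "\<And>e. (\<lambda>l. hom_part e (y l)) \<in> im_piece A r' r d e"
  shows "\<exists>x. supported r x \<and> y = mat_apply A r' r x"
proof -
  have "\<forall>e. \<exists>x. supported r x \<and> (\<lambda>l. hom_part e (y l)) = mat_apply A r' r x"
    using pieces unfolding in_im_piece_iff[OF A] by blast
  then obtain x where x: "\<And>e. supported r (x e)" "\<And>e. (\<lambda>l. hom_part e (y l)) = mat_apply A r' r (x e)" by metis
  define S where "S = (\<Union>l<r'. degrees (y l))"
  have "y l = (\<Sum>e\<in>S. hom_part e (y l))" for l
  proof (cases "l < r'")
    case True
    then show ?thesis unfolding S_def by (subst sum_hom_part) auto
  next
    case False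
    then show ?thesis using y unfolding supported_def by simp
  qed
  then have "y = (\<lambda>l. \<Sum>e\<in>S. mat_apply A r' r (x e) l)" using x(2) by (simp add: fun_eq_iff)
  then have "y = mat_apply A r' r (\<lambda>l. \<Sum>e\<in>S. x e l)" unfolding mat_apply_sum .
  moreover have "supported r (\<lambda>l. \<Sum>e\<in>S. x e l)" using x(1) unfolding supported_def by simp
  ultimately show ?thesis by blast
qed

definition exact_pair where
  "exact_pair A r' r B s \<longleftrightarrow> (\<forall>x. supported r x \<longrightarrow>
     (mat_apply A r' r x = (\<lambda>_. 0) \<longleftrightarrow> (\<exists>y. supported s y \<and> x = mat_apply B r s y)))"

text \<open>Resolutions speak of arbitrary vectors, Koszul exactness of graded pieces. Homogeneous
  maps respect components and a vector has finitely many of them, so exactness can be tested piece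
  by piece.\<close>

lemma exact_pair_iff:
  assumes A: "homogeneous_matrix A r' r d" and B: "homogeneous_matrix B r s d'"
  shows "exact_pair A r' r B s \<longleftrightarrow> (\<forall>e. ker_piece A r' r e = im_piece B r s d' e)"
proof
  assume ex: "exact_pair A r' r B s"
  show "\<forall>e. ker_piece A r' r e = im_piece B r s d' e"
    unfolding set_eq_iff in_im_piece_iff[OF B] ker_piece_def
    using ex supported_free unfolding exact_pair_def by blast
next
  assume pieces: "\<forall>e. ker_piece A r' r e = im_piece B r s d' e"
  show "exact_pair A r' r B s" unfolding exact_pair_def
  proof (intro allI impI iffI)
    fix x assume x: "supported r x" "mat_apply A r' r x = (\<lambda>_. 0)"
    have "(\<lambda>l. hom_part e (x l)) \<in> im_piece B r s d' e" for e
    proof -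
      have "mat_apply A r' r (\<lambda>l. hom_part e (x l)) = (\<lambda>_. 0)"
        unfolding mat_apply_hom_part[OF A, symmetric] x(2) by simp
      then have "(\<lambda>l. hom_part e (x l)) \<in> ker_piece A r' r e"
        unfolding ker_piece_def using hom_part_in_free[OF x(1)] by blast
      then show ?thesis using pieces by blast
    qed
    then show "\<exists>y. supported s y \<and> x = mat_apply B r s y" by (rule in_image_if_pieces[OF B x(1)])
  next
    fix x assume "supported r x" "\<exists>y. supported s y \<and> x = mat_apply B r s y"
    then obtain y where y: "supported s y" "x = mat_apply B r s y" by blast
    define S where "S = (\<Union>l<s. degrees (y l))"
    have "y l = (\<Sum>e\<in>S. hom_part e (y l))" for l
    proof (cases "l < s")
      case True
      then show ?thesis unfolding S_def by (subst sum_hom_part) auto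
    next
      case False
      then show ?thesis using y(1) unfolding supported_def by simp
    qed
    then have "y = (\<lambda>l. \<Sum>e\<in>S. hom_part e (y l))" by (rule ext)
    then have "x = (\<lambda>k. \<Sum>e\<in>S. mat_apply B r s (\<lambda>l. hom_part e (y l)) k)" unfolding y(2) mat_apply_sum[symmetric] by simp
    then have "mat_apply A r' r x = (\<lambda>k. \<Sum>e\<in>S. mat_apply A r' r (mat_apply B r s (\<lambda>l. hom_part e (y l))) k)" by (simp only: mat_apply_sum)
    moreover have "mat_apply A r' r (mat_apply B r s (\<lambda>l. hom_part e (y l))) = (\<lambda>_. 0)" for e
    proof -
      have "mat_apply B r s (\<lambda>l. hom_part e (y l)) \<in> im_piece B r s d' (d' + e)"
        unfolding im_piece_def using hom_part_in_free[OF y(1), of e] by simp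
      then show ?thesis using pieces unfolding ker_piece_def by blast
    qed
    ultimately show "mat_apply A r' r x = (\<lambda>_. 0)" by simp
  qed
qed

section \<open>Linear resolutions and the Koszul complex\<close>

definition ideal_pieces :: "('v::finite, 'k::comm_ring_1) mpoly set \<Rightarrow> int \<Rightarrow> ('v, 'k) pvec set" where
  "ideal_pieces J e = {x \<in> free_piece 1 e. x 0 \<in> J}"

lemma graded_submodule_ideal:
  assumes "up_exps X"
  shows "graded_submodule 1 (ideal_pieces (mon_ideal X :: ('v::finite, 'k::comm_ring_1) mpoly set))"
proof -
  have sub: "module.subspace (*) (mon_ideal X :: ('v, 'k) mpoly set)" by (rule subspace_mon_ideal[OF assms])
  note free = graded_submoduleD[OF graded_submodule_free[of 1, where 'a = 'v and 'b = 'k]]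
  show ?thesis unfolding graded_submodule_def ideal_pieces_def
    using sub free unfolding module.subspace_def[OF module_mult] by simp
qed

lemma ideal_eq_image_iff:
  fixes X :: "('v::finite \<Rightarrow> int) set"
  assumes A: "homogeneous_matrix A 1 r d"
  shows "(\<forall>e. ideal_pieces (mon_ideal X :: ('v, 'k::comm_ring_1) mpoly set) e = im_piece A 1 r d e) \<longleftrightarrow>
    (\<forall>f. f \<in> mon_ideal X \<longleftrightarrow> (\<exists>x. supported r x \<and> f = mat_apply A 1 r x 0))"
proof
  assume pieces: "\<forall>e. ideal_pieces (mon_ideal X :: ('v, 'k) mpoly set) e = im_piece A 1 r d e"
  show "\<forall>f. f \<in> mon_ideal X \<longleftrightarrow> (\<exists>x. supported r x \<and> f = mat_apply A 1 r x 0)"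
  proof (intro allI iffI)
    fix f :: "('v, 'k) mpoly" assume f: "f \<in> mon_ideal X"
    define y where "y l = (if l = 0 then f else 0)" for l :: nat
    have y: "supported 1 y" by (simp add: y_def supported_def)
    have "(\<lambda>l. hom_part e (y l)) \<in> im_piece A 1 r d e" for e
    proof -
      have "hom_part e f \<in> mon_ideal X" using f unfolding mon_ideal_def by (simp add: mcoeff_hom_part)
      then have "(\<lambda>l. hom_part e (y l)) \<in> ideal_pieces (mon_ideal X) e"
        unfolding ideal_pieces_def using hom_part_in_free[OF y] by (simp add: y_def)
      then show ?thesis using pieces by blast
    qed
    then obtain x where "supported r x" "y = mat_apply A 1 r x" using in_image_if_pieces[OF A y] by blast
    then show "\<exists>x. supported r x \<and> f = mat_apply A 1 r x 0" by (metis y_def)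
  next
    fix f :: "('v, 'k) mpoly" assume "\<exists>x. supported r x \<and> f = mat_apply A 1 r x 0"
    then obtain x where x: "supported r x" "f = mat_apply A 1 r x 0" by blast
    show "f \<in> mon_ideal X" unfolding mon_ideal_def mem_Collect_eq
    proof (intro allI impI)
      fix u assume u: "mcoeff f u \<noteq> 0"
      let ?e = "sum u UNIV"
      have "mat_apply A 1 r (\<lambda>l. hom_part (?e - d) (x l)) \<in> im_piece A 1 r d ?e"
        unfolding im_piece_def using hom_part_in_free[OF x(1)] by blast
      then have "mat_apply A 1 r (\<lambda>l. hom_part (?e - d) (x l)) 0 \<in> mon_ideal X"
        using pieces unfolding ideal_pieces_def by blast
      moreover have "mat_apply A 1 r (\<lambda>l. hom_part (?e - d) (x l)) 0 = hom_part ?e f"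
        unfolding mat_apply_hom_part[OF A, symmetric] x(2) by simp
      ultimately show "u \<in> X" using u unfolding mon_ideal_def by (simp add: mcoeff_hom_part)
    qed
  qed
next
  assume J: "\<forall>f. f \<in> mon_ideal X \<longleftrightarrow> (\<exists>x. supported r x \<and> f = mat_apply A 1 r x 0)"
  show "\<forall>e. ideal_pieces (mon_ideal X :: ('v, 'k) mpoly set) e = im_piece A 1 r d e"
  proof (intro allI equalityI subsetI)
    fix e y assume y: "y \<in> ideal_pieces (mon_ideal X :: ('v, 'k) mpoly set) e"
    then obtain x where x: "supported r x" "y 0 = mat_apply A 1 r x 0" using J unfolding ideal_pieces_def by blast
    have "y = mat_apply A 1 r x"
    proof
      fix l show "y l = mat_apply A 1 r x l"
        using x(2) y unfolding ideal_pieces_def free_piece_def by (cases "l = 0") (auto simp: mat_apply_def)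
    qed
    then show "y \<in> im_piece A 1 r d e"
      using y x(1) unfolding in_im_piece_iff[OF A] ideal_pieces_def by blast
  next
    fix e y assume "y \<in> im_piece A 1 r d e"
    then show "y \<in> ideal_pieces (mon_ideal X :: ('v, 'k) mpoly set) e"
      unfolding in_im_piece_iff[OF A] ideal_pieces_def using J by blast
  qed
qed

section \<open>Translation between matrices and functions\<close>

definition entries :: "'a mat \<Rightarrow> nat \<Rightarrow> nat \<Rightarrow> 'a" where
  "entries M k l = M $$ (k, l)"

lemma supported_mat_apply: "supported r' (mat_apply A r' r x)"
  unfolding supported_def mat_apply_def by simp

lemma vec_eq_supported:
  assumes "supported n x" "supported n y"
  shows "vec n x = vec n y \<longleftrightarrow> x = y"
proof
  assume eq: "vec n x = vec n y"
  show "x = y"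
  proof
    fix l show "x l = y l"
      using arg_cong[OF eq, of "\<lambda>v. v $ l"] assms unfolding supported_def by (cases "l < n") auto
  qed
qed simp

lemma carrier_vec_supported:
  "c \<in> carrier_vec n \<longleftrightarrow> (\<exists>x. supported n x \<and> c = vec n x)"
proof
  assume "c \<in> carrier_vec n"
  then have "c = vec n (\<lambda>l. if l < n then c $ l else 0)" by auto
  moreover have "supported n (\<lambda>l. if l < n then c $ l else 0)" by (simp add: supported_def)
  ultimately show "\<exists>x. supported n x \<and> c = vec n x" by blast
qed auto

lemma mult_mat_vec_eq_mat_apply:
  assumes "M \<in> carrier_mat m n"
  shows "M *\<^sub>v vec n x = vec m (mat_apply (entries M) m n x)"
proof (rule eq_vecI)
  fix k assume "k < dim_vec (vec m (mat_apply (entries M) m n x))"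
  then show "(M *\<^sub>v vec n x) $ k = vec m (mat_apply (entries M) m n x) $ k"
    using assms by (simp add: scalar_prod_def mat_apply_def entries_def lessThan_atLeast0)
qed (use assms in simp)

lemma scalar_prod_eq_mat_apply:
  assumes "w \<in> carrier_vec n"
  shows "w \<bullet> vec n x = mat_apply (\<lambda>_ l. w $ l) 1 n x 0"
  using assms by (simp add: scalar_prod_def mat_apply_def lessThan_atLeast0)

lemma kernel_eq_image_iff:
  fixes N :: "('a, 'b::comm_ring_1) mpoly mat"
  assumes P: "\<And>x. supported n x \<Longrightarrow> P (vec n x) \<longleftrightarrow> mat_apply A r' n x = (\<lambda>_. 0)"
    and N: "N \<in> carrier_mat n s"
  shows "{c \<in> carrier_vec n. P c} = {N *\<^sub>v c | c. c \<in> carrier_vec s} \<longleftrightarrow> exact_pair A r' n (entries N) s"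
proof -
  have img: "vec n x \<in> {N *\<^sub>v c | c. c \<in> carrier_vec s} \<longleftrightarrow> (\<exists>y. supported s y \<and> x = mat_apply (entries N) n s y)"
    if x: "supported n x" for x
  proof -
    have "vec n x \<in> {N *\<^sub>v c | c. c \<in> carrier_vec s} \<longleftrightarrow> (\<exists>y. supported s y \<and> vec n x = vec n (mat_apply (entries N) n s y))"
      unfolding carrier_vec_supported mem_Collect_eq using mult_mat_vec_eq_mat_apply[OF N] by metis
    then show ?thesis using vec_eq_supported[OF x supported_mat_apply] by blast
  qed
  have eq_iff: "{c \<in> carrier_vec n. P c} = S \<longleftrightarrow> (\<forall>c\<in>carrier_vec n. P c \<longleftrightarrow> c \<in> S)" if "S \<subseteq> carrier_vec n" for S
    using that by auto
  have ball_iff: "(\<forall>c\<in>carrier_vec n. Q c) \<longleftrightarrow> (\<forall>x. supported n x \<longrightarrow> Q (vec n x))"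
    for Q :: "('a, 'b) mpoly vec \<Rightarrow> bool"
  proof
    assume "\<forall>c\<in>carrier_vec n. Q c"
    then show "\<forall>x. supported n x \<longrightarrow> Q (vec n x)" by simp
  next
    assume *: "\<forall>x. supported n x \<longrightarrow> Q (vec n x)"
    show "\<forall>c\<in>carrier_vec n. Q c"
    proof
      fix c :: "('a, 'b) mpoly vec" assume "c \<in> carrier_vec n"
      then obtain x where "supported n x" "c = vec n x" unfolding carrier_vec_supported by blast
      then show "Q c" using * by simp
    qed
  qed
  have "{c \<in> carrier_vec n. P c} = {N *\<^sub>v c | c. c \<in> carrier_vec s} \<longleftrightarrow>
    (\<forall>c\<in>carrier_vec n. P c \<longleftrightarrow> c \<in> {N *\<^sub>v c | c. c \<in> carrier_vec s})"
    by (rule eq_iff) (use N in auto)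
  also have "\<dots> \<longleftrightarrow> (\<forall>x. supported n x \<longrightarrow> (P (vec n x) \<longleftrightarrow> vec n x \<in> {N *\<^sub>v c | c. c \<in> carrier_vec s}))"
    by (rule ball_iff)
  also have "\<dots> \<longleftrightarrow> exact_pair A r' n (entries N) s"
    unfolding exact_pair_def by (intro iff_allI imp_cong refl) (simp only: P img)
  finally show ?thesis .
qed

lemma mat_apply_cong: "(\<And>k l. k < r' \<Longrightarrow> l < r \<Longrightarrow> A k l = A' k l) \<Longrightarrow> mat_apply A r' r = mat_apply A' r' r"
  unfolding mat_apply_def by (auto simp: fun_eq_iff)

lemma exact_at_above:
  fixes G :: "int \<Rightarrow> ('v::{finite,linorder}, 'k::comm_ring_1) pvec set"
  assumes "graded_submodule r G" "p > card (UNIV :: 'v set)"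
  shows "exact_at G p e"
proof (rule exact_atI)
  have "card \<sigma> \<noteq> p" for \<sigma> :: "'v set" using card_mono[of UNIV \<sigma>] assms(2) by auto
  then show "\<exists>y. (\<forall>\<sigma>. y \<sigma> \<in> G (e + int (card \<sigma>))) \<and> (\<forall>\<sigma>. card \<sigma> = p \<longrightarrow> c \<sigma> = koszul_vec y \<sigma>)" for c
    using graded_submoduleD(2)[OF assms(1)] by (intro exI[of _ "\<lambda>_ _. 0"]) simp
qed

definition row_matrix :: "'a vec \<Rightarrow> nat \<Rightarrow> nat \<Rightarrow> 'a" where
  "row_matrix w = (\<lambda>_ l. w $ l)"

text \<open>
  The maps of a resolution as one sequence, starting with the augmentation as a matrix with a single
  row.
\<close>

lemma graded_free_resolution_iff:
  fixes X :: "('v::finite \<Rightarrow> int) set" and w :: "('v, 'k::comm_ring_1) mpoly vec"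
  assumes carr: "w \<in> carrier_vec (r 0)" "\<And>i. \<phi> i \<in> carrier_mat (r i) (r (Suc i))"
    and hom: "homogeneous_matrix (row_matrix w) 1 (r 0) d" "\<And>i. homogeneous_matrix (entries (\<phi> i)) (r i) (r (Suc i)) 1"
  shows "graded_free_resolution (mon_ideal X) r (\<lambda>i l. d + int i) w \<phi> \<longleftrightarrow>
    (\<forall>e. ideal_pieces (mon_ideal X :: ('v, 'k) mpoly set) e = im_piece (row_matrix w) 1 (r 0) d e) \<and>
    (\<forall>e. ker_piece (row_matrix w) 1 (r 0) e = im_piece (entries (\<phi> 0)) (r 0) (r 1) 1 e) \<and>
    (\<forall>i e. ker_piece (entries (\<phi> i)) (r i) (r (Suc i)) e = im_piece (entries (\<phi> (Suc i))) (r (Suc i)) (r (Suc (Suc i))) 1 e)"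
proof -
  have 0: "\<forall>l<r 0. homogeneous (d + int 0) (w $ l)"
    using hom(1) unfolding homogeneous_matrix_def row_matrix_def by simp
  have 1: "\<forall>i. \<forall>k<r i. \<forall>l<r (Suc i). homogeneous (d + int (Suc i) - (d + int i)) (\<phi> i $$ (k, l))"
    using hom(2) unfolding homogeneous_matrix_def entries_def by simp
  have J: "{w \<bullet> c | c. c \<in> carrier_vec (r 0)} = mon_ideal X \<longleftrightarrow>
      (\<forall>e. ideal_pieces (mon_ideal X) e = im_piece (row_matrix w) 1 (r 0) d e)"
  proof -
    have "f \<in> {w \<bullet> c | c. c \<in> carrier_vec (r 0)} \<longleftrightarrow> (\<exists>x. supported (r 0) x \<and> f = mat_apply (row_matrix w) 1 (r 0) x 0)" for f
      unfolding carrier_vec_supported mem_Collect_eq row_matrix_def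
      using scalar_prod_eq_mat_apply[OF carr(1)] by metis
    then show ?thesis unfolding ideal_eq_image_iff[OF hom(1)] by blast
  qed
  have K0: "{c \<in> carrier_vec (r 0). w \<bullet> c = 0} = {\<phi> 0 *\<^sub>v c | c. c \<in> carrier_vec (r 1)} \<longleftrightarrow>
      (\<forall>e. ker_piece (row_matrix w) 1 (r 0) e = im_piece (entries (\<phi> 0)) (r 0) (r 1) 1 e)"
  proof -
    have "(w \<bullet> vec (r 0) x = 0) \<longleftrightarrow> mat_apply (row_matrix w) 1 (r 0) x = (\<lambda>_. 0)" for x
    proof -
      have "mat_apply (row_matrix w) 1 (r 0) x k = 0" if "k \<noteq> 0" for k using that by (simp add: mat_apply_def)
      then have "mat_apply (row_matrix w) 1 (r 0) x = (\<lambda>_. 0) \<longleftrightarrow> mat_apply (row_matrix w) 1 (r 0) x 0 = 0" by (metis ext)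
      then show ?thesis unfolding scalar_prod_eq_mat_apply[OF carr(1)] row_matrix_def by simp
    qed
    then have "{c \<in> carrier_vec (r 0). w \<bullet> c = 0} = {\<phi> 0 *\<^sub>v c | c. c \<in> carrier_vec (r 1)} \<longleftrightarrow>
        exact_pair (row_matrix w) 1 (r 0) (entries (\<phi> 0)) (r 1)"
      using carr(2)[of 0] by (intro kernel_eq_image_iff) auto
    then show ?thesis using exact_pair_iff[OF hom(1), of "entries (\<phi> 0)" "r 1" 1] hom(2)[of 0] by simp
  qed
  have K: "{c \<in> carrier_vec (r (Suc i)). \<phi> i *\<^sub>v c = 0\<^sub>v (r i)} = {\<phi> (Suc i) *\<^sub>v c | c. c \<in> carrier_vec (r (Suc (Suc i)))} \<longleftrightarrow>
      (\<forall>e. ker_piece (entries (\<phi> i)) (r i) (r (Suc i)) e = im_piece (entries (\<phi> (Suc i))) (r (Suc i)) (r (Suc (Suc i))) 1 e)" for i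
  proof -
    have "(\<phi> i *\<^sub>v vec (r (Suc i)) x = 0\<^sub>v (r i)) \<longleftrightarrow> mat_apply (entries (\<phi> i)) (r i) (r (Suc i)) x = (\<lambda>_. 0)" for x
    proof -
      have "0\<^sub>v (r i) = vec (r i) (\<lambda>_. 0 :: ('v, 'k) mpoly)" by (simp add: zero_vec_def)
      moreover have "supported (r i) (\<lambda>_. 0 :: ('v, 'k) mpoly)" by (simp add: supported_def)
      ultimately show ?thesis
        unfolding mult_mat_vec_eq_mat_apply[OF carr(2)] by (simp add: vec_eq_supported supported_mat_apply)
    qed
    then have "{c \<in> carrier_vec (r (Suc i)). \<phi> i *\<^sub>v c = 0\<^sub>v (r i)} = {\<phi> (Suc i) *\<^sub>v c | c. c \<in> carrier_vec (r (Suc (Suc i)))} \<longleftrightarrow>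
        exact_pair (entries (\<phi> i)) (r i) (r (Suc i)) (entries (\<phi> (Suc i))) (r (Suc (Suc i)))"
      by (intro kernel_eq_image_iff carr(2))
    then show ?thesis using exact_pair_iff[OF hom(2) hom(2)] by simp
  qed
  show ?thesis unfolding graded_free_resolution_def J K0 K by (simp only: carr eqTrueI[OF 0] eqTrueI[OF 1] simp_thms)
qed

text \<open>Dimension shifting: exactness for one image at \<open>p\<close> follows from exactness
  for the next image at \<open>Suc p\<close>, and above the number of variables there is nothing to
  show. The descent is on \<open>p\<close>, so the length of the resolution does not matter.\<close>

lemma exact_at_if_resolution:
  fixes X :: "('v::{finite,linorder} \<Rightarrow> int) set" and w :: "('v, 'k::comm_ring_1) mpoly vec"
  assumes res: "graded_free_resolution (mon_ideal X) r (\<lambda>i l. d + int i) w \<phi>" and "int p + e \<noteq> d"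
  shows "exact_at (ideal_pieces (mon_ideal X :: ('v, 'k) mpoly set)) p e"
proof -
  note R = res[unfolded graded_free_resolution_def]
  have carr: "w \<in> carrier_vec (r 0)" "\<And>i. \<phi> i \<in> carrier_mat (r i) (r (Suc i))"
    using R[THEN conjunct1] R[THEN conjunct2, THEN conjunct2, THEN conjunct1] by simp_all
  have hom_w: "\<forall>l<r 0. homogeneous (d + int 0) (w $ l)"
    by (rule R[THEN conjunct2, THEN conjunct1])
  have hom_\<phi>: "\<forall>i. \<forall>k<r i. \<forall>l<r (Suc i). homogeneous (d + int (Suc i) - (d + int i)) (\<phi> i $$ (k, l))"
    by (rule R[THEN conjunct2, THEN conjunct2, THEN conjunct2, THEN conjunct1])
  have "homogeneous d (w $ l)" if "l < r 0" for l
    using hom_w that by simp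
  then have hom0: "homogeneous_matrix (row_matrix w) 1 (r 0) d"
    unfolding homogeneous_matrix_def row_matrix_def by blast
  have "homogeneous 1 (\<phi> i $$ (k, l))" if "k < r i" "l < r (Suc i)" for i k l
  proof -
    have "homogeneous (d + int (Suc i) - (d + int i)) (\<phi> i $$ (k, l))"
      using hom_\<phi> that by blast
    then show ?thesis by simp
  qed
  then have hom: "homogeneous_matrix (entries (\<phi> i)) (r i) (r (Suc i)) 1" for i
    unfolding homogeneous_matrix_def entries_def by blast
  note pieces = res[unfolded graded_free_resolution_iff[OF carr hom0 hom]]
  have main: "\<forall>i e. int p + e \<noteq> 1 \<longrightarrow> exact_at (im_piece (entries (\<phi> i)) (r i) (r (Suc i)) 1) p e" for p
  proof (induction "Suc (card (UNIV :: 'v set)) - p" arbitrary: p)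
    case 0
    then show ?case using exact_at_above[OF graded_submodule_im[OF hom]] by simp
  next
    case (Suc k)
    have IH: "\<forall>i e. int (Suc p) + e \<noteq> 1 \<longrightarrow> exact_at (im_piece (entries (\<phi> i)) (r i) (r (Suc i)) 1) (Suc p) e"
      by (rule Suc(1)) (use Suc(2) in linarith)
    show ?case
    proof (intro allI impI)
      fix i and e :: int assume ne: "int p + e \<noteq> 1"
      have eq: "ker_piece (entries (\<phi> i)) (r i) (r (Suc i)) = im_piece (entries (\<phi> (Suc i))) (r (Suc i)) (r (Suc (Suc i))) 1"
        using pieces by blast
      show "exact_at (im_piece (entries (\<phi> i)) (r i) (r (Suc i)) 1) p e"
        by (rule exact_im_if_exact_ker[OF hom]) (use IH ne in \<open>simp_all add: eq\<close>)
    qed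
  qed
  have "ker_piece (row_matrix w) 1 (r 0) = im_piece (entries (\<phi> 0)) (r 0) (r 1) 1" using pieces by blast
  then have "exact_at (ker_piece (row_matrix w) 1 (r 0)) (Suc p) (e - d)"
    using main[of "Suc p"] assms(2) by simp
  then have "exact_at (im_piece (row_matrix w) 1 (r 0) d) p e"
    by (rule exact_im_if_exact_ker[OF hom0]) (rule assms(2))
  moreover have "ideal_pieces (mon_ideal X) = im_piece (row_matrix w) 1 (r 0) d" using pieces by blast
  ultimately show ?thesis by simp
qed

text \<open>Each presentation step leaves a kernel of the same kind, so the steps are chained by
  dependent choice. A state is a matrix together with its numbers of rows and columns.\<close>

lemma resolution_if_exact_at:
  fixes X :: "('v::{finite,linorder} \<Rightarrow> int) set"
  assumes up: "up_exps X"
    and exact: "\<And>p e. int p + e \<noteq> d \<Longrightarrow> exact_at (ideal_pieces (mon_ideal X :: ('v, 'k::field) mpoly set)) p e"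
  shows "has_linear_free_resolution (mon_ideal X :: ('v, 'k) mpoly set)"
proof -
  let ?J = "mon_ideal X :: ('v, 'k) mpoly set"
  \<comment> \<open>The invariant: entries of degree \<open>d\<close> in the first matrix and of
    degree 1 in all later ones, and a kernel fit for the next step.\<close>
  define P where "P i x = (case x of (m, r, A) \<Rightarrow>
      homogeneous_matrix A m r (if i = 0 then d else 1) \<and>
      (\<forall>p e. int p + e \<noteq> 1 \<longrightarrow> exact_at (ker_piece A m r) p e) \<and>
      (i = 0 \<longrightarrow> m = 1 \<and> (\<forall>e. ideal_pieces ?J e = im_piece A 1 r d e)))"
    for i :: nat and x :: "nat \<times> nat \<times> (nat \<Rightarrow> nat \<Rightarrow> ('v, 'k) mpoly)"
  define Q where "Q x y = (case x of (m, r, A) \<Rightarrow> case y of (m', r', A') \<Rightarrow>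
      m' = r \<and> (\<forall>e. ker_piece A m r e = im_piece A' r r' 1 e))"
    for x y :: "nat \<times> nat \<times> (nat \<Rightarrow> nat \<Rightarrow> ('v, 'k) mpoly)"
  have "\<exists>x. P 0 x"
  proof -
    obtain r A where "homogeneous_matrix A 1 r d" "\<And>e. ideal_pieces ?J e = im_piece A 1 r d e"
      "\<And>p e. int p + e \<noteq> 1 \<Longrightarrow> exact_at (ker_piece A 1 r) p e"
      using linear_presentation_step[OF graded_submodule_ideal[OF up] exact] by metis
    then have "P 0 (1, r, A)" unfolding P_def by simp
    then show ?thesis by blast
  qed
  moreover have "\<exists>y. P (Suc i) y \<and> Q x y" if x: "P i x" for i x
  proof -
    obtain m r A where x': "x = (m, r, A)" by (cases x)
    have hom: "homogeneous_matrix A m r (if i = 0 then d else 1)"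
      and ex: "\<And>p e. int p + e \<noteq> 1 \<Longrightarrow> exact_at (ker_piece A m r) p e"
      using x unfolding P_def x' by auto
    obtain r' A' where "homogeneous_matrix A' r r' 1" "\<And>e. ker_piece A m r e = im_piece A' r r' 1 e"
      "\<And>p e. int p + e \<noteq> 1 \<Longrightarrow> exact_at (ker_piece A' r r') p e"
      using linear_presentation_step[OF graded_submodule_ker[OF hom] ex] by metis
    then have "P (Suc i) (r, r', A')" "Q x (r, r', A')" unfolding P_def Q_def x' by simp_all
    then show ?thesis by blast
  qed
  ultimately obtain F where F: "\<And>i. P i (F i)" "\<And>i. Q (F i) (F (Suc i))"
    using dependent_nat_choice[of P "\<lambda>_. Q"] by metis
  define R where "R i = fst (snd (F i))" for i
  define M where "M i = snd (snd (F i))" for i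
  have Fi: "F i = (fst (F i), R i, M i)" for i by (simp add: R_def M_def)
  have rows: "fst (F 0) = 1" "fst (F (Suc i)) = R i" for i
    using F(1)[of 0] F(2)[of i] unfolding P_def Q_def by (auto simp: R_def split: prod.splits)
  have P0: "homogeneous_matrix (M 0) 1 (R 0) d" "\<And>e. ideal_pieces ?J e = im_piece (M 0) 1 (R 0) d e"
    using F(1)[of 0] rows(1) unfolding P_def by (auto simp: R_def M_def split: prod.splits)
  have PS: "homogeneous_matrix (M (Suc i)) (R i) (R (Suc i)) 1" for i
    using F(1)[of "Suc i"] rows(2)[of i] unfolding P_def by (auto simp: R_def M_def split: prod.splits)
  have Q0: "ker_piece (M 0) 1 (R 0) e = im_piece (M 1) (R 0) (R 1) 1 e" for e
    using F(2)[of 0] rows(1) unfolding Q_def by (auto simp: R_def M_def split: prod.splits)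
  have QS: "ker_piece (M (Suc i)) (R i) (R (Suc i)) e = im_piece (M (Suc (Suc i))) (R (Suc i)) (R (Suc (Suc i))) 1 e" for i e
    using F(2)[of "Suc i"] rows(2)[of i] unfolding Q_def by (auto simp: R_def M_def split: prod.splits)
  define w where "w = vec (R 0) (M 0 0)"
  define \<phi> where "\<phi> i = mat (R i) (R (Suc i)) (\<lambda>(k, l). M (Suc i) k l)" for i
  have app0: "mat_apply (row_matrix w) 1 (R 0) = mat_apply (M 0) 1 (R 0)"
    by (rule mat_apply_cong) (simp add: row_matrix_def w_def)
  have appS: "mat_apply (entries (\<phi> i)) (R i) (R (Suc i)) = mat_apply (M (Suc i)) (R i) (R (Suc i))" for i
    by (rule mat_apply_cong) (simp add: entries_def \<phi>_def)
  have app1: "mat_apply (entries (\<phi> 0)) (R 0) (R 1) = mat_apply (M 1) (R 0) (R 1)" using appS[of 0] by simp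
  have hom0: "homogeneous_matrix (row_matrix w) 1 (R 0) d"
    using P0(1) unfolding homogeneous_matrix_def by (simp add: row_matrix_def w_def)
  have homS: "homogeneous_matrix (entries (\<phi> i)) (R i) (R (Suc i)) 1" for i
    using PS[of i] unfolding homogeneous_matrix_def by (simp add: entries_def \<phi>_def)
  have "graded_free_resolution ?J R (\<lambda>i l. d + int i) w \<phi>"
  proof (subst graded_free_resolution_iff)
    show "(\<forall>e. ideal_pieces ?J e = im_piece (row_matrix w) 1 (R 0) d e) \<and>
      (\<forall>e. ker_piece (row_matrix w) 1 (R 0) e = im_piece (entries (\<phi> 0)) (R 0) (R 1) 1 e) \<and>
      (\<forall>i e. ker_piece (entries (\<phi> i)) (R i) (R (Suc i)) e = im_piece (entries (\<phi> (Suc i))) (R (Suc i)) (R (Suc (Suc i))) 1 e)"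
      using P0(2) Q0 QS unfolding ker_piece_def im_piece_def app0 appS app1 by blast
  qed (rule hom0 homS | simp add: w_def \<phi>_def)+
  then show ?thesis unfolding has_linear_free_resolution_def by blast
qed

theorem has_linear_free_resolution_iff:
  fixes X :: "('v::{finite,linorder} \<Rightarrow> int) set"
  assumes "up_exps X"
  shows "has_linear_free_resolution (mon_ideal X :: ('v, 'k::field) mpoly set) \<longleftrightarrow>
    (\<exists>d. \<forall>p e. int p + e \<noteq> d \<longrightarrow> exact_at (ideal_pieces (mon_ideal X :: ('v, 'k) mpoly set)) p e)"
  using exact_at_if_resolution resolution_if_exact_at[OF assms]
  unfolding has_linear_free_resolution_def by metis

lemma exact_at_ideal_if_vanishes:
  fixes X :: "('v::{finite,linorder} \<Rightarrow> int) set"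
  assumes nonneg: "\<And>u v. u \<in> X \<Longrightarrow> 0 \<le> u v"
    and van: "\<And>a. sum a UNIV = e \<Longrightarrow> (\<And>v. - 1 \<le> a v) \<Longrightarrow>
      vanishes TYPE('k::comm_ring_1) (box X a (\<lambda>v. a v + 1)) p"
  shows "exact_at (ideal_pieces (mon_ideal X :: ('v, 'k) mpoly set)) p e"
proof (rule exact_atI)
  fix c :: "'v set \<Rightarrow> ('v, 'k) pvec"
  assume c: "\<And>\<sigma>. c \<sigma> \<in> ideal_pieces (mon_ideal X) (e + int (card \<sigma>))"
    and cyc: "\<And>\<tau>. card \<tau> = Suc p \<Longrightarrow> koszul_vec c \<tau> = (\<lambda>_. 0)"
  have "\<exists>y. (\<forall>\<sigma>. y \<sigma> \<in> mon_ideal X \<and> homogeneous (e + int (card \<sigma>)) (y \<sigma>)) \<and>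
    (\<forall>\<sigma>. card \<sigma> = p \<longrightarrow> c \<sigma> 0 = koszul_diff var y \<sigma>)"
  proof (rule koszul_exact_if_vanishes[where X = X])
    fix u v assume "u \<in> X"
    then show "0 \<le> u v" by (rule nonneg)
  next
    fix a :: "'v \<Rightarrow> int" assume "sum a UNIV = e" "\<And>v. - 1 \<le> a v"
    then show "vanishes TYPE('k) (box X a (\<lambda>v. a v + 1)) p" by (rule van)
  next
    fix \<sigma>
    show "c \<sigma> 0 \<in> mon_ideal X" "homogeneous (e + int (card \<sigma>)) (c \<sigma> 0)"
      using c[of \<sigma>] unfolding ideal_pieces_def free_piece_def by blast+
  next
    fix \<tau> :: "'v set" assume "card \<tau> = Suc p"
    then show "koszul_diff var (\<lambda>\<sigma>. c \<sigma> 0) \<tau> = 0" using fun_cong[OF cyc, of \<tau> 0] by (simp add: koszul_vec_def)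
  qed
  then obtain y where y: "\<And>\<sigma>. y \<sigma> \<in> mon_ideal X" "\<And>\<sigma>. homogeneous (e + int (card \<sigma>)) (y \<sigma>)"
    "\<And>\<sigma>. card \<sigma> = p \<Longrightarrow> c \<sigma> 0 = koszul_diff var y \<sigma>" by blast
  define z where "z \<sigma> l = (if l = 0 then y \<sigma> else 0)" for \<sigma> and l :: nat
  have "z \<sigma> \<in> ideal_pieces (mon_ideal X) (e + int (card \<sigma>))" for \<sigma>
    unfolding ideal_pieces_def free_piece_def using y(1,2) by (simp add: z_def)
  moreover have "c \<sigma> = koszul_vec z \<sigma>" if "card \<sigma> = p" for \<sigma>
  proof
    fix l show "c \<sigma> l = koszul_vec z \<sigma> l"
    proof (cases "l = 0")
      case True
      then show ?thesis using y(3)[OF that] by (simp add: koszul_vec_def z_def)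
    next
      case False
      then have "c \<sigma> l = 0" using c[of \<sigma>] unfolding ideal_pieces_def free_piece_def by auto
      then show ?thesis using False by (simp add: koszul_vec_def z_def koszul_diff_def)
    qed
  qed
  ultimately show "\<exists>y. (\<forall>\<sigma>. y \<sigma> \<in> ideal_pieces (mon_ideal X) (e + int (card \<sigma>))) \<and> (\<forall>\<sigma>. card \<sigma> = p \<longrightarrow> c \<sigma> = koszul_vec y \<sigma>)"
    by blast
qed

lemma vanishes_if_exact_at_ideal:
  fixes X :: "('v::{finite,linorder} \<Rightarrow> int) set"
  assumes nonneg: "\<And>u v. u \<in> X \<Longrightarrow> 0 \<le> u v"
    and exact: "exact_at (ideal_pieces (mon_ideal X :: ('v, 'k::comm_ring_1) mpoly set)) p (sum a UNIV)"
  shows "vanishes TYPE('k) (box X a (\<lambda>v. a v + 1)) p"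
proof (rule vanishes_if_koszul_exact[where X = X])
  fix u v assume "u \<in> X"
  then show "0 \<le> u v" by (rule nonneg)
next
  fix c :: "'v set \<Rightarrow> ('v, 'k) mpoly"
  assume c: "\<And>\<sigma>. c \<sigma> \<in> mon_ideal X" "\<And>\<sigma>. homogeneous (sum a UNIV + int (card \<sigma>)) (c \<sigma>)"
    and cyc: "\<And>\<tau>. card \<tau> = Suc p \<Longrightarrow> koszul_diff var c \<tau> = 0"
  define z where "z \<sigma> l = (if l = 0 then c \<sigma> else 0)" for \<sigma> and l :: nat
  have z: "z \<sigma> \<in> ideal_pieces (mon_ideal X) (sum a UNIV + int (card \<sigma>))" for \<sigma>
    unfolding ideal_pieces_def free_piece_def using c by (simp add: z_def)
  have "koszul_vec z \<tau> = (\<lambda>_. 0)" if "card \<tau> = Suc p" for \<tau>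
  proof
    fix l show "koszul_vec z \<tau> l = 0"
      using cyc[OF that] by (cases "l = 0") (simp_all add: koszul_vec_def z_def koszul_diff_def)
  qed
  then obtain y where y: "\<And>\<sigma>. y \<sigma> \<in> ideal_pieces (mon_ideal X) (sum a UNIV + int (card \<sigma>))"
    "\<And>\<sigma>. card \<sigma> = p \<Longrightarrow> z \<sigma> = koszul_vec y \<sigma>"
    by (rule exact_atE[OF exact z _ that])
  show "\<exists>y. (\<forall>\<sigma>. y \<sigma> \<in> mon_ideal X) \<and> (\<forall>\<sigma>. card \<sigma> = p \<longrightarrow> c \<sigma> = koszul_diff var y \<sigma>)"
  proof (intro exI[of _ "\<lambda>\<sigma>. y \<sigma> 0"] conjI allI impI)
    show "y \<sigma> 0 \<in> mon_ideal X" for \<sigma> using y(1)[of \<sigma>] unfolding ideal_pieces_def by blast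
    show "c \<sigma> = koszul_diff var (\<lambda>\<sigma>. y \<sigma> 0) \<sigma>" if "card \<sigma> = p" for \<sigma>
      using fun_cong[OF y(2)[OF that], of 0] by (simp add: z_def koszul_vec_def)
  qed
qed

section \<open>Linear resolutions of powers and the final equivalence\<close>

lemma sum_power_exps_ge:
  fixes u :: "'v::finite \<Rightarrow> int"
  assumes "u \<in> power_exps adj s"
  shows "2 * int s \<le> sum u UNIV"
proof -
  obtain occ where le: "\<And>v. int (card {k. k < 2 * s \<and> occ k = v}) \<le> u v"
    using assms unfolding power_exps_def by blast
  have "{..<2 * s} = (\<Union>v. {k. k < 2 * s \<and> occ k = v})" by auto
  then have "2 * s = card (\<Union>v. {k. k < 2 * s \<and> occ k = v})" by (metis card_lessThan)
  also have "\<dots> = (\<Sum>v\<in>UNIV. card {k. k < 2 * s \<and> occ k = v})"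
    by (rule card_UN_disjoint) auto
  finally have "2 * int s = (\<Sum>v\<in>UNIV. int (card {k. k < 2 * s \<and> occ k = v}))"
    by (metis of_nat_mult of_nat_numeral of_nat_sum)
  also have "\<dots> \<le> sum u UNIV" by (rule sum_mono) (rule le)
  finally show ?thesis .
qed

lemma power_exps_minimal:
  fixes adj :: "'v::finite \<Rightarrow> 'v \<Rightarrow> bool"
  assumes "adj x y"
  shows "\<exists>u\<in>power_exps adj s. sum u UNIV = 2 * int s"
proof (induction s)
  case 0
  show ?case by (intro bexI[of _ "\<lambda>_. 0"]) (simp_all add: power_exps_0)
next
  case (Suc s)
  then obtain u where u: "u \<in> power_exps adj s" "sum u UNIV = 2 * int s" by blast
  define w where "w v = (if v = x then 1 else 0) + (if v = y then 1 else 0 :: int)" for v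
  have "w \<in> power_exps adj 1" by (rule pair_in_power_exps_1[where adj = adj, OF assms]) (simp add: w_def)
  then have "(\<lambda>v. w v + u v) \<in> power_exps adj (Suc s)"
    unfolding power_exps_Suc using u(1) by (intro bexI[of _ w] bexI[of _ u]) simp_all
  moreover have "(\<Sum>v\<in>UNIV. w v + u v) = 2 * int (Suc s)" using u(2) by (simp add: sum.distrib w_def)
  ultimately show ?case by blast
qed

text \<open>A linear resolution singles out one total degree, which has to be \<open>2 * s\<close>:
  a minimal monomial gives a class there. Below it nothing lives, as all monomials have degree at
  least \<open>2 * s\<close>, so only larger total degrees impose a condition.\<close>

lemma linear_resolution_power_iff:
  fixes adj :: "'v::{finite,linorder} \<Rightarrow> 'v \<Rightarrow> bool"
  assumes edge: "adj x0 y0"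
  shows "has_linear_free_resolution (mon_ideal (power_exps adj s) :: ('v, 'k::field) mpoly set) \<longleftrightarrow>
    (\<forall>a p. (\<forall>v. - 1 \<le> a v) \<and> int p + sum a UNIV > 2 * int s \<longrightarrow>
      vanishes TYPE('k) (box (power_exps adj s) a (\<lambda>v. a v + 1)) p)" (is "?L \<longleftrightarrow> ?R")
proof -
  let ?X = "power_exps adj s" and ?n = "card (UNIV :: 'v set)"
  note iff = has_linear_free_resolution_iff[OF up_exps_power_exps[of adj s], where 'k = 'k]
  show ?thesis
  proof
    assume ?L
    then obtain d where d: "\<And>p e. int p + e \<noteq> d \<Longrightarrow> exact_at (ideal_pieces (mon_ideal ?X :: ('v, 'k) mpoly set)) p e"
      unfolding iff by blast
    have van: "vanishes TYPE('k) (box ?X a (\<lambda>v. a v + 1)) p" if "int p + sum a UNIV \<noteq> d" for a p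
      by (rule vanishes_if_exact_at_ideal) (erule power_exps_nonneg, rule d[OF that])
    have "d = 2 * int s"
    proof (rule ccontr)
      assume ne: "d \<noteq> 2 * int s"
      obtain u where u: "u \<in> ?X" "sum u UNIV = 2 * int s" using power_exps_minimal[of adj, OF edge] by blast
      \<comment> \<open>Subtracting 1 everywhere from a minimal exponent leaves \<open>UNIV\<close>
        as the only set in the box, and a cochain there is not a coboundary unless it is
        zero.\<close>
      define a where "a v = u v - 1" for v
      have suma: "sum a UNIV = 2 * int s - int ?n" unfolding a_def by (simp add: sum_subtractf u(2))
      have mem: "\<sigma> \<in> box ?X a (\<lambda>v. a v + 1) \<Longrightarrow> card \<sigma> \<ge> ?n" for \<sigma>
        using sum_power_exps_ge[of "shift_exps 1 \<sigma> a" adj s] suma unfolding box_succ_iff by (simp add: sum_shift_exps)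
      have top: "UNIV \<in> box ?X a (\<lambda>v. a v + 1)" unfolding box_def a_def using u(1) by simp
      define f :: "'v set \<Rightarrow> 'k" where "f \<sigma> = (if \<sigma> = UNIV then 1 else 0)" for \<sigma>
      have none: "card \<tau> \<noteq> Suc ?n" for \<tau> :: "'v set" using card_mono[of UNIV \<tau>] by auto
      have vn: "vanishes TYPE('k) (box ?X a (\<lambda>v. a v + 1)) ?n" by (rule van) (use suma ne in simp)
      obtain g where g: "\<And>\<sigma>. \<sigma> \<notin> box ?X a (\<lambda>v. a v + 1) \<Longrightarrow> g \<sigma> = 0" "\<And>\<sigma>. card \<sigma> = ?n \<Longrightarrow> f \<sigma> = koszul_diff (\<lambda>_. 1) g \<sigma>"
        by (rule vanishesE[OF vn, of f]) (use top none in \<open>auto simp: f_def\<close>)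
      have "card (UNIV - {x}) < ?n" for x :: 'v by (intro psubset_card_mono) auto
      then have "g (UNIV - {x}) = 0" for x using mem[of "UNIV - {x}"] g(1)[of "UNIV - {x}"] by (meson not_le)
      then have "koszul_diff (\<lambda>_. 1) g UNIV = 0" by (simp add: koszul_diff_def)
      then show False using g(2)[of UNIV] by (simp add: f_def)
    qed
    then show ?R using van by simp
  next
    assume R: ?R
    have "exact_at (ideal_pieces (mon_ideal ?X :: ('v, 'k) mpoly set)) p e" if ne: "int p + e \<noteq> 2 * int s" for p e
    proof (rule exact_at_ideal_if_vanishes)
      fix u v assume "u \<in> ?X"
      then show "0 \<le> u v" by (rule power_exps_nonneg)
    next
      fix a :: "'v \<Rightarrow> int" assume a: "sum a UNIV = e" "\<And>v. - 1 \<le> a v"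
      show "vanishes TYPE('k) (box ?X a (\<lambda>v. a v + 1)) p"
      proof (cases "int p + e > 2 * int s")
        case True
        then show ?thesis using R a by blast
      next
        case False
        show ?thesis
        proof (rule vanishes_if_none)
          fix \<sigma> assume "\<sigma> \<in> box ?X a (\<lambda>v. a v + 1)"
          then have "2 * int s \<le> e + int (card \<sigma>)"
            using sum_power_exps_ge[of "shift_exps 1 \<sigma> a" adj s] a(1) unfolding box_succ_iff by (simp add: sum_shift_exps)
          then show "card \<sigma> \<noteq> p" using False ne by auto
        qed
      qed
    qed
    then show ?L unfolding iff by blast
  qed
qed

text \<open>The two passages between kinds of boxes, combined. The threshold \<open>b\<close> is
  free so that \<open>3 \<le> B\<close> can be imposed later; a \<open>B\<close> with
  \<open>a v + 1 \<le> B\<close> for all \<open>v\<close> exists as there are finitely many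
  variables.\<close>

lemma vanishes_koszul_iff_cech:
  fixes X :: "('v::{finite,linorder} \<Rightarrow> int) set"
  assumes up: "up_exps X"
  shows "(\<forall>a p. (\<forall>v. - 1 \<le> a v) \<and> int p + sum a UNIV > r \<longrightarrow>
      vanishes TYPE('k::comm_ring_1) (box X a (\<lambda>v. a v + 1)) p) \<longleftrightarrow>
    (\<forall>a B p. (\<forall>v. - 1 \<le> a v \<and> a v \<le> B) \<and> b \<le> B \<and> int p + sum a UNIV > r \<longrightarrow>
      vanishes TYPE('k) (box X a (\<lambda>_. B)) p)" (is "?K \<longleftrightarrow> ?C")
proof (intro iffI allI impI; elim conjE)
  fix a :: "'v \<Rightarrow> int" and B :: int and p
  assume K: ?K and a: "\<forall>v. - 1 \<le> a v \<and> a v \<le> B" "int p + sum a UNIV > r"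
  show "vanishes TYPE('k) (box X a (\<lambda>_. B)) p"
  proof (rule vanishes_box_if_vanishes_koszul[OF up _ _ a(2)])
    fix lo :: "'v \<Rightarrow> int" and q assume "\<And>v. - 1 \<le> lo v" "int q + sum lo UNIV > r"
    then show "vanishes TYPE('k) (box X lo (\<lambda>v. lo v + 1)) q" using K[rule_format, of lo q] by simp
  next
    show "- 1 \<le> a v \<and> a v \<le> B" for v using a(1) by simp
  qed
next
  fix a :: "'v \<Rightarrow> int" and p
  assume C: ?C and a: "\<forall>v. - 1 \<le> a v" "int p + sum a UNIV > r"
  define B where "B = max b (Max (range a) + 1)"
  have le: "a v + 1 \<le> B" for v unfolding B_def by (simp add: le_max_iff_disj)
  have b: "b \<le> B" unfolding B_def by simp
  show "vanishes TYPE('k) (box X a (\<lambda>v. a v + 1)) p"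
  proof (rule vanishes_box_if_vanishes_cech[OF up _ _ a(2)])
    fix lo :: "'v \<Rightarrow> int" and q assume lo: "\<And>v. - 1 \<le> lo v \<and> lo v < B" "int q + sum lo UNIV > r"
    have "- 1 \<le> lo v \<and> lo v \<le> B" for v using lo(1)[of v] by simp
    then show "vanishes TYPE('k) (box X lo (\<lambda>_. B)) q" using C[rule_format, of lo B q] b lo(2) by simp
  next
    show "- 1 \<le> a v \<and> a v \<le> a v + 1 \<and> a v + 1 \<le> B" for v using a(1) le[of v] by simp
  qed
qed

text \<open>An edge inside the union of two disjoint edges is one of them or joins them, and for
  edges sharing a vertex the right-hand side holds by itself; so no distinctness is stated.\<close>

lemma gap_free_iff:
  assumes G: "simple_graph E"
  shows "gap_free E \<longleftrightarrow> (\<forall>a b c d. {a, b} \<in> E \<longrightarrow> {c, d} \<in> E \<longrightarrow>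
    {a, c} \<in> E \<or> {a, d} \<in> E \<or> {b, c} \<in> E \<or> {b, d} \<in> E)"
proof
  assume gf: "gap_free E"
  show "\<forall>a b c d. {a, b} \<in> E \<longrightarrow> {c, d} \<in> E \<longrightarrow> {a, c} \<in> E \<or> {a, d} \<in> E \<or> {b, c} \<in> E \<or> {b, d} \<in> E"
  proof (intro allI impI, rule ccontr)
    fix a b c d assume e: "{a, b} \<in> E" "{c, d} \<in> E" and no: "\<not> ({a, c} \<in> E \<or> {a, d} \<in> E \<or> {b, c} \<in> E \<or> {b, d} \<in> E)"
    have disj: "{a, b} \<inter> {c, d} = {}" using e no by (auto simp: insert_commute)
    have "h = {a, b} \<or> h = {c, d}" if h: "h \<in> E" "h \<subseteq> {a, b} \<union> {c, d}" for h
    proof -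
      have "card h = 2" using h(1) G unfolding simple_graph_def by blast
      then obtain x y where xy: "h = {x, y}" "x \<noteq> y" unfolding card_2_iff by blast
      then have "x \<in> {a, b, c, d}" "y \<in> {a, b, c, d}" using h(2) by auto
      then show ?thesis using xy h(1) no by (elim insertE emptyE) (simp_all add: insert_commute)
    qed
    then have "{h \<in> E. h \<subseteq> {a, b} \<union> {c, d}} = {{a, b}, {c, d}}" using e by blast
    then have "is_gap E {a, b} {c, d}" using e disj unfolding is_gap_def by blast
    then show False using gf unfolding gap_free_def by blast
  qed
next
  assume *: "\<forall>a b c d. {a, b} \<in> E \<longrightarrow> {c, d} \<in> E \<longrightarrow> {a, c} \<in> E \<or> {a, d} \<in> E \<or> {b, c} \<in> E \<or> {b, d} \<in> E"
  show "gap_free E" unfolding gap_free_def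
  proof
    assume "\<exists>e e'. is_gap E e e'"
    then obtain e e' where "is_gap E e e'" by (elim exE)
    then have gap: "e \<in> E" "e' \<in> E" "e \<inter> e' = {}" "{h \<in> E. h \<subseteq> e \<union> e'} = {e, e'}"
      unfolding is_gap_def by simp_all
    have "card e = 2" "card e' = 2" using gap(1,2) G unfolding simple_graph_def by simp_all
    then obtain a b c d where abcd: "e = {a, b}" "e' = {c, d}" unfolding card_2_iff by metis
    have no: "{x, y} \<notin> E" if xy: "x \<in> e" "y \<in> e'" for x y
    proof
      assume "{x, y} \<in> E"
      then have "{x, y} \<in> {h \<in> E. h \<subseteq> e \<union> e'}" using xy by simp
      then have "{x, y} = e \<or> {x, y} = e'" unfolding gap(4) by simp
      then show False using xy gap(3) by auto
    qed
    have "{a, c} \<in> E \<or> {a, d} \<in> E \<or> {b, c} \<in> E \<or> {b, d} \<in> E"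
      using *[rule_format, of a b c d] gap(1,2) unfolding abcd by simp
    then show False using no unfolding abcd by simp
  qed
qed

theorem theorem1p2:
  fixes E :: "'v::{finite,linorder} set set"
  assumes "simple_graph E" and "E \<noteq> {}"
  shows "has_linear_free_resolution (ideal_power (edge_ideal E :: ('v, 'k::field) mpoly set) 3) \<longleftrightarrow>
         gap_free E \<and> ideal_reg (edge_ideal E :: ('v, 'k) mpoly set) \<le> 4"
proof -
  define adj where "adj x y \<longleftrightarrow> {x, y} \<in> E" for x y
  have adj': "(\<lambda>x y. {x, y} \<in> E) = adj" by (intro ext) (simp add: adj_def)
  have sym: "adj x y \<Longrightarrow> adj y x" for x y unfolding adj_def by (simp add: insert_commute)
  have irrefl: "\<not> adj x x" for x
  proof
    assume "adj x x"
    then have "card {x, x} = 2" using assms(1) unfolding adj_def simple_graph_def by blast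
    then show False by simp
  qed
  obtain h where "h \<in> E" using assms(2) by blast
  moreover from this have "card h = 2" using assms(1) unfolding simple_graph_def by blast
  ultimately obtain x0 y0 where edge: "adj x0 y0" unfolding card_2_iff adj_def by blast
  have K: "has_linear_free_resolution (ideal_power (edge_ideal E :: ('v, 'k) mpoly set) 3) \<longleftrightarrow>
      (\<forall>a p. (\<forall>v. - 1 \<le> a v) \<and> int p + sum a UNIV > 6 \<longrightarrow>
        vanishes TYPE('k) (box (power_exps adj 3) a (\<lambda>v. a v + 1)) p)" (is "?L \<longleftrightarrow> ?K")
    unfolding ideal_power_eq adj' using linear_resolution_power_iff[of adj, OF edge, of 3] by simp
  have reg: "ideal_reg (edge_ideal E :: ('v, 'k) mpoly set) \<le> 4 \<longleftrightarrow>
      (\<forall>N p. int p > int (card N) + 4 \<longrightarrow> vanishes TYPE('k) {\<sigma>. N \<subseteq> \<sigma> \<and> (\<exists>x\<in>\<sigma>. \<exists>y\<in>\<sigma>. adj x y)} p)"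
    unfolding edge_ideal_eq adj' by (rule ideal_reg_le_iff[of adj, OF irrefl edge]) simp
  have gf: "gap_free E \<longleftrightarrow> (\<forall>a b c d. adj a b \<longrightarrow> adj c d \<longrightarrow> adj a c \<or> adj a d \<or> adj b c \<or> adj b d)"
    unfolding gap_free_iff[OF assms(1)] adj_def ..
  have K_gap_free: "gap_free E" if k: ?K
  proof (rule ccontr)
    assume "\<not> gap_free E"
    then obtain a b c d where e: "adj a b" "adj c d" and no: "\<not> adj a c" "\<not> adj a d" "\<not> adj b c" "\<not> adj b d"
      unfolding gf by blast
    have dist: "distinct [a, b, c, d]" using e no irrefl sym by auto
    \<comment> \<open>The multidegree of the 4-cycle strand. With \<open>n\<close> variables its sum
      is \<open>8 - n\<close>, so in degree \<open>n - 1\<close> the total is 7, just above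
      6.\<close>
    define lo where "lo = (\<lambda>v. if v \<in> {a, b} then 2 else if v \<in> {c, d} then 0 else - 1 :: int)"
    have "lo v = - 1 + (if v = a then 3 else 0) + (if v = b then 3 else 0) + (if v = c then 1 else 0) + (if v = d then 1 else 0)" for v
      unfolding lo_def using dist by auto
    then have "sum lo UNIV = 8 - int (card (UNIV :: 'v set))" by (simp add: sum.distrib sum_subtractf)
    moreover have "card (UNIV :: 'v set) > 0" by (simp add: card_gt_0_iff)
    ultimately have "int (card (UNIV :: 'v set) - 1) + sum lo UNIV > 6" by simp
    moreover have "\<forall>v. - 1 \<le> lo v" unfolding lo_def by simp
    ultimately have "vanishes TYPE('k) (box (power_exps adj 3) lo (\<lambda>v. lo v + 1)) (card (UNIV :: 'v set) - 1)"
      using k by blast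
    then show False
      using gap_not_vanishes[of adj, OF sym irrefl dist e no lo_def] by blast
  qed
  \<comment> \<open>For a gap-free graph both conditions become statements about vertex sets: Koszul
    boxes pass to Cech boxes, and these are compared with the strands of the edge ideal.\<close>
  have "?K \<longleftrightarrow> ideal_reg (edge_ideal E :: ('v, 'k) mpoly set) \<le> 4" if g: "gap_free E"
  proof -
    interpret gap_free_graph adj
      using sym irrefl g unfolding gf by unfold_locales blast+
    have "{\<sigma>. N \<subseteq> \<sigma> \<and> \<not> edgeless \<sigma>} = {\<sigma>. N \<subseteq> \<sigma> \<and> (\<exists>x\<in>\<sigma>. \<exists>y\<in>\<sigma>. adj x y)}" for N
      unfolding edgeless_def by blast
    then show ?thesis
      unfolding reg vanishes_koszul_iff_cech[OF up_exps_power_exps, where b = 3] vanishes_cube_iff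
      by (simp add: of_nat_less_iff[symmetric, where 'a = int] del: of_nat_less_iff)
  qed
  then show ?thesis unfolding K using K_gap_free by blast
qed

end
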